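(* Let $\Omega\subset\mathbb{R}^n$ be a bounded domain with Lipschitz boundary, let $c:\overline\Omega\times\mathbb{R}\to[0,+\infty]$ be a (heterogeneous) cost function, and let $f\in\mathrm{Adm}_c$. Then the set $$\mathscr M_{\rm opt}=\Big\{\mu_{\rm opt}\in\mathscr M^+(\overline\Omega):\ \mathcal J_{c,f}(\mu_{\rm opt})=\inf_{\mu\in\mathscr M^+(\overline\Omega)}\mathcal J_{c,f}(\mu)\Big\}$$ is nonempty. Moreover, there exists $\mathbf k>0$ such that for every $\mu_{\rm opt}\in\mathscr M_{\rm opt}$ and every $k\in\mathbb{N}$ with $k\ge\mathbf k$, $$\inf_{u\in\mathscr D(\Omega)}\big(\mathcal F_f(\mu_{\rm opt},u)-\mathcal C(\mu_{\rm opt})\big)=\inf_{u\in\mathscr D(\Omega)}\ \sup_{\mu\in\mathscr K_k^+(\overline\Omega)}\big(\mathcal F_f(\mu,u)-\mathcal C(\mu)\big),$$ where $\mathscr K_k^+(\overline\Omega)=\{\mu\in\mathscr M^+(\overline\Omega):\ \mu(\overline\Omega)\le k\}$.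
   Context: $\mathscr M(\overline\Omega)$ (resp. $\mathscr M^+(\overline\Omega)$): finite real-valued (resp. non-negative) Borel measures on $\mathbb{R}^n$ supported in $\overline\Omega$. $\mathscr D(\Omega)$: smooth functions with compact support in $\Omega$. $\mathscr D'(\overline\Omega)$: distributions on $\mathbb{R}^n$ with support contained in $\overline\Omega$. For a function $g:\mathbb{R}\to\mathbb{R}\cup\{+\infty\}$ convex and proper, the recession function is $g^\infty(t)=\lim_{s\to+\infty}g(t_0+st)/s$ (any $t_0$ with $g(t_0)<+\infty$), and $g^*(s)=\sup_t\{st-g(t)\}$. For $c=c(x,t)$, $c^\infty(x,\cdot)=(c(x,\cdot))^\infty$ and $c^*(x,\cdot)=(c(x,\cdot))^*$. (Heterogeneous) cost function: a normal convex integrand $c:\overline\Omega\times\mathbb{R}\to[0,+\infty]$ (i.e. Borel measurable, with $c(x,\cdot)$ lower semicontinuous and convex for $\mathcal L^n$-a.e. $x$) satisfying: (P1) for some $\alpha>0$, $\beta\in\mathbb{R}$: $c(x,t)\ge\alpha t+\beta$ for all $x\in\overline\Omega$, $t\ge0$; and $c(x,t)=+\infty$ for all $x\in\overline\Omega$, $t<0$; (P2) there exist $a_0\in L^\infty(\Omega)$ and $\lambda_0>0$ with $a_0\ge\lambda_0$ $\mathcal L^n$-a.e. in $\Omega$ and $c(\cdot,a_0(\cdot))\in L^1(\Omega)$; (P3) $c^*(\cdot,t)$ and $c^\infty(\cdot,t)$ are upper semicontinuous for all $t\in\mathbb{R}$. Cost functional: for $\mu=a\mathcal L^n+\mu^s\in\mathscr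 M(\overline\Omega)$ (Lebesgue decomposition), $\mathcal C(\mu)=\int_\Omega c(x,a(x))\,dx+\int c^\infty\big(x,\frac{d\mu^s}{d|\mu^s|}\big)\,d|\mu^s|(x)$. For $f\in\mathscr D'(\overline\Omega)$: $\mathcal F_f(\mu,u)=\frac12\int|\nabla u|^2\,d\mu-\langle f,u\rangle$; $\mathcal E_f(\mu)=\inf_{u\in\mathscr D(\Omega)}\mathcal F_f(\mu,u)$ if $\mu\in\mathscr M^+(\overline\Omega)$ and $\mathcal E_f(\mu)=-\infty$ otherwise; $\mathcal J_{c,f}(\mu)=-\mathcal E_f(\mu)+\mathcal C(\mu)$ for $\mu\in\mathscr M(\overline\Omega)$. $\mathrm{Adm}_c=\{f\in\mathscr D'(\overline\Omega):\ \mathcal J_{c,f}(\mu)<+\infty\text{ for some }\mu\in\mathscr M(\overline\Omega)\}$. *)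

theory Defs
  imports "HOL-Analysis.Analysis"
begin

section \<open>Lipschitz domains\<close>

(* Near every boundary point, and after a rotation taking the last coordinate axis to the unit
   vector e, the set is the strict epigraph of a Lipschitz function of the remaining coordinates
   (the hyperplane orthogonal to e). *)
definition lipschitz_boundary :: "'a::euclidean_space set \<Rightarrow> bool" where
  "lipschitz_boundary \<Omega> \<longleftrightarrow>
     (\<forall>p\<in>frontier \<Omega>. \<exists>e \<phi> L U.
        norm e = 1 \<and> L-lipschitz_on {z. z \<bullet> e = 0} \<phi> \<and> open U \<and> p \<in> U \<and>
        \<Omega> \<inter> U = {y \<in> U. \<phi> (y - (y \<bullet> e) *\<^sub>R e) < y \<bullet> e})"

definition bounded_lipschitz_domain :: "'a::euclidean_space set \<Rightarrow> bool" where
  "bounded_lipschitz_domain \<Omega> \<longleftrightarrow>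
     open \<Omega> \<and> connected \<Omega> \<and> \<Omega> \<noteq> {} \<and> bounded \<Omega> \<and> lipschitz_boundary \<Omega>"


section \<open>Test functions and distributions\<close>

definition partial_deriv :: "'a::euclidean_space \<Rightarrow> ('a \<Rightarrow> real) \<Rightarrow> 'a \<Rightarrow> real" where
  "partial_deriv b u x = frechet_derivative u (at x) b"

definition grad :: "('a::euclidean_space \<Rightarrow> real) \<Rightarrow> 'a \<Rightarrow> 'a" where
  "grad u x = (\<Sum>b\<in>Basis. partial_deriv b u x *\<^sub>R b)"

(* A list of basis vectors plays the role of a multi-index. *)
definition iter_partial :: "'a::euclidean_space list \<Rightarrow> ('a \<Rightarrow> real) \<Rightarrow> 'a \<Rightarrow> real" where
  "iter_partial bs u = foldr partial_deriv bs u"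

definition smooth :: "('a::euclidean_space \<Rightarrow> real) \<Rightarrow> bool" where
  "smooth u \<longleftrightarrow> (\<forall>bs\<in>lists Basis. \<forall>x. iter_partial bs u differentiable (at x))"

definition supp :: "('a::euclidean_space \<Rightarrow> real) \<Rightarrow> 'a set" where
  "supp u = closure {x. u x \<noteq> 0}"

definition test_functions :: "'a::euclidean_space set \<Rightarrow> ('a \<Rightarrow> real) set" where
  "test_functions \<Omega> = {u. smooth u \<and> compact (supp u) \<and> supp u \<subseteq> \<Omega>}"

(* Distributions are only used through their values on test functions; the values of f on other
   functions are irrelevant. *)
definition distribution :: "(('a::euclidean_space \<Rightarrow> real) \<Rightarrow> real) \<Rightarrow> bool" where
  "distribution f \<longleftrightarrow>
     (\<forall>u\<in>test_functions UNIV. \<forall>v\<in>test_functions UNIV. f (\<lambda>x. u x + v x) = f u + f v) \<and>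
     (\<forall>r. \<forall>u\<in>test_functions UNIV. f (\<lambda>x. r * u x) = r * f u) \<and>
     (\<forall>K. compact K \<longrightarrow>
        (\<exists>C N. \<forall>u\<in>test_functions UNIV. supp u \<subseteq> K \<longrightarrow>
           \<bar>f u\<bar> \<le> C * (\<Sum>bs | bs \<in> lists Basis \<and> length bs \<le> N.
                            SUP x. \<bar>iter_partial bs u x\<bar>)))"

definition distributions_in ::
    "'a::euclidean_space set \<Rightarrow> (('a \<Rightarrow> real) \<Rightarrow> real) set" where
  "distributions_in K =
     {f. distribution f \<and> (\<forall>u\<in>test_functions UNIV. supp u \<inter> K = {} \<longrightarrow> f u = 0)}"


section \<open>Finite signed Borel measures\<close>

(* A finite signed measure is a countably additive real set function on the Borel sets,
   extended by 0 to the other sets. *)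
definition signed_measure :: "('a::euclidean_space set \<Rightarrow> real) \<Rightarrow> bool" where
  "signed_measure \<nu> \<longleftrightarrow>
     (\<forall>A. A \<notin> sets borel \<longrightarrow> \<nu> A = 0) \<and>
     (\<forall>A::nat \<Rightarrow> 'a set. range A \<subseteq> sets borel \<longrightarrow> disjoint_family A \<longrightarrow>
        (\<lambda>i. \<nu> (A i)) sums \<nu> (\<Union>i. A i))"

definition measures_in :: "'a::euclidean_space set \<Rightarrow> ('a set \<Rightarrow> real) set" where
  "measures_in K =
     {\<nu>. signed_measure \<nu> \<and> (\<forall>A\<in>sets borel. A \<inter> K = {} \<longrightarrow> \<nu> A = 0)}"

definition pos_measures_in :: "'a::euclidean_space set \<Rightarrow> ('a set \<Rightarrow> real) set" where
  "pos_measures_in K = {\<nu> \<in> measures_in K. \<forall>A. 0 \<le> \<nu> A}"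

(* Jordan decomposition: upper and lower variation; the total variation is their sum. *)
definition pos_part :: "('a::euclidean_space set \<Rightarrow> real) \<Rightarrow> 'a measure" where
  "pos_part \<nu> =
     measure_of UNIV (sets borel) (\<lambda>A. SUP B\<in>{B \<in> sets borel. B \<subseteq> A}. ennreal (\<nu> B))"

definition neg_part :: "('a::euclidean_space set \<Rightarrow> real) \<Rightarrow> 'a measure" where
  "neg_part \<nu> = pos_part (\<lambda>A. - \<nu> A)"

definition variation :: "('a::euclidean_space set \<Rightarrow> real) \<Rightarrow> 'a measure" where
  "variation \<nu> = measure_of UNIV (sets borel)
     (\<lambda>A. emeasure (pos_part \<nu>) A + emeasure (neg_part \<nu>) A)"

definition signed_integral :: "('a::euclidean_space set \<Rightarrow> real) \<Rightarrow> ('a \<Rightarrow> real) \<Rightarrow> real" where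
  "signed_integral \<nu> g = (\<integral>x. g x \<partial>pos_part \<nu>) - (\<integral>x. g x \<partial>neg_part \<nu>)"

definition lebesgue_decomposition ::
    "('a::euclidean_space set \<Rightarrow> real) \<Rightarrow> ('a \<Rightarrow> real) \<Rightarrow> ('a set \<Rightarrow> real) \<Rightarrow> bool" where
  "lebesgue_decomposition \<nu> a \<nu>s \<longleftrightarrow>
     integrable lborel a \<and> signed_measure \<nu>s \<and>
     (\<exists>N\<in>null_sets lborel. \<forall>A\<in>sets borel. A \<inter> N = {} \<longrightarrow> \<nu>s A = 0) \<and>
     (\<forall>A\<in>sets borel. \<nu> A = set_lebesgue_integral lborel A a + \<nu>s A)"

definition ac_density :: "('a::euclidean_space set \<Rightarrow> real) \<Rightarrow> 'a \<Rightarrow> real" where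
  "ac_density \<nu> = (SOME a. \<exists>\<nu>s. lebesgue_decomposition \<nu> a \<nu>s)"

definition singular_part :: "('a::euclidean_space set \<Rightarrow> real) \<Rightarrow> 'a set \<Rightarrow> real" where
  "singular_part \<nu> = (THE \<nu>s. \<exists>a. lebesgue_decomposition \<nu> a \<nu>s)"

(* The Radon-Nikodym derivative of a signed measure with respect to its total variation. *)
definition polar_density :: "('a::euclidean_space set \<Rightarrow> real) \<Rightarrow> 'a \<Rightarrow> real" where
  "polar_density \<nu> = (SOME h. integrable (variation \<nu>) h \<and>
     (\<forall>A\<in>sets borel. \<nu> A = set_lebesgue_integral (variation \<nu>) A h))"


section \<open>Extended-real convex functions\<close>

definition convex_fun :: "(real \<Rightarrow> ereal) \<Rightarrow> bool" where
  "convex_fun g \<longleftrightarrow>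
     (\<forall>s t l. 0 < l \<and> l < 1 \<longrightarrow>
        g ((1 - l) * s + l * t) \<le> ereal (1 - l) * g s + ereal l * g t)"

definition lsc_fun :: "('b::topological_space \<Rightarrow> ereal) \<Rightarrow> bool" where
  "lsc_fun g \<longleftrightarrow> (\<forall>t. g t \<le> Liminf (at t) g)"

definition usc_on :: "'b::topological_space set \<Rightarrow> ('b \<Rightarrow> ereal) \<Rightarrow> bool" where
  "usc_on S g \<longleftrightarrow> (\<forall>x\<in>S. Limsup (at x within S) g \<le> g x)"

definition conj_fun :: "(real \<Rightarrow> ereal) \<Rightarrow> real \<Rightarrow> ereal" where
  "conj_fun g s = (SUP t. ereal (s * t) - g t)"

(* For convex proper g this is lim (g (t0 + s * t) / s) for any t0 with g t0 finite, see
   recession_tendsto below. The lower limit and the infimum over t0 only serve to give a value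
   to functions that are not convex and proper: an integrand is required to be convex in its
   second argument merely for almost every x, whereas the recession function is also evaluated
   on Lebesgue null sets. *)
definition recession :: "(real \<Rightarrow> ereal) \<Rightarrow> real \<Rightarrow> ereal" where
  "recession g t =
     (INF t0\<in>{t0. g t0 < \<infinity>}. Liminf at_top (\<lambda>s. g (t0 + s * t) / ereal s))"

lemma convex_quotient_mono:
  assumes cv: "convex_fun g" and np: "\<And>t. - \<infinity> < g t" and fin: "g t0 < \<infinity>"
    and s: "0 < s" "s \<le> s'"
  shows "(g (t0 + s * t) - g t0) / ereal s \<le> (g (t0 + s' * t) - g t0) / ereal s'"
proof (cases "s = s' \<or> g (t0 + s' * t) = \<infinity>")
  case True
  obtain p where p: "g t0 = ereal p" using fin np[of t0] by (cases "g t0") auto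
  show ?thesis using True s p by auto
next
  case False
  obtain p where p: "g t0 = ereal p" using fin np[of t0] by (cases "g t0") auto
  obtain q where q: "g (t0 + s' * t) = ereal q"
    using False np[of "t0 + s' * t"] by (cases "g (t0 + s' * t)") auto
  define l where "l = s / s'"
  have l: "0 < l" "l < 1" using s False by (auto simp: l_def)
  have e: "(1 - l) * t0 + l * (t0 + s' * t) = t0 + s * t"
    using s by (simp add: l_def field_simps)
  have le: "g (t0 + s * t) \<le> ereal ((1 - l) * p + l * q)"
    using cv[unfolded convex_fun_def, rule_format, OF conjI[OF l], of t0 "t0 + s' * t"]
    unfolding e p q by simp
  obtain r where r: "g (t0 + s * t) = ereal r"
    using le np[of "t0 + s * t"] by (cases "g (t0 + s * t)") auto
  have "r \<le> (1 - l) * p + l * q" using le r by simp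
  hence "r - p \<le> l * (q - p)" by (simp add: algebra_simps)
  hence "(r - p) / s \<le> (q - p) / s'" using s by (simp add: l_def field_simps)
  thus ?thesis using s by (simp add: p q r)
qed

lemma convex_quotient_tendsto:
  assumes cv: "convex_fun g" and np: "\<And>t. - \<infinity> < g t" and fin: "g t0 < \<infinity>"
  shows "\<exists>L. ((\<lambda>s. g (t0 + s * t) / ereal s) \<longlongrightarrow> L) at_top"
proof -
  obtain p where p: "g t0 = ereal p" using fin np[of t0] by (cases "g t0") auto
  define q where "q s = (g (t0 + s * t) - g t0) / ereal s" for s
  define L where "L = (SUP s\<in>{0<..}. q s)"
  have mono: "q s \<le> q s'" if "0 < s" "s \<le> s'" for s s'
    unfolding q_def by (rule convex_quotient_mono[OF cv np fin that])
  have lim: "(q \<longlongrightarrow> L) at_top"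
  proof (rule order_tendstoI)
    fix a assume "a < L"
    then obtain s where s: "0 < s" "a < q s" by (auto simp: L_def less_SUP_iff)
    show "\<forall>\<^sub>F x in at_top. a < q x"
      using eventually_ge_at_top[of s] by eventually_elim (use s mono in \<open>metis less_le_trans\<close>)
  next
    fix a assume a: "L < a"
    have "q x < a" if "x > 0" for x
      using a that by (auto simp: L_def intro: le_less_trans[OF SUP_upper])
    thus "\<forall>\<^sub>F x in at_top. q x < a"
      by (rule eventually_mono[OF eventually_gt_at_top[of 0]])
  qed
  have "((\<lambda>s. p / s) \<longlongrightarrow> 0) at_top"
    by (rule tendsto_divide_0[OF tendsto_const])
       (auto intro: filterlim_at_top_imp_at_infinity filterlim_ident)
  hence lim0: "((\<lambda>s. ereal (p / s)) \<longlongrightarrow> 0) at_top"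
    by (simp add: zero_ereal_def)
  have "((\<lambda>s. q s + ereal (p / s)) \<longlongrightarrow> L + 0) at_top"
    by (rule tendsto_add_ereal_general[OF _ lim lim0]) auto
  moreover have "\<forall>\<^sub>F s in at_top. q s + ereal (p / s) = g (t0 + s * t) / ereal s"
    using eventually_gt_at_top[of 0]
  proof eventually_elim
    case (elim s)
    show ?case
      using elim np[of "t0 + s * t"]
      by (cases "g (t0 + s * t)") (auto simp: q_def p field_simps)
  qed
  ultimately have "((\<lambda>s. g (t0 + s * t) / ereal s) \<longlongrightarrow> L + 0) at_top"
    by (rule Lim_transform_eventually)
  thus ?thesis by blast
qed

lemma quotient_tendsto_shift:
  assumes L: "((\<lambda>s. g (t0 + s * t) / ereal s) \<longlongrightarrow> L) at_top"
    and np: "\<And>t. - \<infinity> < g t" and fin: "g t0 < \<infinity>" "g t1 < \<infinity>"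
  shows "((\<lambda>s. g (t1 + s * t) / ereal s) \<longlongrightarrow> L) at_top"
proof (cases "t = 0")
  case True
  have z: "((\<lambda>s. g u / ereal s) \<longlongrightarrow> 0) at_top" if gu: "g u < \<infinity>" for u
  proof -
    obtain p where p: "g u = ereal p" using gu np[of u] by (cases "g u") auto
    have "((\<lambda>s. p / s) \<longlongrightarrow> 0) at_top"
      by (rule tendsto_divide_0[OF tendsto_const])
         (auto intro: filterlim_at_top_imp_at_infinity filterlim_ident)
    hence "((\<lambda>s. ereal (p / s)) \<longlongrightarrow> 0) at_top" by (simp add: zero_ereal_def)
    moreover have "\<forall>\<^sub>F s in at_top. ereal (p / s) = g u / ereal s"
      using eventually_gt_at_top[of 0] by eventually_elim (simp add: p)
    ultimately show ?thesis by (rule Lim_transform_eventually)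
  qed
  have "L = 0" using tendsto_unique[OF _ L[unfolded True, simplified] z[OF fin(1)]] by simp
  thus ?thesis using z[OF fin(2)] True by simp
next
  case False
  define d where "d = (t1 - t0) / t"
  have sh: "filterlim (\<lambda>s. d + s) at_top (at_top :: real filter)"
    by (rule filterlim_tendsto_add_at_top[OF tendsto_const filterlim_ident])
  have 1: "((\<lambda>s. g (t0 + (d + s) * t) / ereal (d + s)) \<longlongrightarrow> L) at_top"
    by (rule filterlim_compose[OF L sh])
  have "((\<lambda>s. 1 + d / s) \<longlongrightarrow> 1 + 0) at_top"
    by (intro tendsto_add tendsto_const tendsto_divide_0[OF tendsto_const])
       (auto intro: filterlim_at_top_imp_at_infinity filterlim_ident)
  hence 2: "((\<lambda>s. ereal (1 + d / s)) \<longlongrightarrow> ereal 1) at_top" by simp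
  have "((\<lambda>s. ereal (1 + d / s) * (g (t0 + (d + s) * t) / ereal (d + s))) \<longlongrightarrow> ereal 1 * L) at_top"
    by (rule tendsto_mult_ereal[OF 2 1]) auto
  moreover have "\<forall>\<^sub>F s in at_top.
      ereal (1 + d / s) * (g (t0 + (d + s) * t) / ereal (d + s)) = g (t1 + s * t) / ereal s"
    using eventually_gt_at_top[of "\<bar>d\<bar>"]
  proof eventually_elim
    case (elim s)
    have s: "0 < s" "0 < d + s" using elim by auto
    have e: "t0 + (d + s) * t = t1 + s * t" using False by (simp add: d_def field_simps)
    have pos: "0 < 1 + d / s" using s by (simp add: field_simps)
    have "(1 + d / s) * (r / (d + s)) = r / s" for r
    proof -
      have "1 + d / s = (d + s) / s" using s by (simp add: field_simps)
      thus ?thesis using s by simp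
    qed
    thus ?case
      unfolding e using s pos np[of "t1 + s * t"]
      by (cases "g (t1 + s * t)") auto
  qed
  ultimately have "((\<lambda>s. g (t1 + s * t) / ereal s) \<longlongrightarrow> ereal 1 * L) at_top"
    by (rule Lim_transform_eventually)
  thus ?thesis by (simp add: one_ereal_def[symmetric])
qed

lemma recession_tendsto:
  assumes cv: "convex_fun g" and np: "\<And>t. - \<infinity> < g t" and fin: "g t0 < \<infinity>"
  shows "((\<lambda>s. g (t0 + s * t) / ereal s) \<longlongrightarrow> recession g t) at_top"
proof -
  obtain L where L: "((\<lambda>s. g (t0 + s * t) / ereal s) \<longlongrightarrow> L) at_top"
    using convex_quotient_tendsto[OF cv np fin] by blast
  have "Liminf at_top (\<lambda>s. g (t1 + s * t) / ereal s) = L" if "g t1 < \<infinity>" for t1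
    by (rule lim_imp_Liminf[OF _ quotient_tendsto_shift[OF L np fin that]]) simp
  hence "recession g t = (INF t1\<in>{t1. g t1 < \<infinity>}. L)"
    unfolding recession_def by (intro INF_cong) auto
  also have "\<dots> = L" using fin by (intro INF_const) auto
  finally show ?thesis using L by simp
qed


section \<open>Cost functions\<close>

(* Only the values c x t with x in the closure of the domain matter. *)
definition normal_convex_integrand ::
    "'a::euclidean_space set \<Rightarrow> ('a \<Rightarrow> real \<Rightarrow> ereal) \<Rightarrow> bool" where
  "normal_convex_integrand \<Omega> c \<longleftrightarrow>
     (\<forall>x\<in>closure \<Omega>. \<forall>t. 0 \<le> c x t) \<and>
     (\<lambda>(x, t). c x t) \<in> borel_measurable (restrict_space borel (closure \<Omega> \<times> UNIV)) \<and>
     (AE x in lebesgue_on (closure \<Omega>). lsc_fun (c x) \<and> convex_fun (c x))"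

definition cost_function ::
    "'a::euclidean_space set \<Rightarrow> ('a \<Rightarrow> real \<Rightarrow> ereal) \<Rightarrow> bool" where
  "cost_function \<Omega> c \<longleftrightarrow>
     normal_convex_integrand \<Omega> c \<and>
     (\<exists>\<alpha> \<beta>. 0 < \<alpha> \<and>
        (\<forall>x\<in>closure \<Omega>. \<forall>t\<ge>0. ereal (\<alpha> * t + \<beta>) \<le> c x t)) \<and>
     (\<forall>x\<in>closure \<Omega>. \<forall>t<0. c x t = \<infinity>) \<and>
     (\<exists>a\<^sub>0 l\<^sub>0. a\<^sub>0 \<in> borel_measurable (lebesgue_on \<Omega>) \<and>
        (\<exists>M. AE x in lebesgue_on \<Omega>. \<bar>a\<^sub>0 x\<bar> \<le> M) \<and>
        0 < l\<^sub>0 \<and> (AE x in lebesgue_on \<Omega>. l\<^sub>0 \<le> a\<^sub>0 x) \<and>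
        (\<integral>\<^sup>+x. e2ennreal (c x (a\<^sub>0 x)) \<partial>lebesgue_on \<Omega>) < \<infinity>) \<and>
     (\<forall>t. usc_on (closure \<Omega>) (\<lambda>x. conj_fun (c x) t)) \<and>
     (\<forall>t. usc_on (closure \<Omega>) (\<lambda>x. recession (c x) t))"

definition cost_functional ::
    "'a::euclidean_space set \<Rightarrow> ('a \<Rightarrow> real \<Rightarrow> ereal) \<Rightarrow> ('a set \<Rightarrow> real) \<Rightarrow> ereal" where
  "cost_functional \<Omega> c \<mu> = enn2ereal
     ((\<integral>\<^sup>+x. e2ennreal (c x (ac_density \<mu> x)) \<partial>lebesgue_on \<Omega>) +
      (\<integral>\<^sup>+x. e2ennreal (recession (c x) (polar_density (singular_part \<mu>) x))
         \<partial>variation (singular_part \<mu>)))"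


section \<open>Energies and optimal measures\<close>

definition energy_F ::
    "(('a::euclidean_space \<Rightarrow> real) \<Rightarrow> real) \<Rightarrow> ('a set \<Rightarrow> real) \<Rightarrow> ('a \<Rightarrow> real) \<Rightarrow> real" where
  "energy_F f \<mu> u = 1 / 2 * signed_integral \<mu> (\<lambda>x. (norm (grad u x))\<^sup>2) - f u"

definition energy_E ::
    "'a::euclidean_space set \<Rightarrow> (('a \<Rightarrow> real) \<Rightarrow> real) \<Rightarrow> ('a set \<Rightarrow> real) \<Rightarrow> ereal" where
  "energy_E \<Omega> f \<mu> =
     (if \<mu> \<in> pos_measures_in (closure \<Omega>)
      then INF u\<in>test_functions \<Omega>. ereal (energy_F f \<mu> u) else - \<infinity>)"

definition total_J ::
    "'a::euclidean_space set \<Rightarrow> ('a \<Rightarrow> real \<Rightarrow> ereal) \<Rightarrow> (('a \<Rightarrow> real) \<Rightarrow> real) \<Rightarrow>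
     ('a set \<Rightarrow> real) \<Rightarrow> ereal" where
  "total_J \<Omega> c f \<mu> = - energy_E \<Omega> f \<mu> + cost_functional \<Omega> c \<mu>"

definition Adm ::
    "'a::euclidean_space set \<Rightarrow> ('a \<Rightarrow> real \<Rightarrow> ereal) \<Rightarrow> (('a \<Rightarrow> real) \<Rightarrow> real) set" where
  "Adm \<Omega> c =
     {f \<in> distributions_in (closure \<Omega>).
        \<exists>\<mu>\<in>measures_in (closure \<Omega>). total_J \<Omega> c f \<mu> < \<infinity>}"

definition M_opt ::
    "'a::euclidean_space set \<Rightarrow> ('a \<Rightarrow> real \<Rightarrow> ereal) \<Rightarrow> (('a \<Rightarrow> real) \<Rightarrow> real) \<Rightarrow>
     ('a set \<Rightarrow> real) set" where
  "M_opt \<Omega> c f =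
     {\<mu> \<in> pos_measures_in (closure \<Omega>).
        total_J \<Omega> c f \<mu> = (INF \<nu>\<in>pos_measures_in (closure \<Omega>). total_J \<Omega> c f \<nu>)}"

definition K_pos :: "'a::euclidean_space set \<Rightarrow> nat \<Rightarrow> ('a set \<Rightarrow> real) set" where
  "K_pos \<Omega> k = {\<mu> \<in> pos_measures_in (closure \<Omega>). \<mu> (closure \<Omega>) \<le> real k}"

end

theory Submission
  imports Defs
begin

text \<open>The idea is to rewrite both claims as statements about a function that is affine and continuous in
the measure, on a compact set of measures.

Duality for the cost. Call (\<phi>, b) an affine minorant of c if \<phi> is continuous on the whole space, b is
integrable, \<phi>(x) t - b(x) \<le> c(x, t) for almost every x in \<Omega>, and \<phi> is at most the recession slope
of c on the closure of \<Omega>. For every non-negative measure \<mu> on the closure of \<Omega>, the cost C(\<mu>) is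
the supremum of \<integral> \<phi> d\<mu> - \<integral> b dx over all affine minorants (minorant_le_cost and
cost_le_of_minorants). Hence -J(\<mu>) is the infimum over u and (\<phi>, b) of

  1/2 \<integral> |grad u|^2 d\<mu> - f(u) - \<integral> \<phi> d\<mu> + \<integral> b dx,

the payoff, which is affine in \<mu>, depends on \<mu> only through integrals of continuous functions, and
is convex in the strategy (u, \<phi>, b).

Compactness. Integration against \<mu> is a positive functional on continuous functions. The positive
functionals L with L(1) \<le> k form a compact convex set in the product topology, by Tychonoff's theorem
(compact_bounded_functionals), and each of them is integration against a measure, by the Riesz
representation theorem (riesz_representation). So no information is lost by replacing measures of
mass at most k by functionals.

Coercivity. The linear growth of c makes (\<alpha>, -\<beta>) an affine minorant with \<alpha> > 0, so J(\<mu>) bounds the mass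
of \<mu> (total_J_mass_bound). A minimising sequence therefore stays in a compact set, on which the
sublevel sets of J are closed; this yields an optimal measure. For the same reason all optimal
measures have mass at most some fixed number, and once k exceeds it, the supremum over measures of
mass at most k of the infimum over strategies equals -min J.

Exchange. A minimax theorem of Fan's type (compact_minimax) shows that for any v > -min J some
strategy (u, \<phi>, b) has payoff at most v against all measures of mass at most k, since otherwise some
measure would have J \<le> -v < min J. Dropping (\<phi>, b) in favour of the supremum C(\<mu>) gives the
asserted equality, both sides being -min J.

The hard half of the duality, that minorants exhaust the cost, combines three facts. Where
c*(x, q) is finite, t \<mapsto> q t - c*(x, q) is a minorant at x, and upper semicontinuity of c*(., q)
makes {c*(., q) < n} relatively open, so that this line can be cut off continuously. Countably many
such localised lines recover c (by convex duality in one variable) and the recession slope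
everywhere on the closure. Finally, minorants may be blended with continuous weights, which
approximate indicators of Borel sets, so finite pointwise maxima of gains are attained up to \<epsilon>.
The Lipschitz boundary enters because it is Lebesgue null: otherwise absolutely continuous mass on
the boundary would be free of charge.\<close>

section \<open>A minimax theorem on compact sets\<close>

text \<open>The region {(y1, y2). y1 \<le> f x, y2 \<le> g x for some x} is convex because f and g are jointly
concave-like, and it misses the open quadrant above (v, v). The normal of a separating line,
scaled to coordinate sum 1, is the convex combination sought.\<close>

lemma two_function_minimax:
  fixes f g :: "'x \<Rightarrow> real"
  assumes concave: "\<And>x1 x2 l. x1 \<in> X \<Longrightarrow> x2 \<in> X \<Longrightarrow> 0 \<le> l \<Longrightarrow> l \<le> 1 \<Longrightarrow>
      \<exists>x\<in>X. (1 - l) * f x1 + l * f x2 \<le> f x \<and> (1 - l) * g x1 + l * g x2 \<le> g x"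
    and le: "\<And>x. x \<in> X \<Longrightarrow> f x \<le> v \<or> g x \<le> v"
  shows "\<exists>l. 0 \<le> l \<and> l \<le> 1 \<and> (\<forall>x\<in>X. (1 - l) * f x + l * g x \<le> v)"
proof (cases "X = {}")
  case True
  then show ?thesis by (intro exI[of _ 0]) auto
next
  case False
  define S where "S = {z. \<exists>x\<in>X. fst z \<le> f x \<and> snd z \<le> g x}"
  define T where "T = {z::real \<times> real. v < fst z \<and> v < snd z}"
  have "convex S"
  proof (rule convexI)
    fix z w u u' assume z: "z \<in> S" and w: "w \<in> S" and u: "0 \<le> (u::real)" "0 \<le> u'" "u + u' = 1"
    obtain x1 x2 where x1: "x1 \<in> X" "fst z \<le> f x1" "snd z \<le> g x1"
      and x2: "x2 \<in> X" "fst w \<le> f x2" "snd w \<le> g x2"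
      using z w unfolding S_def by blast
    have u1: "u = 1 - u'" "u' \<le> 1" using u by auto
    obtain x where x: "x \<in> X" "(1 - u') * f x1 + u' * f x2 \<le> f x" "(1 - u') * g x1 + u' * g x2 \<le> g x"
      using concave[OF x1(1) x2(1) u(2) u1(2)] by blast
    have "u * fst z + u' * fst w \<le> (1 - u') * f x1 + u' * f x2"
      unfolding u1(1)[symmetric] by (intro add_mono mult_left_mono x1 x2 u)
    moreover have "u * snd z + u' * snd w \<le> (1 - u') * g x1 + u' * g x2"
      unfolding u1(1)[symmetric] by (intro add_mono mult_left_mono x1 x2 u)
    ultimately show "u *\<^sub>R z + u' *\<^sub>R w \<in> S"
      unfolding S_def using x by (auto intro!: bexI[of _ x])
  qed
  moreover have "convex T"
  proof -
    have "T = {v<..} \<times> {v<..}" by (auto simp: T_def)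
    thus ?thesis by (simp add: convex_Times)
  qed
  moreover have "S \<noteq> {}" using False by (auto simp: S_def)
  moreover have "T \<noteq> {}"
  proof -
    have "(v + 1, v + 1) \<in> T" by (simp add: T_def)
    thus ?thesis by blast
  qed
  moreover have "S \<inter> T = {}" using le by (fastforce simp: S_def T_def)
  ultimately obtain p b where p: "p \<noteq> 0" and S: "\<forall>z\<in>S. inner p z \<le> b" and T: "\<forall>z\<in>T. b \<le> inner p z"
    using separating_hyperplane_sets[of S T] by blast
  obtain p1 p2 where p12: "p = (p1, p2)" by (cases p)
  obtain x0 where x0: "x0 \<in> X" using False by blast
  have S': "p1 * a + p2 * c \<le> b" if "x \<in> X" "a \<le> f x" "c \<le> g x" for x a c
    using S[rule_format, of "(a, c)"] that by (auto simp: S_def p12)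
  (* S is closed downwards, so a functional bounded above on S has non-negative coefficients. *)
  have nonneg: "0 \<le> r" if H: "\<And>t. 0 \<le> t \<Longrightarrow> q - t * r \<le> b" for q r :: real
  proof (rule ccontr)
    assume r: "\<not> 0 \<le> r"
    have "q - (max 0 ((b - q + 1) / (- r))) * r \<le> b" by (rule H) simp
    moreover have "(max 0 ((b - q + 1) / (- r))) * (- r) \<ge> (b - q + 1) / (- r) * (- r)"
      using r by (intro mult_right_mono) auto
    ultimately show False using r by auto
  qed
  have "0 \<le> p1"
    by (rule nonneg[of "p1 * f x0 + p2 * g x0"])
       (use S'[OF x0, of "f x0 - _" "g x0"] in \<open>force simp: algebra_simps\<close>)
  moreover have "0 \<le> p2"
    by (rule nonneg[of "p1 * f x0 + p2 * g x0"])
       (use S'[OF x0, of "f x0" "g x0 - _"] in \<open>force simp: algebra_simps\<close>)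
  ultimately have s: "0 \<le> p1" "0 \<le> p2" "0 < p1 + p2" using p by (auto simp: p12 zero_prod_def less_le)
  have "b \<le> (p1 + p2) * v"
  proof (rule field_le_epsilon)
    fix e :: real assume e: "0 < e"
    have "b \<le> inner p (v + e / (p1 + p2), v + e / (p1 + p2))"
      using T e s by (auto simp: T_def)
    also have "\<dots> = (p1 + p2) * v + e * ((p1 + p2) / (p1 + p2))"
      by (simp add: p12 algebra_simps) (simp add: add_divide_distrib[symmetric] distrib_left[symmetric])
    finally show "b \<le> (p1 + p2) * v + e" using s by simp
  qed
  hence bnd: "p1 * f x + p2 * g x \<le> (p1 + p2) * v" if "x \<in> X" for x
    using S'[OF that, of "f x" "g x"] by simp
  define l where "l = p2 / (p1 + p2)"
  have l1: "1 - l = p1 / (p1 + p2)" using s by (simp add: l_def field_simps)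
  have "(1 - l) * f x + l * g x \<le> v" if "x \<in> X" for x
  proof -
    have "(1 - l) * f x + l * g x = (p1 * f x + p2 * g x) / (p1 + p2)"
      unfolding l1 unfolding l_def by (simp add: add_divide_distrib)
    also have "\<dots> \<le> v" using bnd[OF that] s by (simp add: pos_divide_le_eq mult.commute)
    finally show ?thesis .
  qed
  moreover have "0 \<le> l" "l \<le> 1" using s by (auto simp: l_def)
  ultimately show ?thesis by blast
qed

text \<open>Induction on the number of finitely many y. If no x does well against U and w together, then on
the set where h x w \<ge> v the induction hypothesis gives one y that replaces all of U; this y and w
are then merged by the two-function case. Concave-likeness
survives the passage to that subset, since mixing preserves h x w \<ge> v.\<close>

lemma finite_minimax:
  fixes h :: "'x \<Rightarrow> 'y \<Rightarrow> real"
  assumes "finite U" "U \<subseteq> Y" "Y \<noteq> {}"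
    and "\<And>x1 x2 l. x1 \<in> X \<Longrightarrow> x2 \<in> X \<Longrightarrow> 0 \<le> l \<Longrightarrow> l \<le> 1 \<Longrightarrow>
      \<exists>x\<in>X. \<forall>y\<in>Y. (1 - l) * h x1 y + l * h x2 y \<le> h x y"
    and "\<And>y1 y2 l. y1 \<in> Y \<Longrightarrow> y2 \<in> Y \<Longrightarrow> 0 \<le> l \<Longrightarrow> l \<le> 1 \<Longrightarrow>
      \<exists>y\<in>Y. \<forall>x\<in>X. h x y \<le> (1 - l) * h x y1 + l * h x y2"
    and "\<And>x. x \<in> X \<Longrightarrow> \<exists>u\<in>U. h x u < v"
  shows "\<exists>y\<in>Y. \<forall>x\<in>X. h x y \<le> v"
  using assms
proof (induction U arbitrary: X)
  case empty
  from empty.prems(5) have "X = {}" by blast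
  with empty.prems(2) show ?case by blast
next
  case (insert w U)
  note concave = insert.prems(3) and convex = insert.prems(4)
  define X' where "X' = {x\<in>X. v \<le> h x w}"
  have w: "w \<in> Y" using insert.prems by auto
  have "\<exists>y\<in>Y. \<forall>x\<in>X'. h x y \<le> v"
  proof (rule insert.IH)
    show "U \<subseteq> Y" "Y \<noteq> {}" using insert.prems by auto
    show "\<exists>u\<in>U. h x u < v" if "x \<in> X'" for x
      using insert.prems(5)[of x] that by (auto simp: X'_def)
    show "\<exists>y\<in>Y. \<forall>x\<in>X'. h x y \<le> (1 - l) * h x y1 + l * h x y2"
      if "y1 \<in> Y" "y2 \<in> Y" "0 \<le> l" "l \<le> 1" for y1 y2 l
      using convex[OF that] by (auto simp: X'_def)
    fix x1 x2 and l :: real assume x: "x1 \<in> X'" "x2 \<in> X'" and l: "0 \<le> l" "l \<le> 1"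
    obtain x where x': "x \<in> X" "\<forall>y\<in>Y. (1 - l) * h x1 y + l * h x2 y \<le> h x y"
      using concave[of x1 x2 l] x l by (auto simp: X'_def)
    have "(1 - l) * v + l * v \<le> (1 - l) * h x1 w + l * h x2 w"
      using x l by (intro add_mono mult_left_mono) (auto simp: X'_def)
    hence "v \<le> (1 - l) * h x1 w + l * h x2 w" by (simp add: algebra_simps)
    also have "\<dots> \<le> h x w" using x' w by blast
    finally show "\<exists>x\<in>X'. \<forall>y\<in>Y. (1 - l) * h x1 y + l * h x2 y \<le> h x y"
      using x' by (auto simp: X'_def)
  qed
  then obtain y0 where y0: "y0 \<in> Y" "\<And>x. x \<in> X \<Longrightarrow> h x y0 \<le> v \<or> h x w \<le> v"
    unfolding X'_def by force
  have "\<exists>l. 0 \<le> l \<and> l \<le> 1 \<and> (\<forall>x\<in>X. (1 - l) * h x y0 + l * h x w \<le> v)"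
    by (rule two_function_minimax) (use y0 w concave in blast)+
  then obtain l where l: "0 \<le> l" "l \<le> 1" "\<forall>x\<in>X. (1 - l) * h x y0 + l * h x w \<le> v" by blast
  obtain y where "y \<in> Y" "\<forall>x\<in>X. h x y \<le> (1 - l) * h x y0 + l * h x w"
    using convex[OF y0(1) w l(1,2)] by blast
  with l(3) show ?case by (meson order_trans)
qed

text \<open>If every finite family of y leaves some x with all payoffs at least v, the closed sets
{x. v \<le> h x y} have the finite intersection property; otherwise the finite case applies.\<close>

theorem compact_minimax:
  fixes h :: "'x::topological_space \<Rightarrow> 'y \<Rightarrow> real"
  assumes X: "compact X" and Y: "Y \<noteq> {}"
    and cont: "\<And>y. y \<in> Y \<Longrightarrow> continuous_on UNIV (\<lambda>x. h x y)"
    and concave: "\<And>x1 x2 l. x1 \<in> X \<Longrightarrow> x2 \<in> X \<Longrightarrow> 0 \<le> l \<Longrightarrow> l \<le> 1 \<Longrightarrow>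
      \<exists>x\<in>X. \<forall>y\<in>Y. (1 - l) * h x1 y + l * h x2 y \<le> h x y"
    and convex: "\<And>y1 y2 l. y1 \<in> Y \<Longrightarrow> y2 \<in> Y \<Longrightarrow> 0 \<le> l \<Longrightarrow> l \<le> 1 \<Longrightarrow>
      \<exists>y\<in>Y. \<forall>x\<in>X. h x y \<le> (1 - l) * h x y1 + l * h x y2"
  shows "(\<exists>x\<in>X. \<forall>y\<in>Y. v \<le> h x y) \<or> (\<exists>y\<in>Y. \<forall>x\<in>X. h x y \<le> v)"
proof (rule disjCI)
  assume no: "\<not> (\<exists>y\<in>Y. \<forall>x\<in>X. h x y \<le> v)"
  have "X \<inter> (\<Inter>y\<in>Y. {x. v \<le> h x y}) \<noteq> {}"
  proof (rule compact_imp_fip_image[OF X])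
    show "closed {x. v \<le> h x y}" if "y \<in> Y" for y
      by (intro closed_Collect_le continuous_on_const cont that)
    show "X \<inter> (\<Inter>y\<in>U. {x. v \<le> h x y}) \<noteq> {}" if U: "finite U" "U \<subseteq> Y" for U
    proof
      assume "X \<inter> (\<Inter>y\<in>U. {x. v \<le> h x y}) = {}"
      hence "\<exists>u\<in>U. h x u < v" if "x \<in> X" for x using that by (force simp: not_le)
      from finite_minimax[OF U Y concave convex this] no show False by blast
    qed
  qed
  thus "\<exists>x\<in>X. \<forall>y\<in>Y. v \<le> h x y" by blast
qed

section \<open>The Riesz representation theorem on a compact set\<close>

text \<open>A fixed increasing sequence of continuous functions with supremum the indicator of an open set.
The whole space is separate because the distance to the empty set is 0 by convention.\<close>

definition bump :: "'a::euclidean_space set \<Rightarrow> nat \<Rightarrow> 'a \<Rightarrow> real" where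
  "bump U k x = (if U = UNIV then 1 else min 1 (real k * infdist x (- U)))"

lemma continuous_bump [continuous_intros]: "continuous_on S (bump U k)"
  unfolding bump_def by (cases "U = UNIV") (auto intro!: continuous_intros)

lemma bump_nonneg [simp]: "0 \<le> bump U k x"
  and bump_le_1 [simp]: "bump U k x \<le> 1"
  by (auto simp: bump_def infdist_nonneg)

lemma bump_eq_0: "x \<notin> U \<Longrightarrow> bump U k x = 0"
  by (auto simp: bump_def)

lemma bump_mono: "k \<le> l \<Longrightarrow> bump U k x \<le> bump U l x"
  by (simp add: bump_def min.mono mult_right_mono infdist_nonneg min.coboundedI2)

lemma bump_eventually_1:
  assumes "open U" "x \<in> U"
  shows "\<exists>k. \<forall>l\<ge>k. bump U l x = 1"
proof (cases "U = UNIV")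
  case False
  have "closed (- U)" using assms by blast
  hence d: "0 < infdist x (- U)"
    using assms False infdist_pos_not_in_closed[of "- U" x] by auto
  obtain k where k: "1 / infdist x (- U) < real k" using reals_Archimedean2 by blast
  have "bump U l x = 1" if "k \<le> l" for l
  proof -
    have "1 / infdist x (- U) \<le> real l" using k that by linarith
    hence "1 \<le> real l * infdist x (- U)" using d by (simp add: pos_divide_le_eq)
    thus ?thesis by (simp add: bump_def)
  qed
  thus ?thesis by blast
qed (simp add: bump_def)

lemma continuous_bounded_on_compact:
  fixes \<phi> :: "'a::topological_space \<Rightarrow> real"
  assumes K: "compact K" and c: "continuous_on UNIV \<phi>"
  obtains B where "0 \<le> B" "\<And>x. x \<in> K \<Longrightarrow> \<bar>\<phi> x\<bar> \<le> B"
proof -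
  have "compact (\<phi> ` K)"
    by (rule compact_continuous_image[OF continuous_on_subset[OF c] K]) simp
  then obtain B where "\<And>x. x \<in> K \<Longrightarrow> norm (\<phi> x) \<le> B"
    using compact_imp_bounded bounded_iff by (metis image_eqI)
  thus thesis by (intro that[of "max 0 B"]) (auto simp: le_max_iff_disj)
qed

lemma integrable_continuous_compact:
  fixes \<phi> :: "'a::topological_space \<Rightarrow> real"
  assumes M: "finite_measure M" "sets M = sets borel" and K: "compact K" "AE x in M. x \<in> K"
    and c: "continuous_on UNIV \<phi>"
  shows "integrable M \<phi>"
proof -
  interpret finite_measure M by fact
  obtain B where B: "\<And>x. x \<in> K \<Longrightarrow> \<bar>\<phi> x\<bar> \<le> B"
    using continuous_bounded_on_compact[OF K(1) c] by blast
  show ?thesis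
  proof (rule integrable_const_bound[where B=B])
    show "AE x in M. norm (\<phi> x) \<le> B"
      using K(2) by eventually_elim (simp add: B)
    show "\<phi> \<in> borel_measurable M"
      using borel_measurable_continuous_onI[OF c] measurable_cong_sets[OF M(2) refl] by blast
  qed
qed

text \<open>Positivity is tested on K only. This encodes at once that L is a positive functional on the
continuous functions on K and that L sees nothing outside K.\<close>

locale positive_functional =
  fixes K :: "'a::euclidean_space set" and L :: "('a \<Rightarrow> real) \<Rightarrow> real"
  assumes compact_K: "compact K"
    and add: "\<And>\<phi> \<psi>. continuous_on UNIV \<phi> \<Longrightarrow> continuous_on UNIV \<psi> \<Longrightarrow> L (\<lambda>x. \<phi> x + \<psi> x) = L \<phi> + L \<psi>"
    and scale: "\<And>\<phi> r. continuous_on UNIV \<phi> \<Longrightarrow> L (\<lambda>x. r * \<phi> x) = r * L \<phi>"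
    and nonneg: "\<And>\<phi>. continuous_on UNIV \<phi> \<Longrightarrow> (\<And>x. x \<in> K \<Longrightarrow> 0 \<le> \<phi> x) \<Longrightarrow> 0 \<le> L \<phi>"
begin

lemma diff:
  assumes "continuous_on UNIV \<phi>" "continuous_on UNIV \<psi>"
  shows "L (\<lambda>x. \<phi> x - \<psi> x) = L \<phi> - L \<psi>"
  using add[OF assms(1), of "\<lambda>x. -1 * \<psi> x"] scale[OF assms(2), of "-1"] assms
  by (simp add: continuous_on_minus)

lemma mono:
  assumes "continuous_on UNIV \<phi>" "continuous_on UNIV \<psi>" "\<And>x. x \<in> K \<Longrightarrow> \<phi> x \<le> \<psi> x"
  shows "L \<phi> \<le> L \<psi>"
proof -
  have "0 \<le> L (\<lambda>x. \<psi> x - \<phi> x)"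
    by (rule nonneg) (auto intro!: continuous_intros assms(1,2) simp: assms(3))
  thus ?thesis by (simp add: diff assms)
qed

lemma zero: "L (\<lambda>x. 0) = 0"
  using scale[of "\<lambda>x. 0" 0] by simp

lemma const: "L (\<lambda>x. r) = r * L (\<lambda>x. 1)"
  using scale[of "\<lambda>x. 1" r] by simp

lemma small_constant:
  assumes "0 < e"
  obtains d where "0 < d" "d * L (\<lambda>x. 1) \<le> e"
proof
  have L1: "0 \<le> L (\<lambda>x. 1)" by (rule nonneg) auto
  show "0 < e / (L (\<lambda>x. 1) + 1)" "e / (L (\<lambda>x. 1) + 1) * L (\<lambda>x. 1) \<le> e"
    using assms L1 by (auto simp: field_simps)
qed

lemma sum:
  assumes "\<And>i. i \<in> I \<Longrightarrow> continuous_on UNIV (\<phi> i)"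
  shows "L (\<lambda>x. \<Sum>i\<in>I. \<phi> i x) = (\<Sum>i\<in>I. L (\<phi> i))"
  using assms
proof (induction I rule: infinite_finite_induct)
  case (insert i I)
  thus ?case by (simp add: add continuous_on_sum)
qed (simp_all add: zero)

text \<open>Competitors for the content of an open set. They vanish off U but need not have support inside U,
so that the bumps belong to the class; proofs shrink the support when necessary.\<close>

definition below :: "'a set \<Rightarrow> ('a \<Rightarrow> real) set" where
  "below U = {\<phi>. continuous_on UNIV \<phi> \<and> (\<forall>x. 0 \<le> \<phi> x \<and> \<phi> x \<le> indicator U x)}"

definition content :: "'a set \<Rightarrow> ennreal" where
  "content U = (SUP \<phi>\<in>below U. ennreal (L \<phi>))"

definition outer :: "'a set \<Rightarrow> ennreal" where
  "outer E = (INF U\<in>{U. open U \<and> E \<subseteq> U}. content U)"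

lemma content_upper: "\<phi> \<in> below U \<Longrightarrow> ennreal (L \<phi>) \<le> content U"
  unfolding content_def by (rule SUP_upper)

lemma belowD:
  assumes "\<phi> \<in> below U"
  shows "continuous_on UNIV \<phi>" "0 \<le> \<phi> x" "\<phi> x \<le> 1" "x \<notin> U \<Longrightarrow> \<phi> x = 0" "0 \<le> L \<phi>"
proof -
  show *: "continuous_on UNIV \<phi>" "0 \<le> \<phi> x" for x using assms by (auto simp: below_def)
  have "\<phi> x \<le> indicator U x" using assms by (auto simp: below_def)
  thus "\<phi> x \<le> 1" "x \<notin> U \<Longrightarrow> \<phi> x = 0" using *(2)[of x] by (cases "x \<in> U"; simp)+
  show "0 \<le> L \<phi>" using * by (intro nonneg)
qed

lemma belowI:
  assumes "continuous_on UNIV \<phi>" "\<And>x. 0 \<le> \<phi> x" "\<And>x. \<phi> x \<le> 1" "\<And>x. x \<notin> U \<Longrightarrow> \<phi> x = 0"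
  shows "\<phi> \<in> below U"
  using assms by (auto simp: below_def indicator_def)

lemma bump_below: "bump U k \<in> below U"
  by (rule belowI) (auto simp: bump_eq_0 continuous_bump)

lemma below_mono: "U \<subseteq> V \<Longrightarrow> below U \<subseteq> below V"
  by (auto intro!: belowI dest: belowD)

lemma content_mono: "U \<subseteq> V \<Longrightarrow> content U \<le> content V"
  unfolding content_def
  by (rule SUP_subset_mono) (auto dest: below_mono)

lemma content_empty: "content {} = 0"
proof -
  have "L \<phi> \<le> 0" if "\<phi> \<in> below {}" for \<phi>
    using mono[of \<phi> "\<lambda>x. 0"] belowD[OF that] by (simp add: zero)
  hence "content {} \<le> 0"
    unfolding content_def by (intro SUP_least) (simp add: ennreal_neg)
  thus ?thesis by simp
qed

lemma content_UNIV: "content UNIV = ennreal (L (\<lambda>x. 1))"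
proof (rule antisym)
  show "content UNIV \<le> ennreal (L (\<lambda>x. 1))"
    unfolding content_def
    by (intro SUP_least ennreal_leI mono) (auto simp: belowD)
  show "ennreal (L (\<lambda>x. 1)) \<le> content UNIV"
    by (intro content_upper) (auto simp: below_def)
qed

text \<open>Finite sums of bumps of the U i exceed \<phi> - d from some index on, at each point of K. These sums
increase, so by compactness one index serves all of K, and L can be applied to the inequality.\<close>

lemma content_countably_subadditive:
  assumes U: "\<And>i::nat. open (U i)"
  shows "content (\<Union>i. U i) \<le> (\<Sum>i. content (U i))"
  unfolding content_def[of "\<Union>i. U i"]
proof (rule SUP_least)
  fix \<phi> assume \<phi>: "\<phi> \<in> below (\<Union>i. U i)"
  show "ennreal (L \<phi>) \<le> (\<Sum>i. content (U i))"
  proof (rule ennreal_le_epsilon)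
    fix e :: real assume e: "0 < e"
    obtain d where d: "0 < d" "d * L (\<lambda>x. 1) \<le> e" using small_constant[OF e] .
    define \<Phi> where "\<Phi> n x = (\<Sum>i<n. bump (U i) n x)" for n x
    have cont: "continuous_on UNIV (\<Phi> n)" for n
      unfolding \<Phi>_def by (intro continuous_intros)
    define W where "W n = {x. \<phi> x - d < \<Phi> n x}" for n
    have mono\<Phi>: "\<Phi> n x \<le> \<Phi> m x" if "n \<le> m" for n m x
    proof -
      have "\<Phi> n x \<le> (\<Sum>i<n. bump (U i) m x)"
        unfolding \<Phi>_def by (intro sum_mono bump_mono that)
      also have "\<dots> \<le> \<Phi> m x"
        unfolding \<Phi>_def using that by (intro sum_mono2) auto
      finally show ?thesis .
    qed
    have "\<exists>n. x \<in> W n" for x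
    proof (cases "x \<in> (\<Union>i. U i)")
      case True
      then obtain i where i: "x \<in> U i" by blast
      obtain k where k: "\<And>l. k \<le> l \<Longrightarrow> bump (U i) l x = 1"
        using bump_eventually_1[OF U i] by blast
      (* The bump of U i must occur in the sum and be equal to 1. *)
    define n where "n = max (Suc i) k"
      have "1 = bump (U i) n x" using k by (simp add: n_def)
      also have "\<dots> \<le> \<Phi> n x"
        unfolding \<Phi>_def by (rule member_le_sum[where f="\<lambda>i. bump (U i) n x"]) (auto simp: n_def)
      finally have "x \<in> W n" using belowD(3)[OF \<phi>, of x] d by (simp add: W_def)
      thus ?thesis ..
    next
      case False
      hence "x \<in> W 0" using belowD(4)[OF \<phi>, of x] d by (simp add: W_def \<Phi>_def)
      thus ?thesis ..
    qed
    hence "K \<subseteq> (\<Union>n\<in>UNIV. W n)" by blast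
    moreover have "open (W n)" for n
      unfolding W_def using belowD(1)[OF \<phi>] cont by (intro open_Collect_less continuous_intros)
    ultimately obtain I where I: "finite I" "K \<subseteq> (\<Union>n\<in>I. W n)"
      using compactE_image[OF compact_K, of UNIV W] by auto
    define n where "n = Max (insert 0 I)"
    have "\<phi> x \<le> \<Phi> n x + d" if x: "x \<in> K" for x
    proof -
      obtain m where m: "m \<in> I" "x \<in> W m" using I(2) x by blast
      hence "m \<le> n" using I by (simp add: n_def)
      thus ?thesis using mono\<Phi>[of m n x] m by (simp add: W_def)
    qed
    hence "L \<phi> \<le> L (\<lambda>x. \<Phi> n x + d)"
      by (intro mono continuous_intros cont belowD(1)[OF \<phi>])
    also have "\<dots> = L (\<Phi> n) + d * L (\<lambda>x. 1)"
      using add[OF cont, of "\<lambda>x. d" n] const[of d] by simp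
    also have "L (\<Phi> n) = (\<Sum>i<n. L (bump (U i) n))"
      unfolding \<Phi>_def by (rule sum) (rule continuous_bump)
    finally have "L \<phi> \<le> (\<Sum>i<n. L (bump (U i) n)) + e" using d by linarith
    hence "ennreal (L \<phi>) \<le> ennreal ((\<Sum>i<n. L (bump (U i) n)) + e)" by (rule ennreal_leI)
    also have "\<dots> = (\<Sum>i<n. ennreal (L (bump (U i) n))) + ennreal e"
      using e belowD(5)[OF bump_below] by (subst ennreal_plus) (auto intro!: sum_nonneg)
    also have "\<dots> \<le> (\<Sum>i<n. content (U i)) + ennreal e"
      by (intro add_right_mono sum_mono content_upper bump_below)
    also have "\<dots> \<le> (\<Sum>i. content (U i)) + ennreal e"
      by (intro add_right_mono sum_le_suminf) auto
    finally show "ennreal (L \<phi>) \<le> (\<Sum>i. content (U i)) + ennreal e" .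
  qed
qed

lemma outer_open: "open U \<Longrightarrow> outer U = content U"
  unfolding outer_def by (rule antisym) (auto intro!: INF_lower INF_greatest content_mono)

lemma outer_mono: "E \<subseteq> F \<Longrightarrow> outer E \<le> outer F"
  unfolding outer_def by (rule INF_superset_mono) auto

lemma outer_le_content: "open U \<Longrightarrow> E \<subseteq> U \<Longrightarrow> outer E \<le> content U"
  unfolding outer_def by (rule INF_lower) auto

text \<open>Cover each E n by an open set whose content is within e/2^(n+1) of optimal.\<close>

lemma outer_countably_subadditive: "outer (\<Union>i::nat. E i) \<le> (\<Sum>i. outer (E i))"
proof (rule ennreal_le_epsilon)
  fix e :: real assume e: "0 < e" and fin: "(\<Sum>n. outer (E n)) < top"
  have *: "outer (E n) < outer (E n) + e * (1/2)^Suc n" for n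
    using e fin by (auto simp: less_top dest!: ennreal_suminf_lessD)
  have "\<exists>U. open U \<and> E n \<subseteq> U \<and> content U \<le> outer (E n) + e * (1/2)^Suc n" for n
    using *[of n] unfolding outer_def[of "E n"] INF_less_iff by (auto intro: less_imp_le)
  then obtain U where U: "\<And>n. open (U n)" "\<And>n. E n \<subseteq> U n"
    "\<And>n. content (U n) \<le> outer (E n) + e * (1/2)^Suc n" by metis
  have "outer (\<Union>i. E i) \<le> content (\<Union>i. U i)"
    using U by (intro outer_le_content) auto
  also have "\<dots> \<le> (\<Sum>i. content (U i))" by (rule content_countably_subadditive) (rule U)
  also have "\<dots> \<le> (\<Sum>n. outer (E n) + e * (1/2) ^ Suc n)"
    by (intro suminf_le allI U) auto
  also have "\<dots> = (\<Sum>n. outer (E n)) + (\<Sum>n. ennreal e * ennreal ((1/2) ^ Suc n))"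
    using e by (subst suminf_add[symmetric])
      (auto simp del: ennreal_suminf_cmult simp add: ennreal_mult[symmetric])
  also have "\<dots> = (\<Sum>n. outer (E n)) + e"
    unfolding ennreal_suminf_cmult
    by (subst suminf_ennreal_eq[OF zero_le_power power_half_series]) auto
  finally show "outer (\<Union>i. E i) \<le> (\<Sum>n. outer (E n)) + ennreal e" .
qed

lemma outer_empty: "outer {} = 0"
  by (simp add: outer_open content_empty)

lemma outer_Un: "outer (A \<union> B) \<le> outer A + outer B"
proof -
  have "(\<Union>i::nat. (if i = 0 then A else if i = 1 then B else {})) = A \<union> B"
    by (auto split: if_splits)
  hence "outer (A \<union> B) \<le> (\<Sum>i::nat. outer (if i = 0 then A else if i = 1 then B else {}))"
    using outer_countably_subadditive by metis
  also have "\<dots> = (\<Sum>i<2::nat. outer (if i = 0 then A else if i = 1 then B else {}))"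
    by (rule suminf_finite) (auto simp: outer_empty)
  also have "\<dots> = outer A + outer B" by (simp add: numeral_2_eq_2)
  finally show ?thesis .
qed

lemma outer_measure_space_outer: "outer_measure_space (Pow UNIV) outer"
  unfolding outer_measure_space_def positive_def increasing_def countably_subadditive_def
  by (auto simp: outer_empty outer_mono outer_countably_subadditive)

text \<open>This is the Caratheodory condition for an open set tested against an open set. Cutting \<phi> down by d
moves its support into the closed set F inside V \<inter> U, so any competitor for V - F can be added
without exceeding 1.\<close>

lemma content_split:
  assumes U: "open U" and V: "open V"
  shows "content (V \<inter> U) + outer (V - U) \<le> content V"
proof -
  have "ennreal (L \<phi>) + outer (V - U) \<le> content V" if \<phi>: "\<phi> \<in> below (V \<inter> U)" for \<phi>
  proof (rule ennreal_le_epsilon)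
    fix e :: real assume e: "0 < e"
    obtain d where d: "0 < d" "d * L (\<lambda>x. 1) \<le> e" using small_constant[OF e] .
    define \<eta> where "\<eta> x = max 0 (\<phi> x - d)" for x
    have c\<phi>: "continuous_on UNIV \<phi>" by (rule belowD(1)[OF \<phi>])
    have c\<eta>: "continuous_on UNIV \<eta>" unfolding \<eta>_def by (intro continuous_intros c\<phi>)
    have "L \<phi> \<le> L (\<lambda>x. \<eta> x + d)"
      by (intro mono continuous_intros c\<phi> c\<eta>) (auto simp: \<eta>_def)
    also have "\<dots> = L \<eta> + d * L (\<lambda>x. 1)"
      using add[OF c\<eta>, of "\<lambda>x. d"] const[of d] by simp
    finally have L\<eta>: "L \<phi> \<le> L \<eta> + e" using d by linarith
    define F where "F = {x. d \<le> \<phi> x}"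
    have F: "closed F" unfolding F_def by (intro closed_Collect_le continuous_intros c\<phi>)
    have FU: "F \<subseteq> V \<inter> U" using belowD(4)[OF \<phi>] d by (force simp: F_def)
    have \<eta>F: "\<eta> x = 0" if "x \<notin> F" for x using that by (auto simp: \<eta>_def F_def)
    have \<eta>01: "0 \<le> \<eta> x" "\<eta> x \<le> 1" for x using belowD(2,3)[OF \<phi>, of x] d by (auto simp: \<eta>_def)
    have \<eta>0: "0 \<le> L \<eta>" by (rule nonneg[OF c\<eta> \<eta>01(1)])
    have key: "ennreal (L \<eta>) + ennreal (L \<psi>) \<le> content V" if \<psi>: "\<psi> \<in> below (V - F)" for \<psi>
    proof -
      have "(\<lambda>x. \<eta> x + \<psi> x) \<in> below V"
      proof (rule belowI)
        show "continuous_on UNIV (\<lambda>x. \<eta> x + \<psi> x)" by (intro continuous_intros c\<eta> belowD(1)[OF \<psi>])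
        fix x
        show "0 \<le> \<eta> x + \<psi> x" using \<eta>01 belowD(2)[OF \<psi>, of x] by (simp add: add_nonneg_nonneg)
        show "\<eta> x + \<psi> x \<le> 1"
          using \<eta>01[of x] \<eta>F[of x] belowD(3,4)[OF \<psi>, of x] by (cases "x \<in> F") auto
        show "\<eta> x + \<psi> x = 0" if "x \<notin> V"
          using that \<eta>F[of x] FU belowD(4)[OF \<psi>, of x] by auto
      qed
      from content_upper[OF this] show ?thesis
        using add[OF c\<eta> belowD(1)[OF \<psi>]] \<eta>0 belowD(5)[OF \<psi>] by (simp add: ennreal_plus)
    qed
    have ne: "below (V - F) \<noteq> {}" using bump_below by blast
    have "ennreal (L \<eta>) + outer (V - U) \<le> ennreal (L \<eta>) + content (V - F)"
      using V F FU by (intro add_left_mono outer_le_content open_Diff) auto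
    also have "\<dots> = (SUP \<psi>\<in>below (V - F). ennreal (L \<eta>) + ennreal (L \<psi>))"
      unfolding content_def by (rule ennreal_SUP_add_right[OF ne])
    also have "\<dots> \<le> content V" by (rule SUP_least) (rule key)
    finally have *: "ennreal (L \<eta>) + outer (V - U) \<le> content V" .
    have "ennreal (L \<phi>) \<le> ennreal (L \<eta>) + ennreal e"
      using ennreal_leI[OF L\<eta>] \<eta>0 e by (simp add: ennreal_plus)
    hence "ennreal (L \<phi>) + outer (V - U) \<le> (ennreal (L \<eta>) + outer (V - U)) + ennreal e"
      by (metis add.assoc add.commute add_right_mono)
    also have "\<dots> \<le> content V + ennreal e" by (intro add_right_mono *)
    finally show "ennreal (L \<phi>) + outer (V - U) \<le> content V + ennreal e" .
  qed
  moreover have "below (V \<inter> U) \<noteq> {}" using bump_below by blast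
  ultimately show ?thesis
    unfolding content_def[of "V \<inter> U"]
    by (subst ennreal_SUP_add_left[symmetric]) (auto intro!: SUP_least)
qed

lemma open_in_lambda_system:
  assumes U: "open U"
  shows "U \<in> lambda_system UNIV (Pow UNIV) outer"
proof -
  have "outer (U \<inter> E) + outer ((UNIV - U) \<inter> E) = outer E" for E
  proof (rule antisym)
    have "outer (U \<inter> E) + outer ((UNIV - U) \<inter> E) \<le> content V" if V: "open V" "E \<subseteq> V" for V
    proof -
      have "outer (U \<inter> E) \<le> content (V \<inter> U)" using U V by (intro outer_le_content) auto
      moreover have "outer ((UNIV - U) \<inter> E) \<le> outer (V - U)" using V by (intro outer_mono) auto
      ultimately have "outer (U \<inter> E) + outer ((UNIV - U) \<inter> E) \<le> content (V \<inter> U) + outer (V - U)"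
        by (rule add_mono)
      also have "\<dots> \<le> content V" by (rule content_split[OF U V(1)])
      finally show ?thesis .
    qed
    thus "outer (U \<inter> E) + outer ((UNIV - U) \<inter> E) \<le> outer E"
      unfolding outer_def[of E] by (intro INF_greatest) auto
    have "outer E = outer ((U \<inter> E) \<union> ((UNIV - U) \<inter> E))" by (rule arg_cong[of _ _ outer]) blast
    also have "\<dots> \<le> outer (U \<inter> E) + outer ((UNIV - U) \<inter> E)" by (rule outer_Un)
    finally show "outer E \<le> outer (U \<inter> E) + outer ((UNIV - U) \<inter> E)" .
  qed
  thus ?thesis by (auto simp: lambda_system_def)
qed

definition riesz_measure :: "'a measure" where
  "riesz_measure = measure_of UNIV (sets borel) outer"

lemma measure_space_outer: "measure_space UNIV (sets borel) outer"
proof -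
  have ms: "measure_space UNIV (lambda_system UNIV (Pow UNIV) outer) outer"
    by (rule sigma_algebra.caratheodory_lemma[OF sigma_algebra_Pow outer_measure_space_outer])
  have sub: "sets borel \<subseteq> lambda_system UNIV (Pow UNIV) outer"
    unfolding sets_borel
    using ms open_in_lambda_system
    by (intro sigma_algebra.sigma_sets_subset) (auto simp: measure_space_def)
  show ?thesis
    by (rule measure_down[OF ms _ sub]) (metis sets.sigma_algebra_axioms space_borel)
qed

lemma sets_riesz [simp, measurable_cong]: "sets riesz_measure = sets borel"
  and space_riesz [simp]: "space riesz_measure = UNIV"
  by (simp_all add: riesz_measure_def sets.sigma_sets_eq[of borel, simplified])

lemma emeasure_riesz: "A \<in> sets borel \<Longrightarrow> emeasure riesz_measure A = outer A"
  using measure_space_outer unfolding riesz_measure_def measure_space_def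
  by (intro emeasure_measure_of_sigma) auto

lemma finite_measure_riesz: "finite_measure riesz_measure"
  by (rule finite_measureI) (simp add: emeasure_riesz outer_open content_UNIV)

lemma measure_riesz_UNIV: "measure riesz_measure UNIV = L (\<lambda>x. 1)"
  using nonneg[of "\<lambda>x. 1"] by (simp add: measure_def emeasure_riesz outer_open content_UNIV)

lemma riesz_outside: "emeasure riesz_measure (- K) = 0"
proof -
  have K: "open (- K)" using compact_K compact_imp_closed by blast
  have "L \<phi> \<le> 0" if "\<phi> \<in> below (- K)" for \<phi>
    using mono[of \<phi> "\<lambda>x. 0"] belowD[OF that] by (auto simp: zero)
  hence "content (- K) \<le> 0"
    unfolding content_def by (intro SUP_least) (simp add: ennreal_neg)
  thus ?thesis using K by (simp add: emeasure_riesz outer_open)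
qed

lemma AE_riesz: "AE x in riesz_measure. x \<in> K"
proof -
  have "- K \<in> null_sets riesz_measure"
    using riesz_outside compact_K by (auto simp: null_sets_def compact_imp_closed borel_closed)
  from AE_not_in[OF this] show ?thesis by eventually_elim simp
qed

lemma riesz_integrable:
  assumes "continuous_on UNIV (\<phi> :: 'a \<Rightarrow> real)"
  shows "integrable riesz_measure \<phi>"
  by (rule integrable_continuous_compact[OF finite_measure_riesz sets_riesz compact_K AE_riesz assms])

text \<open>Slice \<phi> into n layers \<theta> i of height 1/n, scaled to height 1. Each layer is a competitor for the
open set {\<phi> > i/n}, and the sum of their indicators is at most n \<phi> + 1.\<close>

lemma riesz_upper:
  assumes c: "continuous_on UNIV \<phi>" and b: "\<And>x. 0 \<le> \<phi> x" "\<And>x. \<phi> x \<le> 1"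
  shows "L \<phi> \<le> (\<integral>x. \<phi> x \<partial>riesz_measure)"
proof -
  interpret finite_measure riesz_measure by (rule finite_measure_riesz)
  have [measurable]: "\<phi> \<in> borel_measurable borel" using c by (rule borel_measurable_continuous_onI)
  have main: "real n * L \<phi> \<le> real n * (\<integral>x. \<phi> x \<partial>riesz_measure) + L (\<lambda>x. 1)" for n
  proof -
    define \<theta> where "\<theta> i x = max 0 (min 1 (real n * \<phi> x - real i))" for i :: nat and x
    have c\<theta>: "continuous_on UNIV (\<theta> i)" for i unfolding \<theta>_def by (intro continuous_intros c)
    have tel: "(\<Sum>i<m. \<theta> i x) = min (real m) (real n * \<phi> x)" for m x
      using b(1)[of x] by (induction m) (auto simp: \<theta>_def min_def max_def)
    have "real n * \<phi> x \<le> real n" for x using b(2)[of x] by (simp add: mult_left_le)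
    hence sum\<theta>: "(\<Sum>i<n. \<theta> i x) = real n * \<phi> x" for x using tel[of x n] by (simp add: min.absorb2)
    define V where "V i = {x. real i < real n * \<phi> x}" for i :: nat
    have V: "open (V i)" for i unfolding V_def by (intro open_Collect_less continuous_intros c)
    have [measurable]: "V i \<in> sets borel" for i by (rule borel_open[OF V])
    have L\<theta>: "L (\<theta> i) \<le> measure riesz_measure (V i)" for i
    proof -
      have "\<theta> i \<in> below (V i)" by (rule belowI[OF c\<theta>]) (auto simp: \<theta>_def V_def)
      from content_upper[OF this] show ?thesis
        using V by (simp add: emeasure_riesz outer_open emeasure_eq_measure[symmetric]
            ennreal_le_iff[symmetric] del: ennreal_le_iff)
    qed
    have "real n * L \<phi> = (\<Sum>i<n. L (\<theta> i))"
      using sum[of "{..<n}" \<theta>] c\<theta> scale[OF c, of "real n"] by (simp add: sum\<theta>)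
    also have "\<dots> \<le> (\<Sum>i<n. measure riesz_measure (V i))" by (intro sum_mono L\<theta>)
    also have "\<dots> = (\<Sum>i<n. \<integral>x. indicator (V i) x \<partial>riesz_measure)" by simp
    also have "\<dots> = (\<integral>x. (\<Sum>i<n. indicator (V i) x) \<partial>riesz_measure)"
      by (subst Bochner_Integration.integral_sum) (auto intro!: integrable_real_indicator simp: emeasure_eq_measure)
    also have "\<dots> \<le> (\<integral>x. real n * \<phi> x + 1 \<partial>riesz_measure)"
    proof (rule integral_mono)
      show "integrable riesz_measure (\<lambda>x. real n * \<phi> x + 1)"
        by (intro riesz_integrable continuous_intros c)
      show "integrable riesz_measure (\<lambda>x. (\<Sum>i<n. indicator (V i) x) :: real)"
        by (intro Bochner_Integration.integrable_sum integrable_real_indicator) (auto simp: emeasure_eq_measure)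
      fix x
      have ind: "(\<Sum>i<m. indicator (V i) x) \<le> min (real m) (real n * \<phi> x + 1)" for m
        using b(1)[of x] by (induction m) (auto simp: V_def indicator_def min_def split: if_splits)
      show "(\<Sum>i<n. indicator (V i) x) \<le> real n * \<phi> x + 1" using ind[of n] by simp
    qed
    also have "\<dots> = real n * (\<integral>x. \<phi> x \<partial>riesz_measure) + L (\<lambda>x. 1)"
      using riesz_integrable[OF c] by (simp add: measure_riesz_UNIV)
    finally show ?thesis .
  qed
  show ?thesis
  proof (rule ccontr)
    assume "\<not> ?thesis"
    hence "0 < L \<phi> - (\<integral>x. \<phi> x \<partial>riesz_measure)" by simp
    then obtain n where "L (\<lambda>x. 1) < real n * (L \<phi> - (\<integral>x. \<phi> x \<partial>riesz_measure))"
      using reals_Archimedean3 by blast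
    thus False using main[of n] by (simp add: algebra_simps)
  qed
qed

text \<open>The upper bound for 1 - \<phi> is the lower bound for \<phi>, since both sides agree on constants.\<close>

lemma riesz_eq_unit:
  assumes c: "continuous_on UNIV \<phi>" and b: "\<And>x. 0 \<le> \<phi> x" "\<And>x. \<phi> x \<le> 1"
  shows "L \<phi> = (\<integral>x. \<phi> x \<partial>riesz_measure)"
proof (rule antisym)
  interpret finite_measure riesz_measure by (rule finite_measure_riesz)
  have "L (\<lambda>x. 1 - \<phi> x) \<le> (\<integral>x. 1 - \<phi> x \<partial>riesz_measure)"
    by (rule riesz_upper) (auto intro!: continuous_intros c simp: b)
  thus "(\<integral>x. \<phi> x \<partial>riesz_measure) \<le> L \<phi>"
    using riesz_integrable[OF c] diff[of "\<lambda>x. 1" \<phi>] c by (simp add: measure_riesz_UNIV)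
qed (rule riesz_upper[OF assms])

theorem riesz_representation:
  assumes c: "continuous_on UNIV \<phi>"
  shows "L \<phi> = (\<integral>x. \<phi> x \<partial>riesz_measure)"
proof -
  interpret finite_measure riesz_measure by (rule finite_measure_riesz)
  obtain B0 where B0: "\<And>x. x \<in> K \<Longrightarrow> norm (\<phi> x) \<le> B0"
    using continuous_bounded_on_compact[OF compact_K c] by (metis real_norm_def)
  (* Rescale the values of \<phi> on K to the unit interval; B must not be 0. *)
  define B where "B = max B0 1"
  have B: "0 < B" "\<And>x. x \<in> K \<Longrightarrow> norm (\<phi> x) \<le> B" using B0 by (auto simp: B_def le_max_iff_disj)
  define \<psi> where "\<psi> x = max 0 (min 1 ((\<phi> x + B) / (2 * B)))" for x
  have c\<psi>: "continuous_on UNIV \<psi>" unfolding \<psi>_def using B by (intro continuous_intros c) auto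
  have \<phi>\<psi>: "\<phi> x = 2 * B * \<psi> x - B" if "x \<in> K" for x
    using B(1) B(2)[OF that] by (auto simp: \<psi>_def min_def max_def field_simps)
  have c': "continuous_on UNIV (\<lambda>x. 2 * B * \<psi> x)" by (intro continuous_intros c\<psi>)
  have "L \<phi> = L (\<lambda>x. 2 * B * \<psi> x - B)"
    by (rule antisym; intro mono continuous_intros c c\<psi>; simp add: \<phi>\<psi>)
  also have "\<dots> = 2 * B * L \<psi> - B * L (\<lambda>x. 1)"
    using diff[OF c', of "\<lambda>x. B"] scale[OF c\<psi>, of "2 * B"] const[of B] by simp
  also have "L \<psi> = (\<integral>x. \<psi> x \<partial>riesz_measure)"
    by (rule riesz_eq_unit[OF c\<psi>]) (auto simp: \<psi>_def)
  also have "2 * B * (\<integral>x. \<psi> x \<partial>riesz_measure) - B * L (\<lambda>x. 1) = (\<integral>x. 2 * B * \<psi> x - B \<partial>riesz_measure)"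
    using riesz_integrable[OF c\<psi>] by (simp add: measure_riesz_UNIV)
  also have "\<dots> = (\<integral>x. \<phi> x \<partial>riesz_measure)"
  proof (rule integral_cong_AE)
    show "AE x in riesz_measure. 2 * B * \<psi> x - B = \<phi> x"
      using AE_riesz by eventually_elim (simp add: \<phi>\<psi>)
  qed (use riesz_integrable[OF c\<psi>] riesz_integrable[OF c] in auto)
  finally show ?thesis .
qed

end

section \<open>Convex duality in one variable\<close>

lemma closed_epigraph:
  assumes "lsc_fun g"
  shows "closed {z::real \<times> real. g (fst z) \<le> ereal (snd z)}"
proof -
  have "open {z::real \<times> real. ereal (snd z) < g (fst z)}"
  proof (subst open_prod_def, safe)
    fix t y :: real assume "ereal (snd (t, y)) < g (fst (t, y))"
    then obtain z where z: "y < z" "ereal z < g t"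
      by (metis ereal_dense2 ereal_less_eq(3) fst_conv less_ereal.simps(1) snd_conv)
    have "ereal z < Liminf (at t) g"
      using z assms by (auto simp: lsc_fun_def intro: less_le_trans)
    hence "eventually (\<lambda>s. ereal z < g s) (at t)" by (rule less_LiminfD)
    hence "eventually (\<lambda>s. ereal z < g s) (nhds t)"
      using z(2) by (auto simp: eventually_at_filter elim: eventually_mono)
    then obtain S where S: "open S" "t \<in> S" "\<And>s. s \<in> S \<Longrightarrow> ereal z < g s"
      by (auto simp: eventually_nhds)
    have "S \<times> {..<z} \<subseteq> {z. ereal (snd z) < g (fst z)}"
      using S(3) by (auto intro: less_trans[of "ereal _" "ereal z"])
    with S z show "\<exists>A B. open A \<and> open B \<and> (t, y) \<in> A \<times> B \<and> A \<times> B \<subseteq> {z. ereal (snd z) < g (fst z)}"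
      by (intro exI[of _ S] exI[of _ "{..<z}"]) auto
  qed
  moreover have "- {z::real \<times> real. ereal (snd z) < g (fst z)} = {z. g (fst z) \<le> ereal (snd z)}" by auto
  ultimately show ?thesis by (metis closed_Compl)
qed

lemma convex_epigraph:
  assumes "convex_fun g"
  shows "convex {z::real \<times> real. g (fst z) \<le> ereal (snd z)}"
proof (rule convexI)
  fix z w :: "real \<times> real" and u u' :: real
  assume zw: "z \<in> {z. g (fst z) \<le> ereal (snd z)}" "w \<in> {z. g (fst z) \<le> ereal (snd z)}"
    and u: "0 \<le> u" "0 \<le> u'" "u + u' = 1"
  have "g (u * fst z + u' * fst w) \<le> ereal (u * snd z + u' * snd w)"
  proof (cases "u = 0 \<or> u' = 0")
    case True
    thus ?thesis using zw u by auto
  next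
    case False
    hence u': "u = 1 - u'" "0 < u'" "u' < 1" using u by auto
    have "g ((1 - u') * fst z + u' * fst w) \<le> ereal (1 - u') * g (fst z) + ereal u' * g (fst w)"
      using assms u' by (auto simp: convex_fun_def)
    also have "\<dots> \<le> ereal (1 - u') * ereal (snd z) + ereal u' * ereal (snd w)"
      using zw u' by (intro add_mono ereal_mult_left_mono) auto
    finally show ?thesis using u'(1) by simp
  qed
  thus "u *\<^sub>R z + u' *\<^sub>R w \<in> {z. g (fst z) \<le> ereal (snd z)}" by simp
qed

text \<open>Separate the point (a, v) from the epigraph, a closed convex set. A non-vertical separating line
is the minorant. A vertical one only says that g is infinite at a; as g is non-negative, a steep
enough line that is non-positive on the domain of g and equals v at a does the job.\<close>

lemma exists_affine_minorant:
  assumes cv: "convex_fun g" and lsc: "lsc_fun g" and nonneg: "\<And>t. 0 \<le> g t" and v: "ereal v < g a"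
  shows "\<exists>s. \<forall>t. ereal (s * (t - a) + v) \<le> g t"
proof -
  let ?E = "{z::real \<times> real. g (fst z) \<le> ereal (snd z)}"
  have "(a, v) \<notin> ?E" using v by (simp add: not_le)
  from separating_hyperplane_closed_point[OF convex_epigraph[OF cv] closed_epigraph[OF lsc] this]
  obtain p b where p: "inner p (a, v) < b" "\<forall>z\<in>?E. b < inner p z" by blast
  obtain p1 p2 where p12: "p = (p1, p2)" by (cases p)
  have below: "p1 * a + p2 * v < b" using p(1) by (simp add: p12)
  have above: "b < p1 * t + p2 * y" if "g t \<le> ereal y" for t y
    using p(2)[rule_format, of "(t, y)"] that by (simp add: p12)
  have reduce: ?thesis if H: "\<And>t y. g t = ereal y \<Longrightarrow> s * (t - a) + v \<le> y" for s
  proof (intro exI allI)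
    fix t show "ereal (s * (t - a) + v) \<le> g t"
      using H[of t] nonneg[of t] by (cases "g t") auto
  qed
  show ?thesis
  proof (cases "\<exists>t. g t < \<infinity>")
    case False
    hence "\<And>t. g t = \<infinity>" by (simp add: less_top[symmetric])
    thus ?thesis by auto
  next
    case True
    then obtain t0 where "g t0 < \<infinity>" by blast
    then obtain y0 where t0: "g t0 = ereal y0" using nonneg[of t0] by (cases "g t0") auto
    have "0 \<le> p2"
    proof (rule ccontr)
      assume p2: "\<not> 0 \<le> p2"
      define y where "y = max y0 ((b - p1 * t0) / p2)"
      have "b < p1 * t0 + p2 * y" by (rule above) (simp add: t0 y_def)
      moreover have "p2 * y \<le> p2 * ((b - p1 * t0) / p2)"
        using p2 by (intro mult_left_mono_neg) (auto simp: y_def)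
      ultimately show False using p2 by auto
    qed
    then consider "p2 = 0" | "0 < p2" by linarith
    thus ?thesis
    proof cases
      case 1
      (* The vertical case: M makes the line with slope - M p1 drop by at least |v| on the domain. *)
      define M where "M = \<bar>v\<bar> / (b - p1 * a)"
      have M: "0 \<le> M" "M * (b - p1 * a) = \<bar>v\<bar>" using below 1 by (auto simp: M_def)
      show ?thesis
      proof (rule reduce[of "- M * p1"])
        fix t y assume g: "g t = ereal y"
        have "M * (b - p1 * a) \<le> M * (p1 * t - p1 * a)"
          using above[of t y] g M 1 by (intro mult_left_mono) auto
        hence "\<bar>v\<bar> \<le> M * p1 * (t - a)" using M by (simp add: algebra_simps)
        moreover have "0 \<le> y" using nonneg[of t] g by simp
        ultimately show "- M * p1 * (t - a) + v \<le> y" by simp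
      qed
    next
      case 2
      show ?thesis
      proof (rule reduce[of "- p1 / p2"])
        fix t y assume g: "g t = ereal y"
        have "p1 * a + p2 * v < p1 * t + p2 * y" using below above[of t y] g by simp
        moreover have "p2 * (- p1 / p2 * (t - a) + v) = p1 * a - p1 * t + p2 * v"
          using 2 by (simp add: distrib_left right_diff_distrib)
        ultimately have "p2 * (- p1 / p2 * (t - a) + v) \<le> p2 * y" by linarith
        thus "- p1 / p2 * (t - a) + v \<le> y" using 2 by simp
      qed
    qed
  qed
qed

lemma conj_le_iff:
  assumes "\<And>t. 0 \<le> g t"
  shows "conj_fun g s \<le> ereal y \<longleftrightarrow> (\<forall>t. ereal (s * t - y) \<le> g t)"
proof -
  have "ereal (s * t) - g t \<le> ereal y \<longleftrightarrow> ereal (s * t - y) \<le> g t" for t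
    using assms[of t] by (cases "g t") auto
  thus ?thesis by (simp add: conj_fun_def SUP_le_iff)
qed

lemma conj_0_le:
  assumes "\<And>t. 0 \<le> g t"
  shows "conj_fun g 0 \<le> 0"
  using conj_le_iff[of g, OF assms, where s=0 and y=0] assms by (simp add: zero_ereal_def)

text \<open>Only t \<ge> 0 contributes to the supremum, since g is infinite on the negative axis.\<close>

lemma conj_mono:
  assumes neg: "\<And>t. t < 0 \<Longrightarrow> g t = \<infinity>" and s: "s \<le> s'"
  shows "conj_fun g s \<le> conj_fun g s'"
  unfolding conj_fun_def
proof (rule SUP_mono, rule bexI[of _ "_ :: real"])
  fix t :: real
  show "ereal (s * t) - g t \<le> ereal (s' * t) - g t"
  proof (cases "t < 0")
    case False
    thus ?thesis using s by (intro ereal_minus_mono) (auto intro: mult_right_mono)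
  qed (simp add: neg)
qed simp

text \<open>A finite conjugate at q means g(t) \<ge> q t - y, so g grows at least with slope q. This and the converse
below are stated without convexity because the recession slope is evaluated on null sets too, where
c(x, .) may fail to be convex.\<close>

lemma le_recession_of_conj_finite:
  assumes nonneg: "\<And>t. 0 \<le> g t" and fin: "conj_fun g q < \<infinity>"
  shows "ereal q \<le> recession g 1"
proof -
  obtain y where "conj_fun g q \<le> ereal y"
    using fin by (metis ereal_dense2 less_imp_le)
  hence y: "ereal (q * t - y) \<le> g t" for t using conj_le_iff[of g, OF nonneg] by blast
  have "ereal q \<le> Liminf at_top (\<lambda>s. g (t0 + s * 1) / ereal s)" for t0
  proof -
    have "((\<lambda>s. q + (q * t0 - y) / s) \<longlongrightarrow> q + 0) at_top"
      by (intro tendsto_add tendsto_const tendsto_divide_0[OF tendsto_const])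
         (auto intro: filterlim_at_top_imp_at_infinity filterlim_ident)
    hence "((\<lambda>s. ereal (q + (q * t0 - y) / s)) \<longlongrightarrow> ereal q) at_top" by simp
    hence "ereal q = Liminf at_top (\<lambda>s. ereal (q + (q * t0 - y) / s))"
      by (intro lim_imp_Liminf[symmetric]) auto
    also have "\<dots> \<le> Liminf at_top (\<lambda>s. g (t0 + s * 1) / ereal s)"
    proof (rule Liminf_mono)
      show "\<forall>\<^sub>F s in at_top. ereal (q + (q * t0 - y) / s) \<le> g (t0 + s * 1) / ereal s"
        using eventually_gt_at_top[of 0]
      proof eventually_elim
        case (elim s)
        have "ereal (q + (q * t0 - y) / s) = ereal (q * (t0 + s * 1) - y) / ereal s"
          using elim by (simp add: field_simps)
        also have "\<dots> \<le> g (t0 + s * 1) / ereal s"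
          using elim y by (intro ereal_divide_right_mono) auto
        finally show ?case .
      qed
    qed
    finally show ?thesis .
  qed
  thus ?thesis unfolding recession_def by (intro INF_greatest) auto
qed

lemma conj_finite_of_less_recession:
  assumes nonneg: "\<And>t. 0 \<le> g t" and neg: "\<And>t. t < 0 \<Longrightarrow> g t = \<infinity>" and q: "ereal q < recession g 1"
  shows "conj_fun g q < \<infinity>"
proof (cases "\<exists>t0. g t0 < \<infinity>")
  case False
  hence "\<And>t. g t = \<infinity>" by (simp add: less_top[symmetric])
  thus ?thesis by (simp add: conj_fun_def)
next
  case True
  then obtain t0 where t0: "g t0 < \<infinity>" by blast
  have "ereal q < Liminf at_top (\<lambda>s. g (t0 + s * 1) / ereal s)"
    using q t0 unfolding recession_def by (auto intro: less_INF_D)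
  hence "eventually (\<lambda>s. ereal q < g (t0 + s * 1) / ereal s) at_top" by (rule less_LiminfD)
  then obtain T where T: "\<And>s. s \<ge> T \<Longrightarrow> ereal q < g (t0 + s) / ereal s"
    by (auto simp: eventually_at_top_linorder)
  (* y majorises q t for 0 \<le> t \<le> t0 + max T 1, and also q t0. *)
  define y where "y = \<bar>q\<bar> * (\<bar>t0\<bar> + max T 1)"
  have "ereal (q * t - y) \<le> g t" for t
  proof -
    consider "t < 0" | "0 \<le> t" "t \<le> t0 + max T 1" | "t > t0 + max T 1" by linarith
    thus ?thesis
    proof cases
      case 2
      have "q * t \<le> \<bar>q\<bar> * t" using 2 by (intro mult_right_mono) auto
      also have "\<dots> \<le> y" unfolding y_def using 2 by (intro mult_left_mono) auto
      finally have "ereal (q * t - y) \<le> 0" by (simp add: zero_ereal_def)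
      thus ?thesis using nonneg order_trans by blast
    next
      case 3
      define s where "s = t - t0"
      have s: "T \<le> s" "0 < s" using 3 by (auto simp: s_def)
      have "ereal q < g t / ereal s" using T[OF s(1)] by (simp add: s_def)
      hence "ereal (q * s) \<le> g t"
        using s nonneg[of t] by (cases "g t") (auto simp: field_simps)
      moreover have "q * t - y \<le> q * s"
      proof -
        have "q * t0 \<le> \<bar>q\<bar> * \<bar>t0\<bar>" by (metis abs_ge_self abs_mult)
        also have "\<dots> \<le> y" unfolding y_def by (intro mult_left_mono) auto
        finally show ?thesis by (simp add: s_def algebra_simps)
      qed
      ultimately show ?thesis by (meson ereal_less_eq(3) order_trans)
    qed (simp add: neg)
  qed
  hence "conj_fun g q \<le> ereal y" using conj_le_iff[of g, OF nonneg] by blast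
  thus ?thesis using ereal_infty_less_eq(1) le_less_trans by fastforce
qed

text \<open>Take an affine minorant through a value v' > v and lower its slope to a rational number. Since the
conjugate is monotone, the lowered slope has no larger conjugate, and the loss (s - q) a is smaller
than v' - v.\<close>

lemma rational_slope:
  assumes cv: "convex_fun g" and lsc: "lsc_fun g" and nonneg: "\<And>t. 0 \<le> g t"
    and neg: "\<And>t. t < 0 \<Longrightarrow> g t = \<infinity>" and v: "ereal v < g a" and a: "0 \<le> a"
  shows "\<exists>q::rat. conj_fun g (of_rat q) < ereal (of_rat q * a - v)"
proof -
  obtain v' where v': "v < v'" "ereal v' < g a"
    using v by (metis ereal_dense2 less_ereal.simps(1))
  obtain s where s: "\<And>t. ereal (s * (t - a) + v') \<le> g t"
    using exists_affine_minorant[OF cv lsc nonneg v'(2)] by blast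
  (* The denominator a + 1 covers a = 0. *)
  define d where "d = (v' - v) / (a + 1)"
  have d: "0 < d" "d * a < v' - v" using v' a by (auto simp: d_def field_simps)
  obtain q where q: "s - d < of_rat q" "of_rat q < s" using of_rat_dense[of "s - d" s] d by auto
  have "conj_fun g (of_rat q) \<le> conj_fun g s" using q by (intro conj_mono neg) auto
  also have "\<dots> \<le> ereal (s * a - v')"
    unfolding conj_le_iff[of g, OF nonneg] using s by (simp add: algebra_simps)
  also have "\<dots> < ereal (of_rat q * a - v)"
  proof -
    have "(s - of_rat q) * a \<le> d * a" using q a by (intro mult_right_mono) auto
    thus ?thesis using d by (simp add: algebra_simps)
  qed
  finally show ?thesis by blast
qed

section \<open>Signed set functions, measures and Lebesgue decomposition\<close>

lemma signed_measure_empty: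
  assumes "signed_measure \<mu>"
  shows "\<mu> {} = 0"
proof -
  have "(\<lambda>i::nat. \<mu> {}) sums \<mu> (\<Union>i::nat. {})"
    using assms unfolding signed_measure_def by (elim conjE allE[of _ "\<lambda>i. {}"]) (auto simp: disjoint_family_on_def)
  hence "(\<lambda>i::nat. \<mu> {}) \<longlonglongrightarrow> 0" by (intro summable_LIMSEQ_zero sums_summable)
  thus ?thesis by (simp add: LIMSEQ_const_iff)
qed

lemma signed_measure_Un:
  assumes \<mu>: "signed_measure \<mu>" and A: "A \<in> sets borel" "B \<in> sets borel" "A \<inter> B = {}"
  shows "\<mu> (A \<union> B) = \<mu> A + \<mu> B"
proof -
  have "(\<lambda>i. \<mu> (binaryset A B i)) sums \<mu> (\<Union>i. binaryset A B i)"
    using \<mu> A unfolding signed_measure_def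
    by (elim conjE allE[of _ "binaryset A B"])
       (auto simp: range_binaryset_eq UN_binaryset_eq disjoint_family_on_def binaryset_def fun_upd_def
         split: if_splits)
  moreover have "(\<lambda>i. \<mu> (binaryset A B i)) sums (\<mu> A + \<mu> B)"
    by (rule binaryset_sums) (rule signed_measure_empty[OF \<mu>])
  ultimately show ?thesis by (simp add: UN_binaryset_eq sums_unique2)
qed

lemma sets_pos_part [simp]: "sets (pos_part \<mu>) = sets borel"
  and space_pos_part [simp]: "space (pos_part \<mu>) = UNIV"
  by (simp_all add: pos_part_def sets.sigma_sets_eq[of borel, simplified])

text \<open>For a non-negative set function the supremum defining the upper variation is attained at A.\<close>

lemma emeasure_pos_part:
  assumes \<mu>: "signed_measure \<mu>" and nonneg: "\<And>A. 0 \<le> \<mu> A" and A: "A \<in> sets borel"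
  shows "emeasure (pos_part \<mu>) A = ennreal (\<mu> A)"
proof -
  have mono: "\<mu> B \<le> \<mu> A" if "A \<in> sets borel" "B \<in> sets borel" "B \<subseteq> A" for A B
    using signed_measure_Un[OF \<mu>, of B "A - B"] that nonneg[of "A - B"] by (auto simp: Un_absorb1)
  have eq: "(SUP B\<in>{B \<in> sets borel. B \<subseteq> A}. ennreal (\<mu> B)) = ennreal (\<mu> A)" if "A \<in> sets borel" for A
    by (rule antisym) (auto intro!: SUP_least SUP_upper ennreal_leI mono that)
  have "measure_of UNIV (sets borel) (\<lambda>A. SUP B\<in>{B \<in> sets borel. B \<subseteq> A}. ennreal (\<mu> B)) =
      measure_of UNIV (sets borel) (\<lambda>A. ennreal (\<mu> A))"
    by (rule measure_of_eq) (auto simp: sets.sigma_sets_eq[of borel, simplified] eq)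
  moreover have "emeasure (measure_of UNIV (sets borel) (\<lambda>A. ennreal (\<mu> A))) A = ennreal (\<mu> A)"
  proof (rule emeasure_measure_of_sigma[OF _ _ _ A])
    show "sigma_algebra UNIV (sets borel :: 'a set set)" by (metis sets.sigma_algebra_axioms space_borel)
    show "positive (sets borel) (\<lambda>A. ennreal (\<mu> A))"
      using signed_measure_empty[OF \<mu>] by (simp add: positive_def)
    show "countably_additive (sets borel) (\<lambda>A. ennreal (\<mu> A))"
    proof (rule countably_additiveI)
      fix B :: "nat \<Rightarrow> 'a set" assume "range B \<subseteq> sets borel" "disjoint_family B"
      hence "(\<lambda>i. \<mu> (B i)) sums \<mu> (\<Union>i. B i)" using \<mu> by (simp add: signed_measure_def)
      thus "(\<Sum>i. ennreal (\<mu> (B i))) = ennreal (\<mu> (\<Union>i. B i))"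
        using nonneg by (subst suminf_ennreal2) (auto simp: sums_iff)
    qed
  qed
  ultimately show ?thesis by (simp add: pos_part_def)
qed

lemma signed_measure_measure:
  fixes M :: "'a::euclidean_space measure"
  assumes "finite_measure M" "sets M = sets borel"
  shows "signed_measure (measure M)"
  unfolding signed_measure_def
proof (intro conjI allI impI)
  fix A :: "'a set" assume "A \<notin> sets borel"
  thus "measure M A = 0" using assms by (simp add: measure_notin_sets)
next
  fix A :: "nat \<Rightarrow> 'a set" assume "range A \<subseteq> sets borel" "disjoint_family A"
  thus "(\<lambda>i. measure M (A i)) sums measure M (\<Union>i. A i)"
    using assms by (intro finite_measure.finite_measure_UNION) auto
qed

lemma pos_part_measure:
  fixes M :: "'a::euclidean_space measure"
  assumes M: "finite_measure M" "sets M = sets borel"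
  shows "pos_part (measure M) = M"
proof (rule measure_eqI)
  fix A assume "A \<in> sets (pos_part (measure M))"
  thus "emeasure (pos_part (measure M)) A = emeasure M A"
    using M by (simp add: emeasure_pos_part signed_measure_measure finite_measure.emeasure_eq_measure)
qed (simp add: M)

lemma emeasure_neg_part:
  assumes "\<And>A. 0 \<le> \<mu> A"
  shows "emeasure (neg_part \<mu>) A = 0"
proof (cases "A \<in> sets borel")
  case True
  have "(\<lambda>A. SUP B\<in>{B \<in> sets borel. B \<subseteq> A}. ennreal (- \<mu> B)) = (\<lambda>A. 0)"
    using assms by (intro ext) (auto intro!: antisym SUP_least simp: ennreal_neg)
  thus ?thesis using True
    by (simp add: neg_part_def pos_part_def emeasure_sigma)
next
  case False
  thus ?thesis by (simp add: neg_part_def emeasure_notin_sets)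
qed

lemma variation_measure:
  fixes M :: "'a::euclidean_space measure"
  assumes M: "finite_measure M" "sets M = sets borel"
  shows "variation (measure M) = M"
proof -
  have "(\<lambda>A. emeasure (pos_part (measure M)) A + emeasure (neg_part (measure M)) A) = emeasure M"
    by (simp add: pos_part_measure[OF M] emeasure_neg_part)
  thus ?thesis
    using measure_of_of_measure[of M] sets_eq_imp_space_eq[OF M(2)] M(2) by (simp add: variation_def)
qed

lemma signed_integral_measure:
  fixes M :: "'a::euclidean_space measure"
  assumes M: "finite_measure M" "sets M = sets borel"
  shows "signed_integral (measure M) g = (\<integral>x. g x \<partial>M)"
proof -
  have "neg_part (measure M) = null_measure borel"
    by (rule measure_eqI) (simp_all add: emeasure_neg_part, simp add: neg_part_def)
  thus ?thesis by (simp add: signed_integral_def pos_part_measure[OF M])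
qed

lemma pos_measures_in_iff:
  assumes K: "closed K"
  shows "\<mu> \<in> pos_measures_in K \<longleftrightarrow>
    (\<exists>M. \<mu> = measure M \<and> finite_measure M \<and> sets M = sets borel \<and> emeasure M (- K) = 0)"
proof
  assume "\<mu> \<in> pos_measures_in K"
  hence \<mu>: "signed_measure \<mu>" "\<And>A. 0 \<le> \<mu> A" "\<And>A. A \<in> sets borel \<Longrightarrow> A \<inter> K = {} \<Longrightarrow> \<mu> A = 0"
    by (auto simp: pos_measures_in_def measures_in_def)
  have "\<mu> A = measure (pos_part \<mu>) A" for A
  proof (cases "A \<in> sets borel")
    case True
    thus ?thesis using emeasure_pos_part[OF \<mu>(1,2)] \<mu>(2) by (simp add: measure_def)
  next
    case False
    thus ?thesis using \<mu>(1) by (simp add: signed_measure_def measure_notin_sets)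
  qed
  moreover have "finite_measure (pos_part \<mu>)"
    by (rule finite_measureI) (simp add: emeasure_pos_part[OF \<mu>(1,2)])
  moreover have "emeasure (pos_part \<mu>) (- K) = 0"
    using K by (simp add: emeasure_pos_part[OF \<mu>(1,2)] \<mu>(3) borel_closed)
  ultimately show "\<exists>M. \<mu> = measure M \<and> finite_measure M \<and> sets M = sets borel \<and> emeasure M (- K) = 0"
    by (intro exI[of _ "pos_part \<mu>"]) auto
next
  assume "\<exists>M. \<mu> = measure M \<and> finite_measure M \<and> sets M = sets borel \<and> emeasure M (- K) = 0"
  then obtain M where M: "\<mu> = measure M" "finite_measure M" "sets M = sets borel" "emeasure M (- K) = 0"
    by blast
  have "measure M A = 0" if "A \<in> sets borel" "A \<inter> K = {}" for A
  proof -
    have "emeasure M A \<le> emeasure M (- K)"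
      using that K M(3) by (intro emeasure_mono) (auto simp: borel_closed)
    thus ?thesis using M(4) by (simp add: measure_def)
  qed
  thus "\<mu> \<in> pos_measures_in K"
    using M signed_measure_measure[OF M(2,3)] by (simp add: pos_measures_in_def measures_in_def)
qed

text \<open>Among the Lebesgue null sets there is one of largest M-measure, a countable union of almost
optimal ones; a null set charging its complement would enlarge it. Outside this set M is
absolutely continuous.\<close>

lemma exists_maximal_null_set:
  fixes M :: "'a::euclidean_space measure"
  assumes M: "finite_measure M" "sets M = sets borel"
  shows "\<exists>N\<in>null_sets lborel. \<forall>A\<in>null_sets lborel. emeasure M (A - N) = 0"
proof -
  interpret finite_measure M by fact
  define S where "S = (SUP N\<in>null_sets (lborel :: 'a measure). emeasure M N)"
  have S: "S < \<infinity>"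
  proof -
    have "S \<le> emeasure M (space M)" unfolding S_def by (intro SUP_least emeasure_space)
    thus ?thesis using emeasure_finite[of "space M"] by (metis infinity_ennreal_def le_less_trans less_top)
  qed
  have "null_sets (lborel :: 'a measure) \<noteq> {}" by blast
  from ennreal_Sup_countable_SUP[of "emeasure M ` null_sets lborel"] this
  obtain f :: "nat \<Rightarrow> ennreal" where f: "range f \<subseteq> emeasure M ` null_sets lborel" "S = (SUP i. f i)"
    unfolding S_def by auto
  hence "\<forall>i. \<exists>N\<in>null_sets lborel. f i = emeasure M N" by blast
  then obtain B where B: "\<And>i. B i \<in> null_sets (lborel :: 'a measure)" "\<And>i. f i = emeasure M (B i)" by metis
  define N where "N = (\<Union>i. B i)"
  have N: "N \<in> null_sets lborel" unfolding N_def using B by (intro null_sets_UN') auto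
  hence Nb[measurable]: "N \<in> sets borel" by (auto simp: null_sets_def)
  have "S \<le> emeasure M N"
    unfolding f(2) B(2) N_def
  proof (rule SUP_least)
    fix i
    show "emeasure M (B i) \<le> emeasure M (\<Union>i. B i)"
      by (rule emeasure_mono) (use Nb M N_def in auto)
  qed
  moreover have "emeasure M (A - N) = 0" if A: "A \<in> null_sets lborel" for A
  proof -
    have [measurable]: "A \<in> sets borel" using A by (auto simp: null_sets_def)
    have "emeasure M N + emeasure M (A - N) = emeasure M (N \<union> A)"
      by (subst plus_emeasure) (auto simp: M(2) Un_Diff_cancel)
    also have "\<dots> \<le> S" unfolding S_def using A N by (intro SUP_upper) auto
    also have "\<dots> \<le> emeasure M N" by fact
    finally have "emeasure M N + emeasure M (A - N) \<le> emeasure M N + 0" by simp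
    thus ?thesis using emeasure_finite[of N] by (simp add: ennreal_add_left_cancel_le)
  qed
  ultimately show ?thesis using N by blast
qed

text \<open>The Lebesgue decomposition of a measure: absolutely continuous with density a off the null set N,
singular on N.\<close>

definition lebesgue_split :: "'a::euclidean_space measure \<Rightarrow> ('a \<Rightarrow> real) \<Rightarrow> 'a set \<Rightarrow> bool" where
  "lebesgue_split M a N \<longleftrightarrow> a \<in> borel_measurable borel \<and> (\<forall>x. 0 \<le> a x) \<and> integrable lborel a \<and>
     N \<in> null_sets lborel \<and> density M (indicator (- N)) = density lborel (\<lambda>x. ennreal (a x))"

lemma exists_lebesgue_split:
  fixes M :: "'a::euclidean_space measure"
  assumes M: "finite_measure M" "sets M = sets borel"
  shows "\<exists>a N. lebesgue_split M a N"
proof -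
  interpret finite_measure M by fact
  obtain N where N: "N \<in> null_sets lborel" "\<And>A. A \<in> null_sets lborel \<Longrightarrow> emeasure M (A - N) = 0"
    using exists_maximal_null_set[OF M] by blast
  have [measurable]: "N \<in> sets borel" using N by (auto simp: null_sets_def)
  have [measurable_cong]: "sets M = sets borel" by fact
  define R where "R = density M (indicator (- N))"
  have R: "emeasure R A = emeasure M (A - N)" if [measurable]: "A \<in> sets borel" for A
  proof -
    have "emeasure R A = (\<integral>\<^sup>+x. indicator (- N) x * indicator A x \<partial>M)"
      unfolding R_def by (rule emeasure_density) auto
    also have "\<dots> = (\<integral>\<^sup>+x. indicator (A - N) x \<partial>M)"
      by (intro nn_integral_cong) (auto split: split_indicator)
    finally show ?thesis by simp
  qed
  have fR: "finite_measure R"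
    by (rule finite_measureI) (auto simp: R_def[symmetric] R, auto simp: R_def R[unfolded R_def] sets_eq_imp_space_eq[OF M(2)])
  have ac: "absolutely_continuous lborel R"
    unfolding absolutely_continuous_def
    by (auto simp: null_sets_def R N(2)[unfolded null_sets_def, simplified]) (auto simp: R_def M(2))
  obtain D where D: "D \<in> borel_measurable lborel"
    "AE x in lborel. RN_deriv lborel R x = ennreal (D x)" "AE x in R. 0 < D x" "\<And>x. 0 \<le> D x"
    using sigma_finite_measure.real_RN_deriv[OF sigma_finite_lborel fR ac] by (auto simp: R_def M(2))
  have "density lborel (\<lambda>x. ennreal (D x)) = density lborel (RN_deriv lborel R)"
    using D by (intro density_cong) auto
  also have "\<dots> = R"
    by (rule sigma_finite_measure.density_RN_deriv[OF sigma_finite_lborel ac]) (simp add: R_def M(2))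
  finally have eq: "density lborel (\<lambda>x. ennreal (D x)) = R" .
  have "(\<integral>\<^sup>+x. ennreal (D x) \<partial>lborel) = emeasure R UNIV"
    using D(1) by (subst eq[symmetric]) (simp add: emeasure_density)
  also have "\<dots> < \<infinity>" using finite_measure.emeasure_finite[OF fR] by (simp add: less_top)
  finally have "integrable lborel D" using D by (intro integrableI_nonneg) auto
  thus ?thesis using D N eq by (intro exI[of _ D] exI[of _ N]) (auto simp: lebesgue_split_def R_def)
qed

lemma lebesgue_splitD:
  assumes "lebesgue_split M a N"
  shows "a \<in> borel_measurable borel" "0 \<le> a x" "integrable lborel a" "N \<in> null_sets lborel"
    "N \<in> sets borel" "density M (indicator (- N)) = density lborel (\<lambda>x. ennreal (a x))"
  using assms by (auto simp: lebesgue_split_def null_sets_def)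

lemma integral_lebesgue_split:
  fixes g :: "'a::euclidean_space \<Rightarrow> real"
  assumes M: "sets M = sets borel" and split: "lebesgue_split M a N" and g: "integrable M g"
  shows "integrable lborel (\<lambda>x. a x * g x)"
    "(\<integral>x. g x \<partial>M) = (\<integral>x. a x * g x \<partial>lborel) + (\<integral>x. indicator N x * g x \<partial>M)" (is "?lhs = ?rhs")
proof -
  have [measurable_cong]: "sets M = sets borel" by fact
  have [measurable]: "a \<in> borel_measurable borel" "N \<in> sets borel" "g \<in> borel_measurable borel"
    using lebesgue_splitD[OF split] borel_measurable_integrable[OF g] by auto
  have i1: "integrable M (\<lambda>x. indicator A x * g x)" if [measurable]: "A \<in> sets borel" for A
    using integrable_mult_indicator[OF _ g, of A] that M by simp
  have "integrable (density M (indicator (- N))) g"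
  proof -
    have "integrable (density M (\<lambda>x. ennreal (indicator (- N) x))) g"
      using i1[of "- N"] by (subst integrable_density) auto
    thus ?thesis by (simp add: ennreal_indicator)
  qed
  thus "integrable lborel (\<lambda>x. a x * g x)"
    unfolding lebesgue_splitD(6)[OF split]
    by (subst (asm) integrable_density) (auto simp: lebesgue_splitD(2)[OF split])
  have "(\<integral>x. a x * g x \<partial>lborel) = (\<integral>x. g x \<partial>density lborel (\<lambda>x. ennreal (a x)))"
    by (subst integral_density) (auto simp: lebesgue_splitD(2)[OF split])
  also have "\<dots> = (\<integral>x. g x \<partial>density M (\<lambda>x. ennreal (indicator (- N) x)))"
    by (simp add: lebesgue_splitD(6)[OF split] ennreal_indicator)
  also have "\<dots> = (\<integral>x. indicator (- N) x * g x \<partial>M)"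
    by (subst integral_density) auto
  also have "\<dots> + (\<integral>x. indicator N x * g x \<partial>M) = (\<integral>x. indicator (- N) x * g x + indicator N x * g x \<partial>M)"
    by (rule Bochner_Integration.integral_add[symmetric]) (auto intro!: i1)
  also have "\<dots> = (\<integral>x. g x \<partial>M)"
    by (intro Bochner_Integration.integral_cong) (auto simp: indicator_def)
  finally show "?lhs = ?rhs" ..
qed

text \<open>Off the union of the two carrier null sets both singular parts vanish, so the densities have the
same integrals over all Borel sets.\<close>

lemma lebesgue_decomposition_unique:
  assumes d1: "lebesgue_decomposition \<nu> a1 \<nu>1" and d2: "lebesgue_decomposition \<nu> a2 \<nu>2"
  shows "AE x in lborel. a1 x = a2 x" "\<nu>1 = \<nu>2"
proof -
  obtain N1 N2 where N: "N1 \<in> null_sets lborel" "N2 \<in> null_sets lborel"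
    and z: "\<And>A. A \<in> sets borel \<Longrightarrow> A \<inter> N1 = {} \<Longrightarrow> \<nu>1 A = 0" "\<And>A. A \<in> sets borel \<Longrightarrow> A \<inter> N2 = {} \<Longrightarrow> \<nu>2 A = 0"
    using d1 d2 unfolding lebesgue_decomposition_def by metis
  have [measurable]: "N1 \<in> sets borel" "N2 \<in> sets borel" using N by (auto simp: null_sets_def)
  have i: "integrable lborel a1" "integrable lborel a2"
    and eq: "\<And>A. A \<in> sets borel \<Longrightarrow> set_lebesgue_integral lborel A a1 + \<nu>1 A = set_lebesgue_integral lborel A a2 + \<nu>2 A"
    and s: "signed_measure \<nu>1" "signed_measure \<nu>2"
    using d1 d2 unfolding lebesgue_decomposition_def by metis+
  have [measurable]: "a1 \<in> borel_measurable borel" "a2 \<in> borel_measurable borel"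
    using i by (auto dest: borel_measurable_integrable)
  have int: "set_lebesgue_integral lborel A a1 = set_lebesgue_integral lborel A a2" if [measurable]: "A \<in> sets borel" for A
  proof -
    have ae: "AE x in lborel. x \<in> A \<longleftrightarrow> x \<in> A - (N1 \<union> N2)"
      using AE_not_in[OF N(1)] AE_not_in[OF N(2)] by eventually_elim auto
    have "set_lebesgue_integral lborel A a1 = set_lebesgue_integral lborel (A - (N1 \<union> N2)) a1"
      by (rule set_integral_cong_set[OF _ _ ae, symmetric]) (auto simp: set_borel_measurable_def)
    also have "\<dots> = set_lebesgue_integral lborel (A - (N1 \<union> N2)) a2"
    proof -
      have "(A - (N1 \<union> N2)) \<inter> N1 = {}" "(A - (N1 \<union> N2)) \<inter> N2 = {}" by auto
      from z(1)[OF _ this(1)] z(2)[OF _ this(2)] eq[of "A - (N1 \<union> N2)"] show ?thesis by simp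
    qed
    also have "\<dots> = set_lebesgue_integral lborel A a2"
      by (rule set_integral_cong_set[OF _ _ ae]) (auto simp: set_borel_measurable_def)
    finally show ?thesis .
  qed
  show "AE x in lborel. a1 x = a2 x" by (rule density_unique_real[OF i]) (simp add: int)
  show "\<nu>1 = \<nu>2"
  proof
    fix A show "\<nu>1 A = \<nu>2 A"
      using eq[of A] int[of A] s by (cases "A \<in> sets borel") (auto simp: signed_measure_def)
  qed
qed

lemma lebesgue_split_decomposition:
  assumes M: "finite_measure M" "sets M = sets borel" and split: "lebesgue_split M a N"
  shows "lebesgue_decomposition (measure M) a (measure (density M (indicator N)))"
    "finite_measure (density M (indicator N))"
proof -
  interpret finite_measure M by fact
  have [measurable_cong]: "sets M = sets borel" by fact
  note D = lebesgue_splitD[OF split]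
  have [measurable]: "a \<in> borel_measurable borel" "N \<in> sets borel" using D by auto
  let ?S = "density M (indicator N)"
  have S: "emeasure ?S A = emeasure M (A \<inter> N)" if [measurable]: "A \<in> sets borel" for A
  proof -
    have "emeasure ?S A = (\<integral>\<^sup>+x. indicator N x * indicator A x \<partial>M)"
      by (rule emeasure_density) auto
    also have "\<dots> = (\<integral>\<^sup>+x. indicator (A \<inter> N) x \<partial>M)"
      by (intro nn_integral_cong) (auto split: split_indicator)
    finally show ?thesis by simp
  qed
  show fS: "finite_measure ?S"
    by (rule finite_measureI) (simp add: S sets_eq_imp_space_eq[OF M(2)])
  have "measure M A = set_lebesgue_integral lborel A a + measure ?S A" if A[measurable]: "A \<in> sets borel" for A
  proof -
    have i: "integrable M (indicator A :: 'a \<Rightarrow> real)" by (simp add: M(2) A less_top[symmetric])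
    have "measure M A = (\<integral>x. indicator A x \<partial>M)" using A by (simp add: M(2) sets_eq_imp_space_eq[OF M(2)])
    also have "\<dots> = (\<integral>x. a x * indicator A x \<partial>lborel) + (\<integral>x. indicator N x * indicator A x \<partial>M)"
      by (rule integral_lebesgue_split[OF M(2) split i])
    also have "(\<integral>x. a x * indicator A x \<partial>lborel) = set_lebesgue_integral lborel A a"
      by (simp add: set_lebesgue_integral_def mult.commute)
    also have "(\<integral>x. indicator N x * indicator A x \<partial>M) = measure M (A \<inter> N)"
      using A by (simp add: indicator_inter_arith[symmetric] M(2) sets_eq_imp_space_eq[OF M(2)] Int_commute)
    also have "\<dots> = measure ?S A" by (simp add: measure_def S)
    finally show ?thesis .
  qed
  moreover have "signed_measure (measure ?S)"
    by (rule signed_measure_measure[OF fS]) (simp add: M(2))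
  moreover have "measure ?S A = 0" if "A \<in> sets borel" "A \<inter> N = {}" for A
    using that by (simp add: measure_def S)
  ultimately show "lebesgue_decomposition (measure M) a (measure ?S)"
    unfolding lebesgue_decomposition_def using D by blast
qed

text \<open>The choices hidden in ac_density, singular_part and polar_density are determined almost
everywhere, and the polar density of a non-negative measure is 1.\<close>

lemma cost_functional_measure:
  assumes M: "finite_measure M" "sets M = sets borel" and split: "lebesgue_split M a N" and \<Omega>: "open \<Omega>"
  shows "cost_functional \<Omega> c (measure M) = enn2ereal
     ((\<integral>\<^sup>+x. e2ennreal (c x (a x)) * indicator \<Omega> x \<partial>lborel) +
      (\<integral>\<^sup>+x. e2ennreal (recession (c x) 1) \<partial>density M (indicator N)))"
proof -
  let ?S = "density M (indicator N)"
  note dec = lebesgue_split_decomposition[OF M split]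
  have sS: "sets ?S = sets borel" by (simp add: M(2))
  have sing: "singular_part (measure M) = measure ?S"
    unfolding singular_part_def
    by (rule the_equality) (use dec(1) lebesgue_decomposition_unique(2) in blast)+
  have "\<exists>\<nu>s. lebesgue_decomposition (measure M) (ac_density (measure M)) \<nu>s"
    unfolding ac_density_def by (rule someI[of "\<lambda>a. \<exists>\<nu>s. lebesgue_decomposition (measure M) a \<nu>s"]) (use dec(1) in blast)
  then have "AE x in lborel. ac_density (measure M) x = a x"
    using dec(1) lebesgue_decomposition_unique(1) by blast
  hence ac: "AE x in lebesgue. ac_density (measure M) x = a x" by (rule AE_completion)
  have "(\<integral>\<^sup>+x. e2ennreal (c x (ac_density (measure M) x)) \<partial>lebesgue_on \<Omega>) =
      (\<integral>\<^sup>+x. e2ennreal (c x (ac_density (measure M) x)) * indicator \<Omega> x \<partial>lebesgue)"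
    using \<Omega> by (intro nn_integral_restrict_space) (auto simp: borel_open)
  also have "\<dots> = (\<integral>\<^sup>+x. e2ennreal (c x (a x)) * indicator \<Omega> x \<partial>lebesgue)"
    using ac by (intro nn_integral_cong_AE) auto
  also have "\<dots> = (\<integral>\<^sup>+x. e2ennreal (c x (a x)) * indicator \<Omega> x \<partial>lborel)"
    by (rule nn_integral_completion)
  finally have 1: "(\<integral>\<^sup>+x. e2ennreal (c x (ac_density (measure M) x)) \<partial>lebesgue_on \<Omega>) =
      (\<integral>\<^sup>+x. e2ennreal (c x (a x)) * indicator \<Omega> x \<partial>lborel)" .
  let ?P = "\<lambda>h. integrable (variation (measure ?S)) h \<and>
     (\<forall>A\<in>sets borel. measure ?S A = set_lebesgue_integral (variation (measure ?S)) A h)"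
  have v: "variation (measure ?S) = ?S" by (rule variation_measure[OF dec(2) sS])
  have one: "integrable ?S (\<lambda>x. 1 :: real)" "\<And>A. A \<in> sets borel \<Longrightarrow> measure ?S A = set_lebesgue_integral ?S A (\<lambda>x. 1)"
    using dec(2) by (auto simp: finite_measure.integrable_const set_lebesgue_integral_def M(2) sets_eq_imp_space_eq[OF M(2)])
  have "?P (polar_density (measure ?S))"
    unfolding polar_density_def by (rule someI[of ?P "\<lambda>x. 1"]) (use one v in auto)
  hence P: "integrable ?S (polar_density (measure ?S))"
    "\<And>A. A \<in> sets borel \<Longrightarrow> measure ?S A = set_lebesgue_integral ?S A (polar_density (measure ?S))"
    by (auto simp: v)
  have "AE x in ?S. polar_density (measure ?S) x = 1"
    by (rule density_unique_real[OF P(1) one(1)]) (metis P(2) one(2) sS)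
  hence "(\<integral>\<^sup>+x. e2ennreal (recession (c x) (polar_density (measure ?S) x)) \<partial>?S) =
      (\<integral>\<^sup>+x. e2ennreal (recession (c x) 1) \<partial>?S)"
    by (intro nn_integral_cong_AE) auto
  thus ?thesis by (simp add: cost_functional_def sing v 1)
qed

section \<open>Null boundaries and continuous approximation\<close>

text \<open>The graph is the image of the null hyperplane orthogonal to e under the Lipschitz map
z \<mapsto> z + \<phi> z e.\<close>

lemma negligible_lipschitz_graph:
  fixes e :: "'a::euclidean_space"
  assumes e: "norm e = 1" and lip: "L-lipschitz_on {z. z \<bullet> e = 0} \<phi>"
  shows "negligible {y. \<phi> (y - (y \<bullet> e) *\<^sub>R e) = y \<bullet> e}"
proof -
  let ?H = "{z. z \<bullet> e = 0}"
  have "negligible ?H"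
    using negligible_hyperplane[of e 0] e by (force simp: inner_commute)
  hence "negligible ((\<lambda>z. z + \<phi> z *\<^sub>R e) ` ?H)"
  proof (rule negligible_locally_Lipschitz_image[rotated])
    fix x assume x: "x \<in> ?H"
    have "norm (y + \<phi> y *\<^sub>R e - (x + \<phi> x *\<^sub>R e)) \<le> (1 + L) * norm (y - x)" if y: "y \<in> ?H" for y
    proof -
      have "y + \<phi> y *\<^sub>R e - (x + \<phi> x *\<^sub>R e) = (y - x) + (\<phi> y - \<phi> x) *\<^sub>R e"
        by (simp add: algebra_simps)
      hence "norm (y + \<phi> y *\<^sub>R e - (x + \<phi> x *\<^sub>R e)) \<le> norm (y - x) + norm ((\<phi> y - \<phi> x) *\<^sub>R e)"
        by (metis norm_triangle_ineq)
      also have "\<dots> = norm (y - x) + dist (\<phi> y) (\<phi> x)" using e by (simp add: dist_real_def)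
      also have "dist (\<phi> y) (\<phi> x) \<le> L * dist y x" by (rule lipschitz_onD[OF lip y x])
      finally show ?thesis by (simp add: dist_norm algebra_simps)
    qed
    thus "\<exists>T B. open T \<and> x \<in> T \<and>
        (\<forall>y\<in>?H \<inter> T. norm (y + \<phi> y *\<^sub>R e - (x + \<phi> x *\<^sub>R e)) \<le> B * norm (y - x))"
      by (intro exI[of _ UNIV] exI[of _ "1 + L"]) auto
  qed simp
  moreover have "{y. \<phi> (y - (y \<bullet> e) *\<^sub>R e) = y \<bullet> e} \<subseteq> (\<lambda>z. z + \<phi> z *\<^sub>R e) ` ?H"
  proof
    fix y assume y: "y \<in> {y. \<phi> (y - (y \<bullet> e) *\<^sub>R e) = y \<bullet> e}"
    have "e \<bullet> e = 1" using e by (simp add: norm_eq_1)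
    hence "y - (y \<bullet> e) *\<^sub>R e \<in> ?H" by (simp add: inner_diff_left)
    moreover have "y = (y - (y \<bullet> e) *\<^sub>R e) + \<phi> (y - (y \<bullet> e) *\<^sub>R e) *\<^sub>R e"
      using y by simp
    ultimately show "y \<in> (\<lambda>z. z + \<phi> z *\<^sub>R e) ` ?H" by (rule rev_image_eqI)
  qed
  ultimately show ?thesis by (rule negligible_subset)
qed

text \<open>Near a boundary point the boundary lies on the graph: above the graph is \<Omega>, which is open, and
strictly below it a neighbourhood misses \<Omega>.\<close>

lemma negligible_lipschitz_frontier:
  fixes \<Omega> :: "'a::euclidean_space set"
  assumes \<Omega>: "open \<Omega>" "bounded \<Omega>" and lip: "lipschitz_boundary \<Omega>"
  shows "negligible (frontier \<Omega>)"
proof -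
  have "\<exists>U. open U \<and> p \<in> U \<and> negligible (frontier \<Omega> \<inter> U)" if p: "p \<in> frontier \<Omega>" for p
  proof -
    obtain e \<phi> L U where e: "norm e = 1" and l: "L-lipschitz_on {z. z \<bullet> e = 0} \<phi>"
      and U: "open U" "p \<in> U" and eq: "\<Omega> \<inter> U = {y \<in> U. \<phi> (y - (y \<bullet> e) *\<^sub>R e) < y \<bullet> e}"
      using lip[unfolded lipschitz_boundary_def, rule_format, OF p] by (elim exE conjE) (rule that)
    let ?B = "{y. y \<bullet> e < \<phi> (y - (y \<bullet> e) *\<^sub>R e)}"
    have ee: "e \<bullet> e = 1" using e by (simp add: norm_eq_1)
    have "continuous_on UNIV (\<lambda>y. \<phi> (y - (y \<bullet> e) *\<^sub>R e))"
      by (rule continuous_on_compose2[OF lipschitz_on_continuous_on[OF l]])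
         (auto intro!: continuous_intros simp: inner_diff_left ee)
    hence op: "open ?B"
      by (intro open_Collect_less continuous_intros)
    have "frontier \<Omega> \<inter> U \<subseteq> {y. \<phi> (y - (y \<bullet> e) *\<^sub>R e) = y \<bullet> e}"
    proof
      fix y assume y: "y \<in> frontier \<Omega> \<inter> U"
      have "y \<notin> \<Omega>" using y \<Omega> by (simp add: frontier_def interior_open)
      hence "y \<notin> \<Omega> \<inter> U" by blast
      hence "y \<bullet> e \<le> \<phi> (y - (y \<bullet> e) *\<^sub>R e)" using y unfolding eq by (simp add: not_less)
      moreover have "\<not> y \<bullet> e < \<phi> (y - (y \<bullet> e) *\<^sub>R e)"
      proof
        assume "y \<bullet> e < \<phi> (y - (y \<bullet> e) *\<^sub>R e)"
        moreover have "open (U \<inter> ?B)" using U op by blast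
        moreover have "(U \<inter> ?B) \<inter> \<Omega> = {}"
        proof -
          have "(U \<inter> ?B) \<inter> \<Omega> =
              (\<Omega> \<inter> U) \<inter> ?B" by blast
          also have "\<dots> = {}" unfolding eq by (simp add: disjoint_iff)
          finally show ?thesis .
        qed
        ultimately have "y \<notin> closure \<Omega>"
          using y open_Int_closure_eq_empty[of "U \<inter> ?B" \<Omega>] by blast
        thus False using y by (simp add: frontier_def)
      qed
      ultimately show "y \<in> {y. \<phi> (y - (y \<bullet> e) *\<^sub>R e) = y \<bullet> e}" by simp
    qed
    hence "negligible (frontier \<Omega> \<inter> U)"
      using negligible_lipschitz_graph[OF e l] negligible_subset by blast
    thus ?thesis using U by blast
  qed
  then obtain U where U: "\<And>p. p \<in> frontier \<Omega> \<Longrightarrow> open (U p)" "\<And>p. p \<in> frontier \<Omega> \<Longrightarrow> p \<in> U p"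
    "\<And>p. p \<in> frontier \<Omega> \<Longrightarrow> negligible (frontier \<Omega> \<inter> U p)" by metis
  have "compact (frontier \<Omega>)" using \<Omega>(2) by (rule compact_frontier_bounded)
  then obtain F where F: "F \<subseteq> frontier \<Omega>" "finite F" "frontier \<Omega> \<subseteq> (\<Union>p\<in>F. U p)"
    using compactE_image[of "frontier \<Omega>" "frontier \<Omega>" U] U by blast
  have "negligible (\<Union>p\<in>F. frontier \<Omega> \<inter> U p)"
    using F U(3) by (intro negligible_Union) auto
  thus ?thesis by (rule negligible_subset) (use F(3) in blast)
qed

lemma usc_sublevel_open:
  assumes usc: "usc_on S g"
  shows "\<exists>W. open W \<and> {x \<in> S. g x < a} = S \<inter> W"
proof (intro exI conjI)
  let ?W = "\<Union>{T. open T \<and> (\<forall>y\<in>T \<inter> S. g y < a)}"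
  show "open ?W" by blast
  show "{x \<in> S. g x < a} = S \<inter> ?W"
  proof
    show "{x \<in> S. g x < a} \<subseteq> S \<inter> ?W"
    proof
      fix x assume "x \<in> {x \<in> S. g x < a}"
      hence x: "x \<in> S" "g x < a" by auto
      have "Limsup (at x within S) g < a" using usc x unfolding usc_on_def by (meson le_less_trans)
      hence "eventually (\<lambda>y. g y < a) (at x within S)" by (rule Limsup_lessD)
      then obtain T where T: "open T" "x \<in> T" "\<forall>y\<in>T. y \<noteq> x \<longrightarrow> y \<in> S \<longrightarrow> g y < a"
        unfolding eventually_at_topological by blast
      have "g y < a" if "y \<in> T \<inter> S" for y using T(3) x(2) that by (cases "y = x") auto
      hence "T \<in> {T. open T \<and> (\<forall>y\<in>T \<inter> S. g y < a)}" using T(1) by simp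
      hence "x \<in> ?W" using T(2) by (rule UnionI)
      with x(1) show "x \<in> S \<inter> ?W" by (rule IntI)
    qed
  qed blast
qed

text \<open>Regularity gives closed sets inside and open sets around E that are tight for Q1 and for Q2; a
Urysohn function for the union of the closed and the intersection of the open sets suits both
measures at once.\<close>

lemma continuous_approx_indicator:
  fixes Q1 Q2 :: "'a::euclidean_space measure"
  assumes Q: "finite_measure Q1" "sets Q1 = sets borel" "finite_measure Q2" "sets Q2 = sets borel"
    and E: "E \<in> sets borel" and \<epsilon>: "0 < \<epsilon>"
  shows "\<exists>\<theta>. continuous_on UNIV \<theta> \<and> (\<forall>x. 0 \<le> \<theta> x \<and> \<theta> x \<le> 1) \<and>
    (\<integral>x. \<bar>\<theta> x - indicator E x\<bar> \<partial>Q1) < \<epsilon> \<and> (\<integral>x. \<bar>\<theta> x - indicator E x\<bar> \<partial>Q2) < (\<epsilon>::real)"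
proof -
  have reg: "\<exists>C U. closed C \<and> C \<subseteq> E \<and> open U \<and> E \<subseteq> U \<and> measure Q (U - C) < \<epsilon>"
    if Q: "finite_measure Q" "sets Q = sets borel" for Q :: "'a measure"
  proof -
    interpret finite_measure Q by fact
    have fin: "emeasure Q (space Q) \<noteq> \<infinity>" by simp
    have "\<exists>C. C \<subseteq> E \<and> compact C \<and> emeasure Q E < emeasure Q C + ennreal (\<epsilon> / 2)"
    proof (cases "emeasure Q E = 0")
      case True
      thus ?thesis using \<epsilon> by (intro exI[of _ "{}"]) auto
    next
      case False
      have "emeasure Q E - ennreal (\<epsilon> / 2) < emeasure Q E"
      proof (rule ennreal_between)
        show "emeasure Q E < top" using emeasure_finite[of E] by (simp only: less_top infinity_ennreal_def)
        show "0 < emeasure Q E" using False by (simp add: zero_less_iff_neq_zero)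
        show "0 < ennreal (\<epsilon> / 2)" using \<epsilon> by simp
      qed
      also have "\<dots> = (SUP K\<in>{K. K \<subseteq> E \<and> compact K}. emeasure Q K)"
        by (rule inner_regular[OF Q(2) fin E])
      finally obtain C where C: "C \<subseteq> E" "compact C" "emeasure Q E - ennreal (\<epsilon> / 2) < emeasure Q C"
        by (auto simp: less_SUP_iff)
      have [measurable]: "C \<in> sets Q" using C(2) Q by (simp add: borel_closed compact_imp_closed)
      have "measure Q E < measure Q C + \<epsilon> / 2"
      proof (rule ccontr)
        assume "\<not> ?thesis"
        hence "ennreal (measure Q C) \<le> ennreal (measure Q E - \<epsilon> / 2)" by (intro ennreal_leI) simp
        also have "\<dots> = emeasure Q E - ennreal (\<epsilon> / 2)"
          using \<epsilon> by (simp add: emeasure_eq_measure[of E] ennreal_minus)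
        also have "\<dots> < ennreal (measure Q C)" using C(3) by (simp only: emeasure_eq_measure[of C])
        finally show False by simp
      qed
      hence "ennreal (measure Q E) < ennreal (measure Q C + \<epsilon> / 2)"
        by (intro ennreal_lessI) (use \<epsilon> in \<open>auto intro: add_nonneg_pos\<close>)
      also have "\<dots> = emeasure Q C + ennreal (\<epsilon> / 2)"
        using \<epsilon> by (simp add: emeasure_eq_measure[of C])
      finally have "emeasure Q E < emeasure Q C + ennreal (\<epsilon> / 2)"
        by (simp only: emeasure_eq_measure[of E])
      thus ?thesis using C by blast
    qed
    then obtain C where C: "C \<subseteq> E" "compact C" "emeasure Q E < emeasure Q C + ennreal (\<epsilon> / 2)" by blast
    have "(INF U\<in>{U. E \<subseteq> U \<and> open U}. emeasure Q U) < emeasure Q E + ennreal (\<epsilon> / 2)"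
      unfolding outer_regular[OF Q(2) fin E, symmetric] using \<epsilon> by (simp add: less_top[symmetric])
    then obtain U where U: "E \<subseteq> U" "open U" "emeasure Q U < emeasure Q E + ennreal (\<epsilon> / 2)"
      by (auto simp: INF_less_iff)
    have [measurable]: "C \<in> sets Q" "U \<in> sets Q"
      using C U Q by (auto simp: borel_open borel_closed compact_imp_closed)
    have "measure Q E < measure Q C + \<epsilon> / 2" "measure Q U < measure Q E + \<epsilon> / 2"
      using C(3) U(3) \<epsilon> by (auto simp: emeasure_eq_measure ennreal_plus[symmetric] ennreal_less_iff simp del: ennreal_plus)
    moreover have "measure Q (U - C) = measure Q U - measure Q C"
      using C U by (intro finite_measure_Diff) auto
    ultimately have "measure Q (U - C) < \<epsilon>" by linarith
    thus ?thesis using C U compact_imp_closed by blast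
  qed
  obtain C1 U1 where 1: "closed C1" "C1 \<subseteq> E" "open U1" "E \<subseteq> U1" "measure Q1 (U1 - C1) < \<epsilon>"
    using reg[OF Q(1,2)] by blast
  obtain C2 U2 where 2: "closed C2" "C2 \<subseteq> E" "open U2" "E \<subseteq> U2" "measure Q2 (U2 - C2) < \<epsilon>"
    using reg[OF Q(3,4)] by blast
  have "closed (C1 \<union> C2)" "closed (- (U1 \<inter> U2))" "(C1 \<union> C2) \<inter> - (U1 \<inter> U2) = {}" using 1 2 by auto
  then obtain \<theta> :: "'a \<Rightarrow> real" where \<theta>: "continuous_on UNIV \<theta>" "\<And>x. \<theta> x \<in> closed_segment 1 0"
    "\<And>x. x \<in> C1 \<union> C2 \<Longrightarrow> \<theta> x = 1" "\<And>x. x \<in> - (U1 \<inter> U2) \<Longrightarrow> \<theta> x = 0"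
    by (rule Urysohn[where a=1 and b=0]) blast
  have \<theta>01: "0 \<le> \<theta> x \<and> \<theta> x \<le> 1" for x using \<theta>(2)[of x] by (simp add: closed_segment_eq_real_ivl)
  have [measurable]: "\<theta> \<in> borel_measurable borel" using \<theta>(1) by (rule borel_measurable_continuous_onI)
  have "(\<integral>x. \<bar>\<theta> x - indicator E x\<bar> \<partial>Q) < \<epsilon>"
    if Q: "finite_measure Q" "sets Q = sets borel" and CU: "closed C" "open U" "measure Q (U - C) < \<epsilon>"
      and sub: "C \<subseteq> C1 \<union> C2" "U1 \<inter> U2 \<subseteq> U" "C \<subseteq> E" "E \<subseteq> U" for C U and Q :: "'a measure"
  proof -
    interpret finite_measure Q by fact
    have [measurable_cong]: "sets Q = sets borel" by fact
    have D: "U - C \<in> sets borel" using CU by (auto simp: borel_open borel_closed)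
    have [measurable]: "E \<in> sets borel" by fact
    have "integrable Q (\<lambda>x. \<bar>\<theta> x - indicator E x\<bar>)"
      using \<theta>01 by (intro integrable_const_bound[where B=1]) (auto split: split_indicator)
    moreover have "integrable Q (indicator (U - C) :: 'a \<Rightarrow> real)"
      by (simp add: Q(2) D less_top[symmetric])
    moreover have "\<bar>\<theta> x - indicator E x\<bar> \<le> indicator (U - C) x" for x
      using \<theta>01[of x] \<theta>(3,4)[of x] sub by (auto split: split_indicator)
    ultimately have "(\<integral>x. \<bar>\<theta> x - indicator E x\<bar> \<partial>Q) \<le> (\<integral>x. indicator (U - C) x \<partial>Q)"
      by (rule integral_mono)
    also have "\<dots> = measure Q (U - C)" using D by (simp add: Q(2) sets_eq_imp_space_eq[OF Q(2)])
    finally show ?thesis using CU(3) by simp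
  qed
  from this[OF Q(1,2) 1(1,3,5)] this[OF Q(3,4) 2(1,3,5)]
  have "(\<integral>x. \<bar>\<theta> x - indicator E x\<bar> \<partial>Q1) < \<epsilon>" "(\<integral>x. \<bar>\<theta> x - indicator E x\<bar> \<partial>Q2) < \<epsilon>"
    using 1(2,4) 2(2,4) by blast+
  thus ?thesis using \<theta>(1) \<theta>01 by blast
qed

text \<open>Estimates the error of replacing a sharp switch between g1 and g2 on E by a continuous blend of
approximations f1 and f2. The weight is measured in the measure with density |f2 - f1|, which is
finite, so that the preceding approximation applies to it even when Q is infinite.\<close>

lemma integral_blend_error:
  fixes f1 f2 g1 g2 \<theta> :: "'a::euclidean_space \<Rightarrow> real"
  assumes Q: "sets Q = sets borel" and i: "integrable Q f1" "integrable Q f2" "integrable Q g1" "integrable Q g2"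
    and E: "E \<in> sets borel" and \<theta>: "\<theta> \<in> borel_measurable borel" "\<And>x. 0 \<le> \<theta> x \<and> \<theta> x \<le> 1"
  shows "integrable Q (\<lambda>x. (1 - \<theta> x) * f1 x + \<theta> x * f2 x)"
    "integrable Q (\<lambda>x. if x \<in> E then g2 x else g1 x)"
    "(\<integral>x. \<bar>((1 - \<theta> x) * f1 x + \<theta> x * f2 x) - (if x \<in> E then g2 x else g1 x)\<bar> \<partial>Q) \<le>
      (\<integral>x. \<bar>\<theta> x - indicator E x\<bar> \<partial>density Q (\<lambda>x. ennreal \<bar>f2 x - f1 x\<bar>)) +
      (\<integral>x. \<bar>f1 x - g1 x\<bar> \<partial>Q) + (\<integral>x. \<bar>f2 x - g2 x\<bar> \<partial>Q)" (is "?lhs \<le> ?rhs")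
proof -
  have [measurable_cong]: "sets Q = sets borel" by fact
  have [measurable]: "E \<in> sets borel" "\<theta> \<in> borel_measurable borel" by fact+
  have [measurable]: "f1 \<in> borel_measurable borel" "f2 \<in> borel_measurable borel"
    "g1 \<in> borel_measurable borel" "g2 \<in> borel_measurable borel"
    using i by (auto dest!: borel_measurable_integrable)
  have bi: "integrable Q (\<lambda>x. h x * f x)"
    if "integrable Q f" "h \<in> borel_measurable borel" "\<And>x. \<bar>h x\<bar> \<le> 1" for h f :: "'a \<Rightarrow> real"
  proof (rule Bochner_Integration.integrable_bound[OF that(1)])
    show "(\<lambda>x. h x * f x) \<in> borel_measurable Q"
      using that(2) borel_measurable_integrable[OF that(1)] by measurable
    show "AE x in Q. norm (h x * f x) \<le> norm (f x)"
      using that(3) by (auto simp: abs_mult intro!: mult_left_le_one_le)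
  qed
  show blend: "integrable Q (\<lambda>x. (1 - \<theta> x) * f1 x + \<theta> x * f2 x)"
  proof (intro Bochner_Integration.integrable_add bi i)
    show "\<bar>1 - \<theta> x\<bar> \<le> 1" "\<bar>\<theta> x\<bar> \<le> 1" for x using \<theta>(2)[of x] by auto
  qed auto
  have "integrable Q (\<lambda>x. indicator E x * g2 x + indicator (- E) x * g1 x)"
    by (intro Bochner_Integration.integrable_add bi i) (auto simp: indicator_def)
  also have "(\<lambda>x. indicator E x * g2 x + indicator (- E) x * g1 x) = (\<lambda>x. if x \<in> E then g2 x else g1 x)"
    by (auto simp: indicator_def)
  finally show sw: "integrable Q (\<lambda>x. if x \<in> E then g2 x else g1 x)" .
  have d: "integrable Q (\<lambda>x. \<bar>\<theta> x - indicator E x\<bar> * \<bar>f2 x - f1 x\<bar>)"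
  proof (rule bi)
    show "integrable Q (\<lambda>x. \<bar>f2 x - f1 x\<bar>)"
      by (intro integrable_abs Bochner_Integration.integrable_diff i)
    show "\<bar>\<bar>\<theta> x - indicator E x\<bar>\<bar> \<le> 1" for x
      using \<theta>(2)[of x] by (cases "x \<in> E") simp_all
    show "(\<lambda>x. \<bar>\<theta> x - indicator E x\<bar>) \<in> borel_measurable borel" by measurable
  qed
  have "?lhs \<le>
      (\<integral>x. \<bar>\<theta> x - indicator E x\<bar> * \<bar>f2 x - f1 x\<bar> + \<bar>f1 x - g1 x\<bar> + \<bar>f2 x - g2 x\<bar> \<partial>Q)"
  proof (rule integral_mono)
    show "integrable Q (\<lambda>x. \<bar>((1 - \<theta> x) * f1 x + \<theta> x * f2 x) - (if x \<in> E then g2 x else g1 x)\<bar>)"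
      by (intro integrable_abs Bochner_Integration.integrable_diff blend sw)
    show "integrable Q (\<lambda>x. \<bar>\<theta> x - indicator E x\<bar> * \<bar>f2 x - f1 x\<bar> + \<bar>f1 x - g1 x\<bar> + \<bar>f2 x - g2 x\<bar>)"
      using i by (intro Bochner_Integration.integrable_add d integrable_abs Bochner_Integration.integrable_diff)
    fix x
    have "((1 - \<theta> x) * f1 x + \<theta> x * f2 x) - (if x \<in> E then g2 x else g1 x) =
        (\<theta> x - indicator E x) * (f2 x - f1 x) + (if x \<in> E then f2 x - g2 x else f1 x - g1 x)"
      by (simp add: algebra_simps)
    also have "\<bar>\<dots>\<bar> \<le> \<bar>\<theta> x - indicator E x\<bar> * \<bar>f2 x - f1 x\<bar> + \<bar>if x \<in> E then f2 x - g2 x else f1 x - g1 x\<bar>"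
      by (metis abs_mult abs_triangle_ineq)
    finally show "\<bar>((1 - \<theta> x) * f1 x + \<theta> x * f2 x) - (if x \<in> E then g2 x else g1 x)\<bar> \<le>
        \<bar>\<theta> x - indicator E x\<bar> * \<bar>f2 x - f1 x\<bar> + \<bar>f1 x - g1 x\<bar> + \<bar>f2 x - g2 x\<bar>"
      by (auto split: if_splits)
  qed
  also have "\<dots> = (\<integral>x. \<bar>f2 x - f1 x\<bar> * \<bar>\<theta> x - indicator E x\<bar> \<partial>Q) + (\<integral>x. \<bar>f1 x - g1 x\<bar> \<partial>Q) + (\<integral>x. \<bar>f2 x - g2 x\<bar> \<partial>Q)"
    using d i by (simp add: mult.commute)
  also have "(\<integral>x. \<bar>f2 x - f1 x\<bar> * \<bar>\<theta> x - indicator E x\<bar> \<partial>Q) =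
      (\<integral>x. \<bar>\<theta> x - indicator E x\<bar> \<partial>density Q (\<lambda>x. ennreal \<bar>f2 x - f1 x\<bar>))"
    by (subst integral_density) auto
  finally show "?lhs \<le> ?rhs" .
qed

lemma finite_measure_density_integrable:
  assumes "integrable Q (f :: 'a \<Rightarrow> real)"
  shows "finite_measure (density Q (\<lambda>x. ennreal \<bar>f x\<bar>))"
proof (rule finite_measureI)
  have [measurable]: "f \<in> borel_measurable Q" using assms by (rule borel_measurable_integrable)
  have "emeasure (density Q (\<lambda>x. ennreal \<bar>f x\<bar>)) (space Q) = (\<integral>\<^sup>+x. ennreal \<bar>f x\<bar> \<partial>Q)"
    by (subst emeasure_density) (auto intro!: nn_integral_cong)
  also have "\<dots> < \<infinity>" using assms by (simp add: integrable_iff_bounded)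
  finally show "emeasure (density Q (\<lambda>x. ennreal \<bar>f x\<bar>)) (space (density Q (\<lambda>x. ennreal \<bar>f x\<bar>))) \<noteq> \<infinity>" by simp
qed

section \<open>Affine minorants of the cost\<close>

locale cost_setting =
  fixes \<Omega> :: "'a::euclidean_space set" and c :: "'a \<Rightarrow> real \<Rightarrow> ereal"
  assumes domain: "bounded_lipschitz_domain \<Omega>" and cost: "cost_function \<Omega> c"
begin

lemma open_\<Omega>: "open \<Omega>" and bounded_\<Omega>: "bounded \<Omega>"
  using domain by (auto simp: bounded_lipschitz_domain_def)

lemma compact_closure_\<Omega>: "compact (closure \<Omega>)"
  using bounded_\<Omega> by (simp add: compact_closure)

lemma \<Omega>_borel [measurable]: "\<Omega> \<in> sets borel"
  using open_\<Omega> by (rule borel_open)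

lemma integrable_indicator_\<Omega>: "integrable lborel (indicator \<Omega> :: 'a \<Rightarrow> real)"
proof -
  have "emeasure lborel \<Omega> < \<infinity>" using bounded_\<Omega> by (rule emeasure_bounded_finite)
  thus ?thesis by simp
qed

lemma cost_nonneg: "x \<in> closure \<Omega> \<Longrightarrow> 0 \<le> c x t"
  using cost by (auto simp: cost_function_def normal_convex_integrand_def)

lemma cost_neg: "x \<in> closure \<Omega> \<Longrightarrow> t < 0 \<Longrightarrow> c x t = \<infinity>"
  using cost by (auto simp: cost_function_def)

lemma cost_usc: "usc_on (closure \<Omega>) (\<lambda>x. conj_fun (c x) t)"
  using cost by (auto simp: cost_function_def)

lemma cost_growth:
  obtains \<alpha> \<beta> where "0 < \<alpha>" "\<And>x t. x \<in> closure \<Omega> \<Longrightarrow> ereal (\<alpha> * t + \<beta>) \<le> c x t"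
proof -
  obtain \<alpha> \<beta> where "0 < \<alpha>" "\<forall>x\<in>closure \<Omega>. \<forall>t\<ge>0. ereal (\<alpha> * t + \<beta>) \<le> c x t"
    using cost by (auto simp: cost_function_def)
  hence "ereal (\<alpha> * t + \<beta>) \<le> c x t" if "x \<in> closure \<Omega>" for x t
    using cost_neg[OF that, of t] that by (cases "t < 0") auto
  with \<open>0 < \<alpha>\<close> show thesis by (rule that)
qed

lemma recession_nonneg: "x \<in> closure \<Omega> \<Longrightarrow> 0 \<le> recession (c x) 1"
proof -
  assume x: "x \<in> closure \<Omega>"
  have "conj_fun (c x) 0 < \<infinity>" using conj_0_le[of "c x"] cost_nonneg[OF x] by (auto intro: le_less_trans)
  thus ?thesis
    using le_recession_of_conj_finite[of "c x" 0] cost_nonneg[OF x] by (simp add: zero_ereal_def[symmetric])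
qed

lemma AE_convex_lsc: "AE x in lborel. x \<in> closure \<Omega> \<longrightarrow> lsc_fun (c x) \<and> convex_fun (c x)"
proof -
  have "AE x in lebesgue_on (closure \<Omega>). lsc_fun (c x) \<and> convex_fun (c x)"
    using cost by (auto simp: cost_function_def normal_convex_integrand_def)
  hence "AE x in lebesgue. x \<in> closure \<Omega> \<longrightarrow> lsc_fun (c x) \<and> convex_fun (c x)"
    by (subst (asm) AE_restrict_space_iff) auto
  thus ?thesis by (simp add: AE_completion_iff)
qed

lemma frontier_null: "frontier \<Omega> \<in> null_sets lborel"
proof -
  have "negligible (frontier \<Omega>)"
    using domain by (auto simp: bounded_lipschitz_domain_def intro: negligible_lipschitz_frontier)
  hence "frontier \<Omega> \<in> null_sets lebesgue" by (simp add: negligible_iff_null_sets)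
  thus ?thesis by (simp add: null_sets_def borel_closed)
qed

text \<open>The bound by the recession slope is required on the closure of \<Omega>, since singular mass may sit at any
point of it, and the bound against c almost everywhere in \<Omega>, where absolutely continuous mass lives.\<close>

definition minorants :: "(('a \<Rightarrow> real) \<times> ('a \<Rightarrow> real)) set" where
  "minorants = {(\<phi>, b). continuous_on UNIV \<phi> \<and> integrable lborel b \<and>
     (\<forall>x\<in>closure \<Omega>. ereal (\<phi> x) \<le> recession (c x) 1) \<and> (\<forall>x. x \<notin> \<Omega> \<longrightarrow> b x = 0) \<and>
     (AE x in lborel. x \<in> \<Omega> \<longrightarrow> (\<forall>t. ereal (\<phi> x * t - b x) \<le> c x t))}"

lemma minorantsD:
  assumes "(\<phi>, b) \<in> minorants"
  shows "continuous_on UNIV \<phi>" "integrable lborel b"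
    "x \<in> closure \<Omega> \<Longrightarrow> ereal (\<phi> x) \<le> recession (c x) 1" "x \<notin> \<Omega> \<Longrightarrow> b x = 0"
    "AE x in lborel. x \<in> \<Omega> \<longrightarrow> (\<forall>t. ereal (\<phi> x * t - b x) \<le> c x t)"
  using assms by (auto simp: minorants_def)

lemma zero_minorant: "(\<lambda>x. 0, \<lambda>x. 0) \<in> minorants"
  using recession_nonneg cost_nonneg closure_subset[of \<Omega>]
  by (auto simp: minorants_def zero_ereal_def[symmetric] intro!: AE_I2)

lemma ereal_convex_le:
  assumes "0 \<le> l" "l \<le> 1" "ereal p \<le> z" "ereal q \<le> z"
  shows "ereal ((1 - l) * p + l * q) \<le> z"
proof -
  have "(1 - l) * p + l * q \<le> (1 - l) * max p q + l * max p q"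
    using assms by (intro add_mono mult_left_mono) auto
  also have "\<dots> = max p q" by (simp add: algebra_simps)
  finally have "ereal ((1 - l) * p + l * q) \<le> ereal (max p q)" by (simp del: ereal_max)
  also have "\<dots> \<le> z" using assms by (auto simp: max_def)
  finally show ?thesis .
qed

text \<open>Both bounds in the definition are convex conditions at each point, so the weight may depend on x.\<close>

lemma blend_minorants:
  assumes 1: "(\<phi>1, b1) \<in> minorants" and 2: "(\<phi>2, b2) \<in> minorants"
    and \<theta>: "continuous_on UNIV \<theta>" "\<And>x. 0 \<le> \<theta> x \<and> \<theta> x \<le> 1"
  shows "(\<lambda>x. (1 - \<theta> x) * \<phi>1 x + \<theta> x * \<phi>2 x, \<lambda>x. (1 - \<theta> x) * b1 x + \<theta> x * b2 x) \<in> minorants"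
proof -
  note D1 = minorantsD[OF 1] and D2 = minorantsD[OF 2]
  have "continuous_on UNIV (\<lambda>x. (1 - \<theta> x) * \<phi>1 x + \<theta> x * \<phi>2 x)"
    by (intro continuous_intros \<theta>(1) D1(1) D2(1))
  moreover have "integrable lborel (\<lambda>x. (1 - \<theta> x) * b1 x + \<theta> x * b2 x)"
    by (rule integral_blend_error(1)[where ?g1.0=b1 and ?g2.0=b2 and E="{}"])
       (use D1 D2 \<theta> in \<open>auto intro: borel_measurable_continuous_onI\<close>)
  moreover have "ereal ((1 - \<theta> x) * \<phi>1 x + \<theta> x * \<phi>2 x) \<le> recession (c x) 1" if "x \<in> closure \<Omega>" for x
    using \<theta>(2)[of x] D1(3)[OF that] D2(3)[OF that] by (intro ereal_convex_le) auto
  moreover have "AE x in lborel. x \<in> \<Omega> \<longrightarrow>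
      (\<forall>t. ereal (((1 - \<theta> x) * \<phi>1 x + \<theta> x * \<phi>2 x) * t - ((1 - \<theta> x) * b1 x + \<theta> x * b2 x)) \<le> c x t)"
    using D1(5) D2(5)
  proof eventually_elim
    case (elim x)
    show ?case
    proof (intro impI allI)
      fix t assume "x \<in> \<Omega>"
      hence "ereal ((1 - \<theta> x) * (\<phi>1 x * t - b1 x) + \<theta> x * (\<phi>2 x * t - b2 x)) \<le> c x t"
        using \<theta>(2)[of x] elim by (intro ereal_convex_le) auto
      thus "ereal (((1 - \<theta> x) * \<phi>1 x + \<theta> x * \<phi>2 x) * t - ((1 - \<theta> x) * b1 x + \<theta> x * b2 x)) \<le> c x t"
        by (simp add: algebra_simps)
    qed
  qed
  ultimately show ?thesis using D1(4) D2(4) by (simp add: minorants_def)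
qed

text \<open>The coercive minorant: growth of c at rate \<alpha> in t also bounds the recession slope below by \<alpha>.\<close>

lemma mass_minorant:
  obtains \<alpha> b where "0 < \<alpha>" "(\<lambda>x. \<alpha>, b) \<in> minorants"
proof -
  obtain \<alpha> \<beta> where \<alpha>: "0 < \<alpha>" "\<And>x t. x \<in> closure \<Omega> \<Longrightarrow> ereal (\<alpha> * t + \<beta>) \<le> c x t"
    using cost_growth by blast
  have "ereal \<alpha> \<le> recession (c x) 1" if "x \<in> closure \<Omega>" for x
  proof (rule le_recession_of_conj_finite)
    have "conj_fun (c x) \<alpha> \<le> ereal (- \<beta>)"
      using conj_le_iff[of "c x" \<alpha> "- \<beta>"] cost_nonneg[OF that] \<alpha>(2)[OF that] by simp
    thus "conj_fun (c x) \<alpha> < \<infinity>" by (rule le_less_trans) simp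
  qed (use cost_nonneg that in auto)
  moreover have "integrable lborel (\<lambda>x. - \<beta> * indicator \<Omega> x)"
    using integrable_indicator_\<Omega> by simp
  ultimately have "(\<lambda>x. \<alpha>, \<lambda>x. - \<beta> * indicator \<Omega> x) \<in> minorants"
    using \<alpha>(2) closure_subset[of \<Omega>] by (auto simp: minorants_def intro!: AE_I2)
  with \<alpha>(1) show thesis by (rule that)
qed

definition carried :: "'a measure \<Rightarrow> bool" where
  "carried M \<longleftrightarrow> finite_measure M \<and> sets M = sets borel \<and> emeasure M (- closure \<Omega>) = 0"

lemma carriedD:
  assumes "carried M"
  shows "finite_measure M" "sets M = sets borel" "AE x in M. x \<in> closure \<Omega>"
proof -
  show M: "finite_measure M" "sets M = sets borel" using assms by (auto simp: carried_def)
  have "- closure \<Omega> \<in> null_sets M"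
    using assms M by (auto simp: carried_def null_sets_def borel_closed)
  from AE_not_in[OF this] show "AE x in M. x \<in> closure \<Omega>" by eventually_elim simp
qed

lemma carried_integrable:
  assumes M: "carried M" and c: "continuous_on UNIV (\<phi> :: 'a \<Rightarrow> real)"
  shows "integrable M \<phi>"
  by (rule integrable_continuous_compact[OF carriedD(1,2)[OF M] compact_closure_\<Omega> carriedD(3)[OF M] c])

text \<open>The closure carries M and the boundary is null.\<close>

lemma density_0_outside:
  assumes M: "carried M" and split: "lebesgue_split M a N"
  shows "AE x in lborel. x \<notin> \<Omega> \<longrightarrow> a x = 0"
proof -
  note D = lebesgue_splitD[OF split]
  have [measurable]: "a \<in> borel_measurable borel" "N \<in> sets borel" using D by auto
  have [measurable_cong]: "sets M = sets borel" by (rule carriedD(2)[OF M])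
  have K[measurable]: "- closure \<Omega> \<in> sets borel" by (simp add: borel_closed)
  have "(\<integral>\<^sup>+x. ennreal (a x) * indicator (- closure \<Omega>) x \<partial>lborel) =
      emeasure (density lborel (\<lambda>x. ennreal (a x))) (- closure \<Omega>)"
    by (subst emeasure_density) auto
  also have "\<dots> = emeasure (density M (indicator (- N))) (- closure \<Omega>)" by (simp add: D(6))
  also have "\<dots> = (\<integral>\<^sup>+x. indicator (- N) x * indicator (- closure \<Omega>) x \<partial>M)"
    by (subst emeasure_density) auto
  also have "\<dots> = (\<integral>\<^sup>+x. 0 \<partial>M)"
    using carriedD(3)[OF M] by (intro nn_integral_cong_AE) (auto split: split_indicator)
  finally have "AE x in lborel. ennreal (a x) * indicator (- closure \<Omega>) x = 0"
    by (subst nn_integral_0_iff_AE[symmetric]) auto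
  with AE_not_in[OF frontier_null] show ?thesis
  proof eventually_elim
    case (elim x)
    show ?case
    proof
      assume "x \<notin> \<Omega>"
      hence "x \<notin> closure \<Omega>" using elim(1) open_\<Omega> by (simp add: frontier_def interior_open)
      thus "a x = 0" using elim(2) D(2)[of x] by (simp add: ennreal_eq_0_iff)
    qed
  qed
qed

lemma ennreal_integral_le:
  assumes "integrable Q (f :: 'b \<Rightarrow> real)"
  shows "ennreal (\<integral>x. f x \<partial>Q) \<le> (\<integral>\<^sup>+x. ennreal (f x) \<partial>Q)"
proof -
  have "(\<integral>x. f x \<partial>Q) \<le> (\<integral>x. max 0 (f x) \<partial>Q)"
    using assms by (intro integral_mono) auto
  hence "ennreal (\<integral>x. f x \<partial>Q) \<le> ennreal (\<integral>x. max 0 (f x) \<partial>Q)" by (rule ennreal_leI)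
  also have "\<dots> = (\<integral>\<^sup>+x. ennreal (max 0 (f x)) \<partial>Q)"
    using assms by (intro nn_integral_eq_integral[symmetric]) auto
  also have "\<dots> = (\<integral>\<^sup>+x. ennreal (f x) \<partial>Q)"
    by (intro nn_integral_cong) (simp add: max_def ennreal_neg)
  finally show ?thesis .
qed

lemma integral_minorant_split:
  assumes M: "carried M" and split: "lebesgue_split M a N" and i: "integrable M \<phi>" "integrable lborel b"
  shows "integrable lborel (\<lambda>x. a x * \<phi> x - b x)" "integrable (density M (indicator N)) \<phi>"
    "(\<integral>x. \<phi> x \<partial>M) - (\<integral>x. b x \<partial>lborel) =
      (\<integral>x. a x * \<phi> x - b x \<partial>lborel) + (\<integral>x. \<phi> x \<partial>density M (indicator N))" (is "?lhs = ?rhs")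
proof -
  note D = lebesgue_splitD[OF split] and S = integral_lebesgue_split[OF carriedD(2)[OF M] split i(1)]
  have [measurable_cong]: "sets M = sets borel" by (rule carriedD(2)[OF M])
  have [measurable]: "N \<in> sets borel" "\<phi> \<in> borel_measurable borel"
    using D borel_measurable_integrable[OF i(1)] by auto
  show "integrable lborel (\<lambda>x. a x * \<phi> x - b x)" using S(1) i(2) by simp
  have "integrable M (\<lambda>x. indicator N x * \<phi> x)"
    using integrable_mult_indicator[OF _ i(1), of N] by simp
  hence "integrable (density M (\<lambda>x. ennreal (indicator N x))) \<phi>"
    by (subst integrable_density) auto
  thus "integrable (density M (indicator N)) \<phi>" by (simp add: ennreal_indicator)
  have "(\<integral>x. \<phi> x \<partial>density M (\<lambda>x. ennreal (indicator N x))) = (\<integral>x. indicator N x * \<phi> x \<partial>M)"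
    by (subst integral_density) auto
  thus "?lhs = ?rhs"
    using S i(2) by (simp add: ennreal_indicator)
qed

text \<open>Split M into density and singular part. On the first, \<phi> a - b \<le> c(x, a) pointwise by definition; on
the second, \<phi> is at most the recession slope.\<close>

lemma minorant_le_cost:
  assumes M: "carried M" and mem: "(\<phi>, b) \<in> minorants"
  shows "ereal ((\<integral>x. \<phi> x \<partial>M) - (\<integral>x. b x \<partial>lborel)) \<le> cost_functional \<Omega> c (measure M)"
proof -
  note mD = minorantsD[OF mem]
  obtain a N where split: "lebesgue_split M a N"
    using exists_lebesgue_split[OF carriedD(1,2)[OF M]] by blast
  note D = lebesgue_splitD[OF split]
  note S = integral_minorant_split[OF M split carried_integrable[OF M mD(1)] mD(2)]
  have [measurable_cong]: "sets M = sets borel" by (rule carriedD(2)[OF M])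
  have [measurable]: "N \<in> sets borel" using D by auto
  let ?X = "\<integral>\<^sup>+x. e2ennreal (c x (a x)) * indicator \<Omega> x \<partial>lborel"
  let ?Y = "\<integral>\<^sup>+x. e2ennreal (recession (c x) 1) \<partial>density M (indicator N)"
  have "ennreal (\<integral>x. a x * \<phi> x - b x \<partial>lborel) \<le> (\<integral>\<^sup>+x. ennreal (a x * \<phi> x - b x) \<partial>lborel)"
    by (rule ennreal_integral_le[OF S(1)])
  also have "\<dots> \<le> ?X"
  proof (rule nn_integral_mono_AE)
    show "AE x in lborel. ennreal (a x * \<phi> x - b x) \<le> e2ennreal (c x (a x)) * indicator \<Omega> x"
      using mD(5) density_0_outside[OF M split]
    proof eventually_elim
      case (elim x)
      show ?case
      proof (cases "x \<in> \<Omega>")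
        case True
        hence "e2ennreal (ereal (\<phi> x * a x - b x)) \<le> e2ennreal (c x (a x))"
          using elim by (intro e2ennreal_mono) auto
        thus ?thesis using True by (simp add: mult.commute)
      next
        case False
        thus ?thesis using elim mD(4) by simp
      qed
    qed
  qed
  finally have X: "ennreal (\<integral>x. a x * \<phi> x - b x \<partial>lborel) \<le> ?X" .
  have "ennreal (\<integral>x. \<phi> x \<partial>density M (indicator N)) \<le> (\<integral>\<^sup>+x. ennreal (\<phi> x) \<partial>density M (indicator N))"
    by (rule ennreal_integral_le[OF S(2)])
  also have "\<dots> \<le> ?Y"
  proof (rule nn_integral_mono_AE)
    have "AE x in M. ennreal (\<phi> x) \<le> e2ennreal (recession (c x) 1)"
      using carriedD(3)[OF M]
    proof eventually_elim
      case (elim x)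
      show ?case using e2ennreal_mono[OF mD(3)[OF elim]] by simp
    qed
    thus "AE x in density M (indicator N). ennreal (\<phi> x) \<le> e2ennreal (recession (c x) 1)"
      by (subst AE_density) auto
  qed
  finally have Y: "ennreal (\<integral>x. \<phi> x \<partial>density M (indicator N)) \<le> ?Y" .
  have "ereal ((\<integral>x. \<phi> x \<partial>M) - (\<integral>x. b x \<partial>lborel)) \<le>
      enn2ereal (ennreal (\<integral>x. a x * \<phi> x - b x \<partial>lborel) + ennreal (\<integral>x. \<phi> x \<partial>density M (indicator N)))"
    unfolding S(3) plus_ennreal.rep_eq ennreal.rep_eq plus_ereal.simps(1)[symmetric]
    by (rule add_mono) (auto simp: sup_ereal_def)
  also have "\<dots> \<le> enn2ereal (?X + ?Y)"
    using add_mono[OF X Y] by (simp add: less_eq_ennreal.rep_eq)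
  also have "\<dots> = cost_functional \<Omega> c (measure M)"
    by (rule cost_functional_measure[OF carriedD(1,2)[OF M] split open_\<Omega>, symmetric])
  finally show ?thesis .
qed

end

section \<open>Minorants exhaust the cost\<close>

lemma le_ennreal_if_reals_below:
  fixes z :: ereal and S :: ennreal
  assumes H: "\<And>v. 0 \<le> v \<Longrightarrow> ereal v < z \<Longrightarrow> ennreal v \<le> S"
  shows "e2ennreal z \<le> S"
proof (rule dense_le)
  fix y assume y: "y < e2ennreal z"
  then obtain v where v: "y = ennreal v" "0 \<le> v" by (cases y) auto
  have "\<not> z \<le> ereal v"
  proof
    assume "z \<le> ereal v"
    from e2ennreal_mono[OF this] show False using y v by simp
  qed
  with H[OF v(2)] v(1) show "y \<le> S" by simp
qed

context cost_setting
begin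

text \<open>Pairs of possibly discontinuous functions in the L1-closure of the minorants, with respect to M for
the slope and to Lebesgue measure for the offset.\<close>

definition approximable :: "'a measure \<Rightarrow> ('a \<Rightarrow> real) \<Rightarrow> ('a \<Rightarrow> real) \<Rightarrow> bool" where
  "approximable M \<psi> b \<longleftrightarrow> integrable M \<psi> \<and> integrable lborel b \<and>
     (\<forall>\<epsilon>>0. \<exists>\<phi> b'. (\<phi>, b') \<in> minorants \<and>
        (\<integral>x. \<bar>\<phi> x - \<psi> x\<bar> \<partial>M) < \<epsilon> \<and> (\<integral>x. \<bar>b' x - b x\<bar> \<partial>lborel) < \<epsilon>)"

lemma approximable_minorant:
  assumes M: "carried M" and mem: "(\<phi>, b) \<in> minorants"
  shows "approximable M \<phi> b"
  unfolding approximable_def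
proof (intro conjI allI impI)
  show "integrable M \<phi>" by (rule carried_integrable[OF M minorantsD(1)[OF mem]])
  show "integrable lborel b" by (rule minorantsD(2)[OF mem])
  fix \<epsilon> :: real assume "0 < \<epsilon>"
  with mem show "\<exists>\<phi>' b'. (\<phi>', b') \<in> minorants \<and>
      (\<integral>x. \<bar>\<phi>' x - \<phi> x\<bar> \<partial>M) < \<epsilon> \<and> (\<integral>x. \<bar>b' x - b x\<bar> \<partial>lborel) < \<epsilon>"
    by (intro exI[of _ \<phi>] exI[of _ b]) simp
qed

text \<open>Approximate the indicator of E by continuous weights in the finite measures with densities
|\<phi>2 - \<phi>1| and |d2 - d1|, and blend.\<close>

lemma approximable_switch:
  assumes M: "carried M" and 1: "approximable M \<psi>1 b1" and 2: "approximable M \<psi>2 b2"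
    and E: "E \<in> sets borel"
  shows "approximable M (\<lambda>x. if x \<in> E then \<psi>2 x else \<psi>1 x) (\<lambda>x. if x \<in> E then b2 x else b1 x)"
  unfolding approximable_def
proof (intro conjI allI impI)
  have sM: "sets M = sets borel" by (rule carriedD(2)[OF M])
  have i: "integrable M \<psi>1" "integrable M \<psi>2" "integrable lborel b1" "integrable lborel b2"
    using 1 2 by (auto simp: approximable_def)
  show "integrable M (\<lambda>x. if x \<in> E then \<psi>2 x else \<psi>1 x)"
    by (rule integral_blend_error(2)[OF sM i(1,2,1,2) E, of "\<lambda>x. 0"]) auto
  show "integrable lborel (\<lambda>x. if x \<in> E then b2 x else b1 x)"
    by (rule integral_blend_error(2)[OF sets_lborel i(3,4,3,4) E, of "\<lambda>x. 0"]) auto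
  fix \<epsilon> :: real assume "0 < \<epsilon>"
  hence \<epsilon>: "0 < \<epsilon> / 3" by simp
  obtain \<phi>1 d1 where a1: "(\<phi>1, d1) \<in> minorants"
    "(\<integral>x. \<bar>\<phi>1 x - \<psi>1 x\<bar> \<partial>M) < \<epsilon> / 3" "(\<integral>x. \<bar>d1 x - b1 x\<bar> \<partial>lborel) < \<epsilon> / 3"
    using 1 \<epsilon> unfolding approximable_def by blast
  obtain \<phi>2 d2 where a2: "(\<phi>2, d2) \<in> minorants"
    "(\<integral>x. \<bar>\<phi>2 x - \<psi>2 x\<bar> \<partial>M) < \<epsilon> / 3" "(\<integral>x. \<bar>d2 x - b2 x\<bar> \<partial>lborel) < \<epsilon> / 3"
    using 2 \<epsilon> unfolding approximable_def by blast
  have j: "integrable M \<phi>1" "integrable M \<phi>2" "integrable lborel d1" "integrable lborel d2"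
    using a1(1) a2(1) by (auto intro: carried_integrable[OF M] dest: minorantsD(1,2))
  have f: "finite_measure (density M (\<lambda>x. ennreal \<bar>\<phi>2 x - \<phi>1 x\<bar>))"
    "finite_measure (density lborel (\<lambda>x. ennreal \<bar>d2 x - d1 x\<bar>))"
    by (intro finite_measure_density_integrable Bochner_Integration.integrable_diff j)+
  obtain \<theta> :: "'a \<Rightarrow> real" where \<theta>: "continuous_on UNIV \<theta>" "\<And>x. 0 \<le> \<theta> x \<and> \<theta> x \<le> 1"
    "(\<integral>x. \<bar>\<theta> x - indicator E x\<bar> \<partial>density M (\<lambda>x. ennreal \<bar>\<phi>2 x - \<phi>1 x\<bar>)) < \<epsilon> / 3"
    "(\<integral>x. \<bar>\<theta> x - indicator E x\<bar> \<partial>density lborel (\<lambda>x. ennreal \<bar>d2 x - d1 x\<bar>)) < \<epsilon> / 3"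
    using continuous_approx_indicator[OF f(1) _ f(2) _ E \<epsilon>] sM by auto
  have \<theta>m: "\<theta> \<in> borel_measurable borel" using \<theta>(1) by (rule borel_measurable_continuous_onI)
  let ?\<phi> = "\<lambda>x. (1 - \<theta> x) * \<phi>1 x + \<theta> x * \<phi>2 x" and ?d = "\<lambda>x. (1 - \<theta> x) * d1 x + \<theta> x * d2 x"
  have "(?\<phi>, ?d) \<in> minorants" by (rule blend_minorants[OF a1(1) a2(1) \<theta>(1,2)])
  moreover have "(\<integral>x. \<bar>?\<phi> x - (if x \<in> E then \<psi>2 x else \<psi>1 x)\<bar> \<partial>M) < \<epsilon>"
    using integral_blend_error(3)[OF sM j(1,2) i(1,2) E \<theta>m \<theta>(2)] \<theta>(3) a1(2) a2(2) by linarith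
  moreover have "(\<integral>x. \<bar>?d x - (if x \<in> E then b2 x else b1 x)\<bar> \<partial>lborel) < \<epsilon>"
    using integral_blend_error(3)[OF sets_lborel j(3,4) i(3,4) E \<theta>m \<theta>(2)] \<theta>(4) a1(3) a2(3) by linarith
  ultimately show "\<exists>\<phi> b'. (\<phi>, b') \<in> minorants \<and>
      (\<integral>x. \<bar>\<phi> x - (if x \<in> E then \<psi>2 x else \<psi>1 x)\<bar> \<partial>M) < \<epsilon> \<and>
      (\<integral>x. \<bar>b' x - (if x \<in> E then b2 x else b1 x)\<bar> \<partial>lborel) < \<epsilon>"
    by blast
qed

lemma approximable_value_le:
  assumes M: "carried M" and ap: "approximable M \<psi> b"
    and le: "\<And>\<phi> b. (\<phi>, b) \<in> minorants \<Longrightarrow> (\<integral>x. \<phi> x \<partial>M) - (\<integral>x. b x \<partial>lborel) \<le> z"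
  shows "(\<integral>x. \<psi> x \<partial>M) - (\<integral>x. b x \<partial>lborel) \<le> z"
proof (rule field_le_epsilon)
  fix \<epsilon> :: real assume "0 < \<epsilon>"
  hence \<epsilon>: "0 < \<epsilon> / 2" by simp
  obtain \<phi> d where a: "(\<phi>, d) \<in> minorants"
    "(\<integral>x. \<bar>\<phi> x - \<psi> x\<bar> \<partial>M) < \<epsilon> / 2" "(\<integral>x. \<bar>d x - b x\<bar> \<partial>lborel) < \<epsilon> / 2"
    using ap \<epsilon> unfolding approximable_def by blast
  have i: "integrable M \<psi>" "integrable lborel b" using ap by (auto simp: approximable_def)
  have j: "integrable M \<phi>" "integrable lborel d"
    using a(1) by (auto intro: carried_integrable[OF M] dest: minorantsD(1,2))
  have "\<bar>(\<integral>x. \<phi> x \<partial>M) - (\<integral>x. \<psi> x \<partial>M)\<bar> \<le> (\<integral>x. \<bar>\<phi> x - \<psi> x\<bar> \<partial>M)"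
    using integral_abs_bound[of M "\<lambda>x. \<phi> x - \<psi> x"] i j by simp
  moreover have "\<bar>(\<integral>x. d x \<partial>lborel) - (\<integral>x. b x \<partial>lborel)\<bar> \<le> (\<integral>x. \<bar>d x - b x\<bar> \<partial>lborel)"
    using integral_abs_bound[of lborel "\<lambda>x. d x - b x"] i j by simp
  ultimately show "(\<integral>x. \<psi> x \<partial>M) - (\<integral>x. b x \<partial>lborel) \<le> z + \<epsilon>"
    using le[OF a(1)] a(2,3) by linarith
qed

text \<open>The density of \<integral> \<phi> dM - \<integral> b dx, with respect to Lebesgue measure off N and with respect to M on N.\<close>

definition gain :: "('a \<Rightarrow> real) \<Rightarrow> 'a set \<Rightarrow> ('a \<Rightarrow> real) \<Rightarrow> ('a \<Rightarrow> real) \<Rightarrow> 'a \<Rightarrow> real" where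
  "gain a N \<phi> b x = (if x \<in> N then \<phi> x else a x * \<phi> x - b x)"

text \<open>Switch to the next minorant exactly on the Borel set where it gains more. Starting from the zero
minorant keeps the gain non-negative, so that integrals of positive parts can be used later.\<close>

lemma approximable_max:
  fixes \<phi> b :: "nat \<Rightarrow> 'a \<Rightarrow> real"
  assumes M: "carried M" and meas: "a \<in> borel_measurable borel" "N \<in> sets borel"
    and mem: "\<And>i. (\<phi> i, b i) \<in> minorants"
  shows "\<exists>\<psi> d. approximable M \<psi> d \<and>
    (\<forall>x. 0 \<le> gain a N \<psi> d x) \<and>
    (\<forall>i<m. \<forall>x. gain a N (\<phi> i) (b i) x \<le> gain a N \<psi> d x)"
proof (induction m)
  case 0
  show ?case
    using approximable_minorant[OF M zero_minorant]
    by (intro exI[of _ "\<lambda>x. 0"]) (simp add: gain_def)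
next
  case (Suc m)
  then obtain \<psi> d where IH: "approximable M \<psi> d" "\<forall>x. 0 \<le> gain a N \<psi> d x"
    "\<forall>i<m. \<forall>x. gain a N (\<phi> i) (b i) x \<le> gain a N \<psi> d x" by blast
  have [measurable]: "a \<in> borel_measurable borel" "N \<in> sets borel" by fact+
  have [measurable_cong]: "sets M = sets borel" by (rule carriedD(2)[OF M])
  have [measurable]: "\<psi> \<in> borel_measurable borel" "d \<in> borel_measurable borel"
    using IH(1) by (auto simp: approximable_def dest: borel_measurable_integrable)
  have [measurable]: "\<phi> m \<in> borel_measurable borel" "b m \<in> borel_measurable borel"
    using minorantsD(1,2)[OF mem[of m]]
    by (auto dest: borel_measurable_integrable borel_measurable_continuous_onI)
  define E where "E = {x. gain a N \<psi> d x < gain a N (\<phi> m) (b m) x}"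
  have E: "E \<in> sets borel" unfolding E_def gain_def by measurable
  let ?\<psi> = "\<lambda>x. if x \<in> E then \<phi> m x else \<psi> x" and ?d = "\<lambda>x. if x \<in> E then b m x else d x"
  have "approximable M ?\<psi> ?d"
    by (rule approximable_switch[OF M IH(1) approximable_minorant[OF M mem] E])
  moreover have eq: "gain a N ?\<psi> ?d x =
      max (gain a N \<psi> d x) (gain a N (\<phi> m) (b m) x)" for x
  proof (cases "x \<in> E")
    case True
    hence "gain a N \<psi> d x < gain a N (\<phi> m) (b m) x" by (simp add: E_def)
    thus ?thesis using True by (simp add: gain_def max_def)
  next
    case False
    hence "\<not> gain a N \<psi> d x < gain a N (\<phi> m) (b m) x" by (simp add: E_def)
    thus ?thesis using False by (simp add: gain_def max_def)
  qed
  ultimately show ?case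
    using IH(2,3) by (intro exI[of _ ?\<psi>] exI[of _ ?d]) (simp add: le_max_iff_disj less_Suc_eq all_conj_distrib)
qed

text \<open>Taken open in the whole space, so that its bumps are continuous there.\<close>

definition sublevel :: "real \<Rightarrow> nat \<Rightarrow> 'a set" where
  "sublevel q n = (SOME W. open W \<and> {x \<in> closure \<Omega>. conj_fun (c x) q < ereal (real n)} = closure \<Omega> \<inter> W)"

lemma sublevel:
  "open (sublevel q n)"
  "x \<in> closure \<Omega> \<Longrightarrow> x \<in> sublevel q n \<longleftrightarrow> conj_fun (c x) q < ereal (real n)"
proof -
  have "open (sublevel q n) \<and>
      {x \<in> closure \<Omega>. conj_fun (c x) q < ereal (real n)} = closure \<Omega> \<inter> sublevel q n"
    unfolding sublevel_def by (rule someI_ex) (rule usc_sublevel_open[OF cost_usc])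
  thus "open (sublevel q n)"
    "x \<in> closure \<Omega> \<Longrightarrow> x \<in> sublevel q n \<longleftrightarrow> conj_fun (c x) q < ereal (real n)" by blast+
qed

lemma conj_measurable:
  "(\<lambda>x. if x \<in> closure \<Omega> then conj_fun (c x) q else \<infinity>) \<in> borel_measurable borel"
proof (rule borel_measurableI_less)
  fix y :: ereal
  obtain W where W: "open W" "{x \<in> closure \<Omega>. conj_fun (c x) q < y} = closure \<Omega> \<inter> W"
    using usc_sublevel_open[OF cost_usc] by blast
  have "{x. (if x \<in> closure \<Omega> then conj_fun (c x) q else \<infinity>) < y} = {x \<in> closure \<Omega>. conj_fun (c x) q < y}"
    by auto
  thus "{x \<in> space borel. (if x \<in> closure \<Omega> then conj_fun (c x) q else \<infinity>) < y} \<in> sets borel"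
    using W by (simp add: borel_open borel_closed sets.Int)
qed

definition local_slope :: "real \<Rightarrow> nat \<Rightarrow> nat \<Rightarrow> 'a \<Rightarrow> real" where
  "local_slope q n k x = q * bump (sublevel q n) k x"

text \<open>The conjugate truncated below at -j. The conjugate itself may be -\<infinity>, namely where c(x, .) is identically +\<infinity>, and a
minorant needs an integrable offset.\<close>

definition truncated_conj :: "real \<Rightarrow> nat \<Rightarrow> 'a \<Rightarrow> real" where
  "truncated_conj q j x =
     real_of_ereal (max (- ereal (real j)) (if x \<in> closure \<Omega> then conj_fun (c x) q else \<infinity>))"

definition local_offset :: "real \<Rightarrow> nat \<Rightarrow> nat \<Rightarrow> nat \<Rightarrow> 'a \<Rightarrow> real" where
  "local_offset q n k j x = indicator \<Omega> x * (bump (sublevel q n) k x * truncated_conj q j x)"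

lemma truncated_conj_bounds:
  assumes "x \<in> closure \<Omega>" "x \<in> sublevel q n"
  shows "ereal (truncated_conj q j x) = max (- ereal (real j)) (conj_fun (c x) q)"
    "\<bar>truncated_conj q j x\<bar> \<le> real n + real j"
proof -
  have lt: "conj_fun (c x) q < ereal (real n)" using assms sublevel(2) by blast
  show "ereal (truncated_conj q j x) = max (- ereal (real j)) (conj_fun (c x) q)"
    "\<bar>truncated_conj q j x\<bar> \<le> real n + real j"
    using assms(1) lt unfolding truncated_conj_def by (cases "conj_fun (c x) q"; auto simp: max_def)+
qed

text \<open>On the sublevel set the line q t - c*(x, q) lies below c and is blended, with weight the bump,
with the zero line; elsewhere only the zero line remains.\<close>

lemma local_minorant: "(local_slope q n k, local_offset q n k j) \<in> minorants"
proof -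
  have meas: "local_offset q n k j \<in> borel_measurable borel"
  proof -
    have [measurable]: "bump (sublevel q n) k \<in> borel_measurable borel"
      by (rule borel_measurable_continuous_onI[OF continuous_bump])
    note conj_measurable[measurable]
    show ?thesis unfolding local_offset_def truncated_conj_def by measurable
  qed
  have "integrable lborel (local_offset q n k j)"
  proof (rule Bochner_Integration.integrable_bound[where f="\<lambda>x. (real n + real j) * indicator \<Omega> x"])
    show "integrable lborel (\<lambda>x. (real n + real j) * indicator \<Omega> x)"
      using integrable_indicator_\<Omega> by simp
    show "local_offset q n k j \<in> borel_measurable lborel" using meas by simp
    show "AE x in lborel. norm (local_offset q n k j x) \<le> norm ((real n + real j) * indicator \<Omega> x)"
    proof (rule AE_I2)
      fix x :: 'a
      show "norm (local_offset q n k j x) \<le> norm ((real n + real j) * indicator \<Omega> x)"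
      proof (cases "x \<in> \<Omega> \<and> x \<in> sublevel q n")
        case True
        hence x: "x \<in> closure \<Omega>" using closure_subset by blast
        have "bump (sublevel q n) k x * \<bar>truncated_conj q j x\<bar>
            \<le> 1 * (real n + real j)"
          by (rule mult_mono) (use truncated_conj_bounds(2)[OF x, of q n j] True in auto)
        thus ?thesis using True by (simp add: local_offset_def abs_mult)
      next
        case False
        thus ?thesis by (auto simp: local_offset_def bump_eq_0)
      qed
    qed
  qed
  moreover have "ereal (local_slope q n k x) \<le> recession (c x) 1" if x: "x \<in> closure \<Omega>" for x
  proof (cases "x \<in> sublevel q n")
    case True
    hence "conj_fun (c x) q < \<infinity>" using sublevel(2)[OF x] less_trans by fastforce
    hence "ereal q \<le> recession (c x) 1"
      by (intro le_recession_of_conj_finite cost_nonneg x)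
    moreover have "q * bump (sublevel q n) k x \<le> max 0 q"
    proof (cases "0 \<le> q")
      case True
      thus ?thesis by (simp add: mult_left_le)
    next
      case False
      thus ?thesis by (simp add: mult_nonpos_nonneg max_def)
    qed
    ultimately show ?thesis
      using recession_nonneg[OF x] unfolding local_slope_def
      by (metis ereal_less_eq(3) max_def order_trans zero_ereal_def)
  next
    case False
    thus ?thesis using recession_nonneg[OF x] by (simp add: local_slope_def bump_eq_0 zero_ereal_def[symmetric])
  qed
  moreover have "ereal (local_slope q n k x * t - local_offset q n k j x) \<le> c x t" if x: "x \<in> \<Omega>" for x t
  proof -
    have xK: "x \<in> closure \<Omega>" using x closure_subset by blast
    show ?thesis
    proof (cases "x \<in> sublevel q n")
      case True
      define m where "m = truncated_conj q j x"
      have "conj_fun (c x) q \<le> ereal m"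
        using truncated_conj_bounds(1)[OF xK True, of j] by (simp add: m_def)
      hence le: "ereal (q * t - m) \<le> c x t"
        using conj_le_iff[of "c x" q m] cost_nonneg[OF xK] by blast
      have "local_slope q n k x * t - local_offset q n k j x = (1 - bump (sublevel q n) k x) * 0 + bump (sublevel q n) k x * (q * t - m)"
        using x by (simp add: local_slope_def local_offset_def m_def algebra_simps)
      also have "ereal \<dots> \<le> c x t"
        using le cost_nonneg[OF xK] by (intro ereal_convex_le) (auto simp: zero_ereal_def[symmetric])
      finally show ?thesis .
    next
      case False
      thus ?thesis using cost_nonneg[OF xK]
        by (simp add: local_slope_def local_offset_def bump_eq_0 zero_ereal_def[symmetric])
    qed
  qed
  ultimately show ?thesis
    by (auto simp: minorants_def local_slope_def[abs_def] local_offset_def intro!: AE_I2 continuous_intros)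
qed

definition enum_index :: "nat \<Rightarrow> rat \<times> nat \<times> nat \<times> nat" where
  "enum_index = from_nat"

text \<open>An enumeration of the local minorants over all rational slopes q, bounds n, bump indices k and
truncations j.\<close>

definition slope_seq :: "nat \<Rightarrow> 'a \<Rightarrow> real" where
  "slope_seq i = (case enum_index i of (q, n, k, j) \<Rightarrow> local_slope (of_rat q) n k)"

definition offset_seq :: "nat \<Rightarrow> 'a \<Rightarrow> real" where
  "offset_seq i = (case enum_index i of (q, n, k, j) \<Rightarrow> local_offset (of_rat q) n k j)"

lemma seq_minorant: "(slope_seq i, offset_seq i) \<in> minorants"
  by (simp add: slope_seq_def offset_seq_def local_minorant split: prod.split)

lemma seq_surj: "\<exists>i. slope_seq i = local_slope (of_rat q) n k \<and> offset_seq i = local_offset (of_rat q) n k j"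
  by (intro exI[of _ "to_nat (q, n, k, j)"]) (simp add: slope_seq_def offset_seq_def enum_index_def)

text \<open>A rational q below the recession slope has a finite conjugate, hence belongs to some sublevel set,
on which a bump eventually equals 1.\<close>

lemma recession_le_SUP:
  assumes x: "x \<in> closure \<Omega>"
  shows "e2ennreal (recession (c x) 1) \<le> (SUP i. ennreal (slope_seq i x))"
proof (rule le_ennreal_if_reals_below)
  fix v :: real assume v: "0 \<le> v" "ereal v < recession (c x) 1"
  then obtain w where w: "v < w" "ereal w < recession (c x) 1"
    by (metis ereal_dense2 less_ereal.simps(1))
  obtain q where q: "v < of_rat q" "of_rat q < w" using of_rat_dense[OF w(1)] by blast
  have "ereal (of_rat q) < recession (c x) 1" using q w(2) by (metis less_ereal.simps(1) less_trans)
  hence "conj_fun (c x) (of_rat q) < \<infinity>"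
    by (intro conj_finite_of_less_recession cost_nonneg cost_neg x)
  then obtain r where "conj_fun (c x) (of_rat q) < ereal r" using ereal_dense2 by blast
  moreover obtain n where "r < real n" using reals_Archimedean2 by blast
  ultimately have "conj_fun (c x) (of_rat q) < ereal (real n)" by (metis less_ereal.simps(1) less_trans)
  hence "x \<in> sublevel (of_rat q) n" using sublevel(2)[OF x] by blast
  then obtain k where "bump (sublevel (of_rat q) n) k x = 1"
    using bump_eventually_1[OF sublevel(1)] by blast
  moreover obtain i where "slope_seq i = local_slope (of_rat q) n k" using seq_surj by blast
  ultimately have "v \<le> slope_seq i x" using q by (simp add: local_slope_def)
  thus "ennreal v \<le> (SUP i. ennreal (slope_seq i x))" by (intro SUP_upper2[of i] ennreal_leI) auto
qed

text \<open>A rational slope q with c*(x, q) < q a - v yields a line exceeding v at a. The truncation index j is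
chosen so large that truncating does not spoil this inequality.\<close>

lemma cost_le_SUP:
  assumes x: "x \<in> \<Omega>" and reg: "lsc_fun (c x)" "convex_fun (c x)" and a: "0 \<le> a"
  shows "e2ennreal (c x a) \<le> (SUP i. ennreal (a * slope_seq i x - offset_seq i x))"
proof (rule le_ennreal_if_reals_below)
  have xK: "x \<in> closure \<Omega>" using x closure_subset by blast
  fix v :: real assume v: "0 \<le> v" "ereal v < c x a"
  obtain q where q: "conj_fun (c x) (of_rat q) < ereal (of_rat q * a - v)"
    using rational_slope[OF reg(2,1) cost_nonneg[OF xK] cost_neg[OF xK] v(2) a] by blast
  obtain n where n: "of_rat q * a - v < real n" using reals_Archimedean2 by blast
  have "conj_fun (c x) (of_rat q) < ereal (real n)" using q n by (metis less_ereal.simps(1) less_trans)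
  hence s: "x \<in> sublevel (of_rat q) n" using sublevel(2)[OF xK] by blast
  then obtain k where k: "bump (sublevel (of_rat q) n) k x = 1"
    using bump_eventually_1[OF sublevel(1)] by blast
  obtain j where j: "- (of_rat q * a - v) < real j" using reals_Archimedean2 by blast
  obtain i where i: "slope_seq i = local_slope (of_rat q) n k" "offset_seq i = local_offset (of_rat q) n k j"
    using seq_surj by blast
  define m where "m = truncated_conj (of_rat q) j x"
  have "ereal m = max (- ereal (real j)) (conj_fun (c x) (of_rat q))"
    unfolding m_def by (rule truncated_conj_bounds(1)[OF xK s])
  also have "\<dots> \<le> ereal (of_rat q * a - v)" using q j by simp
  finally have "m \<le> of_rat q * a - v" by simp
  moreover have "offset_seq i x = m" using x k i(2) by (simp add: local_offset_def m_def)
  moreover have "slope_seq i x = of_rat q" using k i(1) by (simp add: local_slope_def)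
  ultimately have "v \<le> a * slope_seq i x - offset_seq i x" by (simp add: mult.commute)
  thus "ennreal v \<le> (SUP i. ennreal (a * slope_seq i x - offset_seq i x))"
    by (intro SUP_upper2[of i] ennreal_leI) auto
qed

end

section \<open>Duality for the cost and compactness of functionals\<close>

context cost_setting
begin

lemma nn_integral_SUP_partial:
  fixes f :: "nat \<Rightarrow> 'b \<Rightarrow> ennreal"
  assumes [measurable]: "\<And>i. f i \<in> borel_measurable Q"
  shows "(\<integral>\<^sup>+x. (SUP i. f i x) \<partial>Q) = (SUP m. \<integral>\<^sup>+x. (SUP i\<in>{..<m}. f i x) \<partial>Q)" (is "?lhs = ?rhs")
    "incseq (\<lambda>m. \<integral>\<^sup>+x. (SUP i\<in>{..<m}. f i x) \<partial>Q)"
proof -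
  have mono: "(SUP i\<in>{..<m}. f i x) \<le> (SUP i\<in>{..<m'}. f i x)" if "m \<le> m'" for m m' x
    using that by (intro SUP_subset_mono) auto
  have eq: "(SUP i. f i x) = (SUP m. SUP i\<in>{..<m}. f i x)" for x
  proof (rule antisym)
    show "(SUP i. f i x) \<le> (SUP m. SUP i\<in>{..<m}. f i x)"
    proof (rule SUP_least)
      fix i
      have "f i x \<le> (SUP j\<in>{..<Suc i}. f j x)" by (rule SUP_upper) simp
      also have "\<dots> \<le> (SUP m. SUP i\<in>{..<m}. f i x)" by (rule SUP_upper) simp
      finally show "f i x \<le> (SUP m. SUP i\<in>{..<m}. f i x)" .
    qed
    show "(SUP m. SUP i\<in>{..<m}. f i x) \<le> (SUP i. f i x)"
      by (intro SUP_least) (auto intro: SUP_upper)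
  qed
  show "?lhs = ?rhs"
    unfolding eq
    by (rule nn_integral_monotone_convergence_SUP) (auto simp: incseq_def le_fun_def mono)
  show "incseq (\<lambda>m. \<integral>\<^sup>+x. (SUP i\<in>{..<m}. f i x) \<partial>Q)"
    by (intro incseq_SucI nn_integral_mono mono) simp
qed

text \<open>By the maximum construction, the finite suprema of the enumerated gains have integrals at most z.
They increase to at least c(x, a(x)) almost everywhere in \<Omega> and to at least the recession slope
on the closure, so monotone convergence concludes.\<close>

lemma cost_le_of_minorants:
  assumes M: "carried M"
    and le: "\<And>\<phi> b. (\<phi>, b) \<in> minorants \<Longrightarrow> (\<integral>x. \<phi> x \<partial>M) - (\<integral>x. b x \<partial>lborel) \<le> z"
  shows "cost_functional \<Omega> c (measure M) \<le> ereal z"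
proof -
  have z: "0 \<le> z" using le[OF zero_minorant] by simp
  obtain a N where split: "lebesgue_split M a N"
    using exists_lebesgue_split[OF carriedD(1,2)[OF M]] by blast
  note D = lebesgue_splitD[OF split]
  have [measurable_cong]: "sets M = sets borel" by (rule carriedD(2)[OF M])
  have [measurable]: "N \<in> sets borel" "a \<in> borel_measurable borel" using D by auto
  have [measurable]: "slope_seq i \<in> borel_measurable borel" "offset_seq i \<in> borel_measurable borel" for i
    using minorantsD(1,2)[OF seq_minorant[of i]]
    by (auto dest: borel_measurable_integrable borel_measurable_continuous_onI)
  let ?S = "density M (indicator N)"
  let ?X = "\<lambda>m. \<integral>\<^sup>+x. (SUP i\<in>{..<m}. ennreal (a x * slope_seq i x - offset_seq i x)) \<partial>lborel"
  let ?Y = "\<lambda>m. \<integral>\<^sup>+x. (SUP i\<in>{..<m}. ennreal (slope_seq i x)) \<partial>?S"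
  have partial: "?X m + ?Y m \<le> ennreal z" for m
  proof -
    obtain \<psi> d where ap: "approximable M \<psi> d" and "\<forall>x. 0 \<le> gain a N \<psi> d x"
      and "\<forall>i<m. \<forall>x. gain a N (slope_seq i) (offset_seq i) x \<le> gain a N \<psi> d x"
      using approximable_max[OF M D(1) D(5), of slope_seq offset_seq m, OF seq_minorant]
      by (elim exE conjE) (rule that)
    hence pos: "\<And>x. 0 \<le> gain a N \<psi> d x"
      and G: "\<And>i x. i < m \<Longrightarrow> gain a N (slope_seq i) (offset_seq i) x \<le> gain a N \<psi> d x"
      by auto
    have i: "integrable M \<psi>" "integrable lborel d" using ap by (auto simp: approximable_def)
    note I = integral_minorant_split[OF M split i]
    have aeX: "AE x in lborel. x \<notin> N" by (rule AE_not_in[OF D(4)])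
    have aeY: "AE x in ?S. x \<in> N" by (subst AE_density) (auto simp: indicator_def)
    have posX: "AE x in lborel. 0 \<le> a x * \<psi> x - d x"
      using aeX
    proof eventually_elim
      case (elim x)
      thus ?case using pos[of x] by (simp add: gain_def)
    qed
    have posY: "AE x in ?S. 0 \<le> \<psi> x"
      using aeY
    proof eventually_elim
      case (elim x)
      thus ?case using pos[of x] by (simp add: gain_def)
    qed
    have "?X m \<le> (\<integral>\<^sup>+x. ennreal (a x * \<psi> x - d x) \<partial>lborel)"
    proof (rule nn_integral_mono_AE, use aeX in eventually_elim)
      case (elim x)
      have "a x * slope_seq i x - offset_seq i x \<le> a x * \<psi> x - d x" if "i < m" for i
        using G[OF that, of x] elim by (simp add: gain_def)
      thus ?case by (intro SUP_least ennreal_leI) auto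
    qed
    also have "\<dots> = ennreal (\<integral>x. a x * \<psi> x - d x \<partial>lborel)"
      by (rule nn_integral_eq_integral[OF I(1) posX])
    finally have X: "?X m \<le> ennreal (\<integral>x. a x * \<psi> x - d x \<partial>lborel)" .
    have "?Y m \<le> (\<integral>\<^sup>+x. ennreal (\<psi> x) \<partial>?S)"
    proof (rule nn_integral_mono_AE, use aeY in eventually_elim)
      case (elim x)
      have "slope_seq i x \<le> \<psi> x" if "i < m" for i
        using G[OF that, of x] elim by (simp add: gain_def)
      thus ?case by (intro SUP_least ennreal_leI) auto
    qed
    also have "\<dots> = ennreal (\<integral>x. \<psi> x \<partial>?S)"
      by (rule nn_integral_eq_integral[OF I(2) posY])
    finally have Y: "?Y m \<le> ennreal (\<integral>x. \<psi> x \<partial>?S)" .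
    have "?X m + ?Y m \<le> ennreal (\<integral>x. a x * \<psi> x - d x \<partial>lborel) + ennreal (\<integral>x. \<psi> x \<partial>?S)"
      by (rule add_mono[OF X Y])
    also have "\<dots> = ennreal ((\<integral>x. \<psi> x \<partial>M) - (\<integral>x. d x \<partial>lborel))"
      unfolding I(3) by (intro ennreal_plus[symmetric] integral_nonneg_AE posX posY)
    also have "\<dots> \<le> ennreal z" by (intro ennreal_leI approximable_value_le[OF M ap le])
    finally show ?thesis .
  qed
  have "(\<integral>\<^sup>+x. e2ennreal (c x (a x)) * indicator \<Omega> x \<partial>lborel) \<le>
      (\<integral>\<^sup>+x. (SUP i. ennreal (a x * slope_seq i x - offset_seq i x)) \<partial>lborel)"
  proof (rule nn_integral_mono_AE, use AE_convex_lsc in eventually_elim)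
    case (elim x)
    show ?case
    proof (cases "x \<in> \<Omega>")
      case True
      hence "x \<in> closure \<Omega>" using closure_subset by blast
      thus ?thesis using True elim cost_le_SUP[OF True _ _ D(2)] by simp
    qed simp
  qed
  also have "\<dots> = (SUP m. ?X m)" by (rule nn_integral_SUP_partial) measurable
  finally have 1: "(\<integral>\<^sup>+x. e2ennreal (c x (a x)) * indicator \<Omega> x \<partial>lborel) \<le> (SUP m. ?X m)" .
  have "(\<integral>\<^sup>+x. e2ennreal (recession (c x) 1) \<partial>?S) \<le> (\<integral>\<^sup>+x. (SUP i. ennreal (slope_seq i x)) \<partial>?S)"
  proof (rule nn_integral_mono_AE)
    have "AE x in M. e2ennreal (recession (c x) 1) \<le> (SUP i. ennreal (slope_seq i x))"
      using carriedD(3)[OF M] by eventually_elim (rule recession_le_SUP)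
    thus "AE x in ?S. e2ennreal (recession (c x) 1) \<le> (SUP i. ennreal (slope_seq i x))"
      by (subst AE_density) auto
  qed
  also have "\<dots> = (SUP m. ?Y m)" by (rule nn_integral_SUP_partial) measurable
  finally have 2: "(\<integral>\<^sup>+x. e2ennreal (recession (c x) 1) \<partial>?S) \<le> (SUP m. ?Y m)" .
  have "(SUP m. ?X m) + (SUP m. ?Y m) = (SUP m. ?X m + ?Y m)"
    by (rule ennreal_SUP_add[symmetric]; rule nn_integral_SUP_partial(2); measurable)
  also have "\<dots> \<le> ennreal z" by (rule SUP_least) (rule partial)
  finally have "(\<integral>\<^sup>+x. e2ennreal (c x (a x)) * indicator \<Omega> x \<partial>lborel) +
      (\<integral>\<^sup>+x. e2ennreal (recession (c x) 1) \<partial>?S) \<le> ennreal z"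
    using add_mono[OF 1 2] by (rule order_trans[rotated])
  hence "cost_functional \<Omega> c (measure M) \<le> enn2ereal (ennreal z)"
    by (simp add: cost_functional_measure[OF carriedD(1,2)[OF M] split open_\<Omega>] less_eq_ennreal.rep_eq)
  thus ?thesis using z by simp
qed

end

text \<open>Values at discontinuous functions are fixed to 0, so that compactness can be taken in the full
product space of real-valued maps on functions.\<close>

definition bounded_functionals :: "'a::euclidean_space set \<Rightarrow> real \<Rightarrow> (('a \<Rightarrow> real) \<Rightarrow> real) set" where
  "bounded_functionals K k = {L. positive_functional K L \<and> L (\<lambda>x. 1) \<le> k \<and>
     (\<forall>\<phi>. \<not> continuous_on UNIV \<phi> \<longrightarrow> L \<phi> = 0)}"

text \<open>A closed subset of a product of compact intervals: |L \<phi>| is at most k times the maximum of |\<phi>| on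
K, and each defining condition is a closed condition on finitely many coordinates.\<close>

lemma compact_bounded_functionals:
  assumes K: "compact K"
  shows "compact (bounded_functionals K k)"
proof -
  have "\<exists>B. 0 \<le> B \<and> (\<forall>x\<in>K. \<bar>\<phi> x\<bar> \<le> B)" if c: "continuous_on UNIV \<phi>" for \<phi> :: "'a \<Rightarrow> real"
    by (rule continuous_bounded_on_compact[OF K c]) blast
  then obtain B where B: "\<And>\<phi> :: 'a \<Rightarrow> real. continuous_on UNIV \<phi> \<Longrightarrow> 0 \<le> B \<phi>"
    "\<And>\<phi> x. continuous_on UNIV \<phi> \<Longrightarrow> x \<in> K \<Longrightarrow> \<bar>\<phi> x\<bar> \<le> B \<phi>" by metis
  let ?C = "{\<phi>. continuous_on UNIV (\<phi> :: 'a \<Rightarrow> real)}"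
  define box where "box = Pi\<^sub>E UNIV (\<lambda>\<phi>. if \<phi> \<in> ?C then {- (B \<phi> * k)..B \<phi> * k} else {0::real})"
  have "compactin (product_topology (\<lambda>\<phi>. euclidean) UNIV) box"
    unfolding box_def compactin_PiE by (auto simp: compact_Icc)
  hence box: "compact box" by (simp add: euclidean_product_topology)
  have "bounded_functionals K k \<subseteq> box"
  proof
    fix L assume "L \<in> bounded_functionals K k"
    hence L: "positive_functional K L" "L (\<lambda>x. 1) \<le> k" "\<And>\<phi>. \<not> continuous_on UNIV \<phi> \<Longrightarrow> L \<phi> = 0"
      by (auto simp: bounded_functionals_def)
    interpret positive_functional K L by fact
    have "\<bar>L \<phi>\<bar> \<le> B \<phi> * k" if c: "continuous_on UNIV \<phi>" for \<phi>
    proof -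
      have "L \<phi> \<le> L (\<lambda>x. B \<phi>)" "L (\<lambda>x. - B \<phi>) \<le> L \<phi>"
        by (rule mono; use B(2)[OF c] c in \<open>auto simp: abs_le_iff minus_le_iff\<close>)+
      moreover have "B \<phi> * L (\<lambda>x. 1) \<le> B \<phi> * k" using B(1)[OF c] L(2) by (rule mult_left_mono[rotated])
      ultimately show ?thesis using const[of "B \<phi>"] const[of "- B \<phi>"] by simp
    qed
    thus "L \<in> box" using L(3) by (auto simp: box_def abs_le_iff minus_le_iff)
  qed
  moreover have "closed (bounded_functionals K k)"
  proof -
    have ev: "continuous_on UNIV (\<lambda>L :: ('a \<Rightarrow> real) \<Rightarrow> real. L \<phi>)" for \<phi> by simp
    have "bounded_functionals K k =
        (\<Inter>\<phi>\<in>?C. \<Inter>\<psi>\<in>?C. {L. L (\<lambda>x. \<phi> x + \<psi> x) = L \<phi> + L \<psi>}) \<inter>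
        (\<Inter>\<phi>\<in>?C. \<Inter>r. {L. L (\<lambda>x. r * \<phi> x) = r * L \<phi>}) \<inter>
        (\<Inter>\<phi>\<in>{\<phi>\<in>?C. \<forall>x\<in>K. 0 \<le> \<phi> x}. {L. 0 \<le> L \<phi>}) \<inter>
        {L. L (\<lambda>x. 1) \<le> k} \<inter> (\<Inter>\<phi>\<in>-?C. {L. L \<phi> = 0})"
      using K by (auto simp: bounded_functionals_def positive_functional_def)
    also have "closed \<dots>"
      by (intro closed_Int closed_INT ballI closed_Collect_eq closed_Collect_le continuous_intros ev)
    finally show ?thesis .
  qed
  ultimately show ?thesis using box by (metis compact_Int_closed inf.absorb_iff2)
qed

lemma mix_bounded_functionals:
  assumes L1: "L1 \<in> bounded_functionals K k" and L2: "L2 \<in> bounded_functionals K k"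
    and l: "0 \<le> l" "l \<le> (1::real)"
  shows "(\<lambda>\<phi>. (1 - l) * L1 \<phi> + l * L2 \<phi>) \<in> bounded_functionals K k"
proof -
  interpret L1: positive_functional K L1 using L1 by (simp add: bounded_functionals_def)
  interpret L2: positive_functional K L2 using L2 by (simp add: bounded_functionals_def)
  have "positive_functional K (\<lambda>\<phi>. (1 - l) * L1 \<phi> + l * L2 \<phi>)"
  proof
    fix \<phi> :: "'a \<Rightarrow> real" assume "continuous_on UNIV \<phi>" "\<And>x. x \<in> K \<Longrightarrow> 0 \<le> \<phi> x"
    thus "0 \<le> (1 - l) * L1 \<phi> + l * L2 \<phi>" using L1.nonneg L2.nonneg l by simp
  qed (simp_all add: L1.compact_K L1.add L2.add L1.scale L2.scale algebra_simps)
  moreover have "(1 - l) * L1 (\<lambda>x. 1) + l * L2 (\<lambda>x. 1) \<le> (1 - l) * k + l * k"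
    using L1 L2 l by (intro add_mono mult_left_mono) (auto simp: bounded_functionals_def)
  ultimately show ?thesis using L1 L2 by (auto simp: bounded_functionals_def algebra_simps)
qed

context cost_setting
begin

definition functional_of :: "'a measure \<Rightarrow> ('a \<Rightarrow> real) \<Rightarrow> real" where
  "functional_of M \<phi> = (if continuous_on UNIV \<phi> then (\<integral>x. \<phi> x \<partial>M) else 0)"

lemma functional_of_bounded:
  assumes M: "carried M" and k: "measure M (closure \<Omega>) \<le> k"
  shows "functional_of M \<in> bounded_functionals (closure \<Omega>) k"
proof -
  note i = carried_integrable[OF M]
  interpret finite_measure M by (rule carriedD(1)[OF M])
  have "positive_functional (closure \<Omega>) (functional_of M)"
  proof
    fix \<phi> :: "'a \<Rightarrow> real" assume c: "continuous_on UNIV \<phi>" and p: "\<And>x. x \<in> closure \<Omega> \<Longrightarrow> 0 \<le> \<phi> x"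
    have "AE x in M. 0 \<le> \<phi> x" using carriedD(3)[OF M] by eventually_elim (rule p)
    thus "0 \<le> functional_of M \<phi>" using c by (simp add: functional_of_def integral_nonneg_AE)
  qed (simp_all add: bounded_\<Omega> functional_of_def continuous_intros i)
  moreover have "measure M (space M) = measure M (closure \<Omega>)"
  proof -
    have sp: "space M = UNIV" using sets_eq_imp_space_eq[OF carriedD(2)[OF M]] by simp
    hence "AE x in M. x \<in> space M \<longleftrightarrow> x \<in> closure \<Omega>" using carriedD(3)[OF M] by auto
    thus ?thesis unfolding sp by (intro measure_eq_AE) (auto simp: carriedD(2)[OF M] borel_closed)
  qed
  ultimately show ?thesis using k by (simp add: bounded_functionals_def functional_of_def)
qed

text \<open>The Riesz representation theorem in the form needed to return from functionals to measures.\<close>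

lemma bounded_functional_measure:
  assumes L: "L \<in> bounded_functionals (closure \<Omega>) k"
  obtains M where "carried M" "measure M (closure \<Omega>) \<le> k" "L = functional_of M"
proof -
  interpret positive_functional "closure \<Omega>" L using L by (simp add: bounded_functionals_def)
  interpret R: finite_measure riesz_measure by (rule finite_measure_riesz)
  have "carried riesz_measure"
    using finite_measure_riesz riesz_outside by (simp add: carried_def)
  moreover have "measure riesz_measure (closure \<Omega>) \<le> k"
  proof -
    have "measure riesz_measure (closure \<Omega>) \<le> measure riesz_measure UNIV"
      using R.bounded_measure[of "closure \<Omega>"] by simp
    thus ?thesis using L measure_riesz_UNIV by (simp add: bounded_functionals_def)
  qed
  moreover have "L = functional_of riesz_measure"
    using L by (auto simp: functional_of_def riesz_representation bounded_functionals_def)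
  ultimately show thesis by (rule that)
qed

end

section \<open>Test functions and gradients\<close>

lemma iter_partial_combination:
  assumes u: "smooth u" and v: "smooth v" and bs: "bs \<in> lists Basis"
  shows "iter_partial bs (\<lambda>x. p * u x + q * v x) = (\<lambda>x. p * iter_partial bs u x + q * iter_partial bs v x)"
  using bs
proof (induction bs)
  case Nil
  show ?case by (simp add: iter_partial_def)
next
  case (Cons b bs)
  show ?case
  proof
    fix x
    have "iter_partial bs u differentiable (at x)" "iter_partial bs v differentiable (at x)"
      using u v Cons.hyps by (auto simp: smooth_def)
    hence d: "(iter_partial bs u has_derivative frechet_derivative (iter_partial bs u) (at x)) (at x)"
      "(iter_partial bs v has_derivative frechet_derivative (iter_partial bs v) (at x)) (at x)"
      by (simp_all add: frechet_derivative_works)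
    have "((\<lambda>x. p * iter_partial bs u x + q * iter_partial bs v x) has_derivative
        (\<lambda>h. p * frechet_derivative (iter_partial bs u) (at x) h + q * frechet_derivative (iter_partial bs v) (at x) h)) (at x)"
      by (intro has_derivative_add has_derivative_mult_right d)
    from frechet_derivative_at[OF this, symmetric]
    show "iter_partial (b # bs) (\<lambda>x. p * u x + q * v x) x =
        p * iter_partial (b # bs) u x + q * iter_partial (b # bs) v x"
      using Cons.IH by (simp add: iter_partial_def partial_deriv_def)
  qed
qed

lemma smooth_combination:
  assumes u: "smooth u" and v: "smooth v"
  shows "smooth (\<lambda>x. p * u x + q * v x)"
  unfolding smooth_def
proof (intro ballI allI)
  fix bs :: "'a list" and x assume bs: "bs \<in> lists Basis"
  have "iter_partial bs u differentiable (at x)" "iter_partial bs v differentiable (at x)"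
    using u v bs by (auto simp: smooth_def)
  thus "iter_partial bs (\<lambda>x. p * u x + q * v x) differentiable (at x)"
    unfolding iter_partial_combination[OF assms bs] by simp
qed

lemma partial_deriv_combination:
  assumes "smooth u" "smooth v" "b \<in> Basis"
  shows "partial_deriv b (\<lambda>x. p * u x + q * v x) x = p * partial_deriv b u x + q * partial_deriv b v x"
  using iter_partial_combination[OF assms(1,2), of "[b]" p q] assms(3)
  by (simp add: iter_partial_def fun_eq_iff)

lemma grad_combination:
  assumes "smooth u" "smooth v"
  shows "grad (\<lambda>x. p * u x + q * v x) x = p *\<^sub>R grad u x + q *\<^sub>R grad v x"
proof -
  have "grad (\<lambda>x. p * u x + q * v x) x =
      (\<Sum>b\<in>Basis. p *\<^sub>R (partial_deriv b u x *\<^sub>R b) + q *\<^sub>R (partial_deriv b v x *\<^sub>R b))"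
    unfolding grad_def
    by (intro sum.cong refl) (simp add: partial_deriv_combination[OF assms] scaleR_add_left)
  also have "\<dots> = p *\<^sub>R grad u x + q *\<^sub>R grad v x"
    by (simp add: grad_def sum.distrib scaleR_sum_right)
  finally show ?thesis .
qed

lemma continuous_grad:
  assumes "smooth u"
  shows "continuous_on UNIV (grad u)"
proof -
  have "continuous_on UNIV (partial_deriv b u)" if "b \<in> Basis" for b
  proof -
    have "iter_partial [b] u differentiable (at x)" for x
      using assms that by (auto simp: smooth_def)
    hence "partial_deriv b u differentiable_on UNIV"
      by (simp add: differentiable_on_def iter_partial_def)
    thus ?thesis by (rule differentiable_imp_continuous_on)
  qed
  thus ?thesis unfolding grad_def[abs_def] by (intro continuous_intros)
qed

text \<open>The difference of the two sides is l (1 - l) |x - y|^2.\<close>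

lemma norm_convex_combination_sq:
  fixes x y :: "'a::real_inner"
  assumes "0 \<le> l" "l \<le> 1"
  shows "(norm ((1 - l) *\<^sub>R x + l *\<^sub>R y))\<^sup>2 \<le> (1 - l) * (norm x)\<^sup>2 + l * (norm y)\<^sup>2"
proof -
  have "(1 - l) * (norm x)\<^sup>2 + l * (norm y)\<^sup>2 - (norm ((1 - l) *\<^sub>R x + l *\<^sub>R y))\<^sup>2 =
      l * (1 - l) * (norm (x - y))\<^sup>2"
    by (simp add: power2_norm_eq_inner inner_add_left inner_add_right inner_diff_left inner_diff_right
        inner_commute algebra_simps)
  moreover have "0 \<le> l * (1 - l) * (norm (x - y))\<^sup>2" using assms by simp
  ultimately show ?thesis by linarith
qed

lemma test_functions_combination:
  assumes u: "u \<in> test_functions \<Omega>" and v: "v \<in> test_functions \<Omega>"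
  shows "(\<lambda>x. p * u x + q * v x) \<in> test_functions \<Omega>"
proof -
  have "{x. p * u x + q * v x \<noteq> 0} \<subseteq> {x. u x \<noteq> 0} \<union> {x. v x \<noteq> 0}" by auto
  hence s: "supp (\<lambda>x. p * u x + q * v x) \<subseteq> supp u \<union> supp v"
    unfolding supp_def closure_Un[symmetric] by (rule closure_mono)
  have c: "compact (supp u \<union> supp v)" using u v by (auto simp: test_functions_def)
  have "compact (supp (\<lambda>x. p * u x + q * v x))"
    using s compact_Int_closed[OF c, of "supp (\<lambda>x. p * u x + q * v x)"]
    by (simp add: supp_def inf.absorb2)
  thus ?thesis using u v s by (auto simp: test_functions_def smooth_combination)
qed

lemma test_functions_mono: "test_functions \<Omega> \<subseteq> test_functions UNIV"
  by (auto simp: test_functions_def)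

lemma partial_deriv_zero: "partial_deriv b (\<lambda>x. 0) = (\<lambda>x. 0)"
  by (simp add: partial_deriv_def[abs_def] frechet_derivative_const)

lemma zero_test_function: "(\<lambda>x. 0) \<in> test_functions \<Omega>"
proof -
  have "iter_partial bs (\<lambda>x. 0) = (\<lambda>x. 0)" for bs :: "'a list"
    by (induction bs) (simp_all add: iter_partial_def partial_deriv_zero)
  thus ?thesis by (simp add: test_functions_def smooth_def supp_def)
qed

lemma grad_zero: "grad (\<lambda>x. 0) x = 0"
  by (simp add: grad_def partial_deriv_zero)

lemma distribution_combination:
  assumes f: "distribution f" and u: "u \<in> test_functions UNIV" and v: "v \<in> test_functions UNIV"
  shows "f (\<lambda>x. p * u x + q * v x) = p * f u + q * f v"
proof -
  have "(\<lambda>x. r * w x) \<in> test_functions UNIV" if "w \<in> test_functions UNIV" for r and w :: "'a \<Rightarrow> real"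
    using test_functions_combination[OF that that, of r 0] by simp
  thus ?thesis using f u v by (simp add: distribution_def)
qed

lemma distribution_zero:
  assumes "distribution f"
  shows "f (\<lambda>x. 0) = 0"
  using distribution_combination[OF assms zero_test_function zero_test_function, of 0 0] by simp

section \<open>Existence and exchange\<close>

context cost_setting
begin

lemma pos_measures_iff_carried:
  "\<mu> \<in> pos_measures_in (closure \<Omega>) \<longleftrightarrow> (\<exists>M. \<mu> = measure M \<and> carried M)"
  by (simp add: pos_measures_in_iff carried_def)

lemma cost_functional_nonneg: "0 \<le> cost_functional \<Omega> c \<mu>"
  by (simp add: cost_functional_def)

definition grad_sq :: "('a \<Rightarrow> real) \<Rightarrow> 'a \<Rightarrow> real" where
  "grad_sq u x = (norm (grad u x))\<^sup>2"

lemma continuous_grad_sq: "u \<in> test_functions \<Omega> \<Longrightarrow> continuous_on UNIV (grad_sq u)"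
  unfolding grad_sq_def[abs_def]
  by (intro continuous_intros continuous_grad) (simp add: test_functions_def)

lemma energy_F_measure:
  assumes M: "carried M" and u: "u \<in> test_functions \<Omega>"
  shows "energy_F f (measure M) u = 1 / 2 * functional_of M (grad_sq u) - f u"
  using continuous_grad_sq[OF u]
  by (simp add: energy_F_def signed_integral_measure[OF carriedD(1,2)[OF M]] functional_of_def grad_sq_def[abs_def])

text \<open>The energy minus the contribution of one minorant. Its infimum over the minorants is the energy
minus the cost.\<close>

definition payoff :: "(('a \<Rightarrow> real) \<Rightarrow> real) \<Rightarrow> (('a \<Rightarrow> real) \<Rightarrow> real) \<Rightarrow>
    ('a \<Rightarrow> real) \<times> ('a \<Rightarrow> real) \<times> ('a \<Rightarrow> real) \<Rightarrow> real" where
  "payoff f L = (\<lambda>(u, \<phi>, b). 1 / 2 * L (grad_sq u) - f u - (L \<phi> - (\<integral>x. b x \<partial>lborel)))"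

abbreviation functionals :: "real \<Rightarrow> (('a \<Rightarrow> real) \<Rightarrow> real) set" where
  "functionals \<equiv> bounded_functionals (closure \<Omega>)"

definition strategies :: "(('a \<Rightarrow> real) \<times> ('a \<Rightarrow> real) \<times> ('a \<Rightarrow> real)) set" where
  "strategies = test_functions \<Omega> \<times> minorants"

lemma functional_of_minorant:
  "(\<phi>, b) \<in> minorants \<Longrightarrow> functional_of M \<phi> = (\<integral>x. \<phi> x \<partial>M)"
  by (simp add: functional_of_def minorantsD(1))

lemma energy_minus_cost_le_payoff:
  assumes M: "carried M" and u: "u \<in> test_functions \<Omega>" and m: "(\<phi>, b) \<in> minorants"
  shows "ereal (energy_F f (measure M) u) - cost_functional \<Omega> c (measure M)
    \<le> ereal (payoff f (functional_of M) (u, \<phi>, b))"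
proof -
  have "ereal (energy_F f (measure M) u) - cost_functional \<Omega> c (measure M) \<le>
      ereal (energy_F f (measure M) u) - ereal ((\<integral>x. \<phi> x \<partial>M) - (\<integral>x. b x \<partial>lborel))"
    by (intro ereal_minus_mono minorant_le_cost[OF M m]) simp
  thus ?thesis by (simp add: payoff_def energy_F_measure[OF M u] functional_of_minorant[OF m])
qed

lemma total_J_carried:
  assumes M: "carried M"
  shows "total_J \<Omega> c f (measure M) =
    - (INF u\<in>test_functions \<Omega>. ereal (energy_F f (measure M) u)) + cost_functional \<Omega> c (measure M)"
  using M pos_measures_iff_carried by (auto simp: total_J_def energy_E_def)

text \<open>J is a supremum over u plus a supremum over minorants. Finiteness of the cost, which follows from
u = 0, allows the second supremum to be subtracted when the two are separated.\<close>

lemma total_J_le_iff: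
  assumes M: "carried M"
  shows "total_J \<Omega> c f (measure M) \<le> ereal z \<longleftrightarrow>
    (\<forall>y\<in>strategies. - z \<le> payoff f (functional_of M) y)"
proof
  let ?E = "INF u\<in>test_functions \<Omega>. ereal (energy_F f (measure M) u)"
  let ?C = "cost_functional \<Omega> c (measure M)"
  {
    assume J: "total_J \<Omega> c f (measure M) \<le> ereal z"
    show "\<forall>y\<in>strategies. - z \<le> payoff f (functional_of M) y"
    proof
      fix y assume "y \<in> strategies"
      then obtain u \<phi> b where y: "y = (u, \<phi>, b)" and u: "u \<in> test_functions \<Omega>" and m: "(\<phi>, b) \<in> minorants"
        by (auto simp: strategies_def)
      have "- ereal (energy_F f (measure M) u) \<le> - ?E"
        unfolding ereal_minus_le_minus by (rule INF_lower[OF u])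
      hence "- ereal (energy_F f (measure M) u) + ereal ((\<integral>x. \<phi> x \<partial>M) - (\<integral>x. b x \<partial>lborel)) \<le> - ?E + ?C"
        by (intro add_mono minorant_le_cost[OF M m])
      also have "\<dots> \<le> ereal z" using J by (simp add: total_J_carried[OF M])
      finally show "- z \<le> payoff f (functional_of M) y"
        by (simp add: y payoff_def energy_F_measure[OF M u] functional_of_minorant[OF m])
    qed
  }
  {
    assume H: "\<forall>y\<in>strategies. - z \<le> payoff f (functional_of M) y"
    have C: "?C \<le> ereal (z + energy_F f (measure M) u)" if u: "u \<in> test_functions \<Omega>" for u
    proof (rule cost_le_of_minorants[OF M])
      fix \<phi> b assume m: "(\<phi>, b) \<in> minorants"
      hence "- z \<le> payoff f (functional_of M) (u, \<phi>, b)" using H u by (simp add: strategies_def)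
      thus "(\<integral>x. \<phi> x \<partial>M) - (\<integral>x. b x \<partial>lborel) \<le> z + energy_F f (measure M) u"
        by (simp add: payoff_def energy_F_measure[OF M u] functional_of_minorant[OF m])
    qed
    obtain \<gamma> where \<gamma>: "?C = ereal \<gamma>"
      using C[OF zero_test_function] cost_functional_nonneg[of "measure M"] by (cases ?C) auto
    have "ereal (\<gamma> - z) \<le> ?E"
    proof (rule INF_greatest)
      fix u assume u: "u \<in> test_functions \<Omega>"
      show "ereal (\<gamma> - z) \<le> ereal (energy_F f (measure M) u)" using C[OF u] \<gamma> by simp
    qed
    hence "- ?E \<le> ereal (z - \<gamma>)" by (metis ereal_minus_le_minus ereal_uminus_uminus minus_diff_eq uminus_ereal.simps(1))
    hence "- ?E + ?C \<le> ereal (z - \<gamma>) + ereal \<gamma>" unfolding \<gamma> by (rule add_right_mono)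
    thus "total_J \<Omega> c f (measure M) \<le> ereal z" by (simp add: total_J_carried[OF M])
  }
qed

lemma zero_strategy: "(\<lambda>x. 0, \<lambda>x. 0, \<lambda>x. 0) \<in> strategies"
  using zero_minorant zero_test_function by (simp add: strategies_def)

text \<open>Evaluate the payoff at u = 0 and the coercive minorant.\<close>

lemma total_J_mass_bound:
  assumes f: "distribution f"
  shows "\<exists>k. \<forall>M. carried M \<longrightarrow> total_J \<Omega> c f (measure M) \<le> ereal z \<longrightarrow> measure M (closure \<Omega>) \<le> k"
proof -
  obtain \<alpha> b where \<alpha>: "0 < \<alpha>" "(\<lambda>x. \<alpha>, b) \<in> minorants" by (rule mass_minorant)
  have "measure M (closure \<Omega>) \<le> (z + (\<integral>x. b x \<partial>lborel)) / \<alpha>"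
    if M: "carried M" and J: "total_J \<Omega> c f (measure M) \<le> ereal z" for M
  proof -
    interpret finite_measure M by (rule carriedD(1)[OF M])
    have "(\<lambda>x. 0, \<lambda>x. \<alpha>, b) \<in> strategies" using \<alpha> zero_test_function by (simp add: strategies_def)
    hence "- z \<le> payoff f (functional_of M) (\<lambda>x. 0, \<lambda>x. \<alpha>, b)" using J total_J_le_iff[OF M] by blast
    hence "measure M (space M) * \<alpha> \<le> z + (\<integral>x. b x \<partial>lborel)"
      by (simp add: payoff_def grad_sq_def[abs_def] grad_zero functional_of_def distribution_zero[OF f])
    moreover have "measure M (closure \<Omega>) \<le> measure M (space M)" by (rule bounded_measure)
    ultimately have "measure M (closure \<Omega>) * \<alpha> \<le> z + (\<integral>x. b x \<partial>lborel)"
      using \<alpha>(1) by (meson less_imp_le mult_right_mono order_trans)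
    thus ?thesis using \<alpha>(1) by (simp add: pos_le_divide_eq)
  qed
  thus ?thesis by blast
qed

lemma continuous_payoff: "continuous_on UNIV (\<lambda>L. payoff f L y)"
proof -
  have "continuous_on UNIV (\<lambda>L :: ('a \<Rightarrow> real) \<Rightarrow> real. L \<phi>)" for \<phi> by simp
  thus ?thesis unfolding payoff_def by (cases y) (auto intro!: continuous_intros)
qed

lemma payoff_mix:
  "payoff f (\<lambda>\<phi>. (1 - l) * L1 \<phi> + l * L2 \<phi>) y = (1 - l) * payoff f L1 y + l * payoff f L2 y"
  by (cases y) (simp add: payoff_def field_simps)

text \<open>Mix u, \<phi> and b separately: the squared gradient is convex and L is monotone, while all other terms
are affine.\<close>

lemma payoff_convex:
  assumes f: "distribution f" and y: "y1 \<in> strategies" "y2 \<in> strategies" and l: "0 \<le> l" "l \<le> 1"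
  shows "\<exists>y\<in>strategies. \<forall>L\<in>functionals k.
    payoff f L y \<le> (1 - l) * payoff f L y1 + l * payoff f L y2"
proof -
  obtain u1 \<phi>1 b1 u2 \<phi>2 b2 where y12: "y1 = (u1, \<phi>1, b1)" "y2 = (u2, \<phi>2, b2)"
    and u: "u1 \<in> test_functions \<Omega>" "u2 \<in> test_functions \<Omega>"
    and m: "(\<phi>1, b1) \<in> minorants" "(\<phi>2, b2) \<in> minorants"
    using y by (auto simp: strategies_def)
  define u where "u = (\<lambda>x. (1 - l) * u1 x + l * u2 x)"
  define \<phi> where "\<phi> = (\<lambda>x. (1 - l) * \<phi>1 x + l * \<phi>2 x)"
  define b where "b = (\<lambda>x. (1 - l) * b1 x + l * b2 x)"
  have uT: "u \<in> test_functions \<Omega>" unfolding u_def by (rule test_functions_combination[OF u])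
  have "(\<phi>, b) \<in> minorants"
    unfolding \<phi>_def b_def by (rule blend_minorants[OF m, of "\<lambda>x. l"]) (use l in auto)
  hence "(u, \<phi>, b) \<in> strategies" using uT by (simp add: strategies_def)
  moreover have "payoff f L (u, \<phi>, b) \<le> (1 - l) * payoff f L y1 + l * payoff f L y2"
    if L: "L \<in> functionals k" for L
  proof -
    interpret positive_functional "closure \<Omega>" L using L by (simp add: bounded_functionals_def)
    have comb: "L (\<lambda>x. (1 - l) * \<psi>1 x + l * \<psi>2 x) = (1 - l) * L \<psi>1 + l * L \<psi>2"
      if "continuous_on UNIV \<psi>1" "continuous_on UNIV \<psi>2" for \<psi>1 \<psi>2
      using add[of "\<lambda>x. (1 - l) * \<psi>1 x" "\<lambda>x. l * \<psi>2 x"] scale[OF that(1), of "1 - l"] scale[OF that(2), of l] that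
      by (simp add: continuous_intros)
    have cg: "continuous_on UNIV (grad_sq u1)" "continuous_on UNIV (grad_sq u2)"
      by (intro continuous_grad_sq u)+
    have "L (grad_sq u) \<le> L (\<lambda>x. (1 - l) * grad_sq u1 x + l * grad_sq u2 x)"
    proof (rule mono[OF continuous_grad_sq[OF uT]])
      show "continuous_on UNIV (\<lambda>x. (1 - l) * grad_sq u1 x + l * grad_sq u2 x)"
        by (intro continuous_intros cg)
      fix x
      show "grad_sq u x \<le> (1 - l) * grad_sq u1 x + l * grad_sq u2 x"
        unfolding u_def grad_sq_def using u
        by (subst grad_combination) (auto simp: test_functions_def intro: norm_convex_combination_sq[OF l])
    qed
    also have "\<dots> = (1 - l) * L (grad_sq u1) + l * L (grad_sq u2)" by (rule comb[OF cg])
    finally have 1: "L (grad_sq u) \<le> (1 - l) * L (grad_sq u1) + l * L (grad_sq u2)" .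
    have 2: "L \<phi> = (1 - l) * L \<phi>1 + l * L \<phi>2"
      unfolding \<phi>_def by (rule comb[OF minorantsD(1)[OF m(1)] minorantsD(1)[OF m(2)]])
    have 3: "(\<integral>x. b x \<partial>lborel) = (1 - l) * (\<integral>x. b1 x \<partial>lborel) + l * (\<integral>x. b2 x \<partial>lborel)"
      unfolding b_def using minorantsD(2)[OF m(1)] minorantsD(2)[OF m(2)] by simp
    have 4: "f u = (1 - l) * f u1 + l * f u2"
      unfolding u_def using u test_functions_mono by (intro distribution_combination[OF f]) auto
    show ?thesis using 1 by (simp add: payoff_def y12 2 3 4 algebra_simps diff_divide_distrib)
  qed
  ultimately show ?thesis by blast
qed

lemma strategies_minimax:
  assumes f: "distribution f"
  shows "(\<exists>L\<in>functionals k. \<forall>y\<in>strategies. v \<le> payoff f L y) \<or>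
    (\<exists>y\<in>strategies. \<forall>L\<in>functionals k. payoff f L y \<le> v)"
proof (rule compact_minimax)
  show "compact (functionals k)"
    by (rule compact_bounded_functionals[OF compact_closure_\<Omega>])
  show "strategies \<noteq> {}" using zero_strategy by blast
  show "continuous_on UNIV (\<lambda>L. payoff f L y)" for y by (rule continuous_payoff)
  fix L1 L2 and l :: real
  assume "L1 \<in> functionals k" "L2 \<in> functionals k" "0 \<le> l" "l \<le> 1"
  from mix_bounded_functionals[OF this]
  show "\<exists>L\<in>functionals k. \<forall>y\<in>strategies.
      (1 - l) * payoff f L1 y + l * payoff f L2 y \<le> payoff f L y"
    by (intro bexI[of _ "\<lambda>\<phi>. (1 - l) * L1 \<phi> + l * L2 \<phi>"]) (simp_all add: payoff_mix)
next
  fix y1 y2 and l :: real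
  assume "y1 \<in> strategies" "y2 \<in> strategies" "0 \<le> l" "l \<le> 1"
  thus "\<exists>y\<in>strategies. \<forall>L\<in>functionals k.
      payoff f L y \<le> (1 - l) * payoff f L y1 + l * payoff f L y2"
    by (rule payoff_convex[OF f])
qed

abbreviation inf_J :: "(('a \<Rightarrow> real) \<Rightarrow> real) \<Rightarrow> ereal" where
  "inf_J f \<equiv> INF \<nu>\<in>pos_measures_in (closure \<Omega>). total_J \<Omega> c f \<nu>"

text \<open>A measure of finite J cannot take negative values, as the energy would be -\<infinity>. Testing with u = 0
shows J \<ge> 0.\<close>

lemma Adm_infimum:
  assumes f: "f \<in> Adm \<Omega> c"
  shows "distribution f"
    "\<exists>m. inf_J f = ereal m"
proof -
  show d: "distribution f" using f by (simp add: Adm_def distributions_in_def)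
  obtain \<mu> where \<mu>: "\<mu> \<in> measures_in (closure \<Omega>)" "total_J \<Omega> c f \<mu> < \<infinity>"
    using f by (auto simp: Adm_def)
  have "\<mu> \<in> pos_measures_in (closure \<Omega>)"
  proof (rule ccontr)
    assume "\<mu> \<notin> pos_measures_in (closure \<Omega>)"
    hence "total_J \<Omega> c f \<mu> = \<infinity>"
      using cost_functional_nonneg[of \<mu>] by (simp add: total_J_def energy_E_def)
    thus False using \<mu>(2) by simp
  qed
  hence "inf_J f < \<infinity>"
    using \<mu>(2) by (metis INF_lower le_less_trans)
  moreover have "0 \<le> inf_J f"
  proof (rule INF_greatest)
    fix \<nu> assume "\<nu> \<in> pos_measures_in (closure \<Omega>)"
    then obtain M where M: "\<nu> = measure M" "carried M" using pos_measures_iff_carried by blast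
    have "(INF u\<in>test_functions \<Omega>. ereal (energy_F f (measure M) u)) \<le> ereal (energy_F f (measure M) (\<lambda>x. 0))"
      by (rule INF_lower[OF zero_test_function])
    also have "energy_F f (measure M) (\<lambda>x. 0) = 0"
      unfolding energy_F_measure[OF M(2) zero_test_function]
      by (simp add: grad_sq_def[abs_def] grad_zero functional_of_def distribution_zero[OF d])
    finally show "0 \<le> total_J \<Omega> c f \<nu>"
      using cost_functional_nonneg[of "measure M"]
      by (simp add: M(1) total_J_carried[OF M(2)] ereal_uminus_le_reorder add_nonneg_nonneg zero_ereal_def[symmetric])
  qed
  ultimately show "\<exists>m. inf_J f = ereal m"
    by (cases "inf_J f") auto
qed

text \<open>In the compact set of functionals given by the mass bound, the conditions that the payoff of y be at
least -(inf J + 1/(n+1)) are closed, and finitely many of them hold at an almost minimising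
measure. A functional satisfying all of them is an optimal measure.\<close>

lemma optimal_measure_exists:
  assumes f: "f \<in> Adm \<Omega> c"
  shows "M_opt \<Omega> c f \<noteq> {}"
proof -
  note d = Adm_infimum(1)[OF f]
  obtain m where m: "inf_J f = ereal m"
    using Adm_infimum(2)[OF f] by blast
  obtain k where k: "\<And>M. carried M \<Longrightarrow> total_J \<Omega> c f (measure M) \<le> ereal (m + 1) \<Longrightarrow> measure M (closure \<Omega>) \<le> k"
    using total_J_mass_bound[OF d] by blast
  let ?P = "functionals k"
  let ?S = "\<lambda>(y, n::nat). {L. - (m + 1 / Suc n) \<le> payoff f L y}"
  have "?P \<inter> (\<Inter>i\<in>strategies \<times> UNIV. ?S i) \<noteq> {}"
  proof (rule compact_imp_fip_image[OF compact_bounded_functionals[OF compact_closure_\<Omega>]])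
    show "closed (?S i)" if "i \<in> strategies \<times> UNIV" for i
      by (cases i) (auto intro!: closed_Collect_le continuous_on_const continuous_payoff)
    fix I :: "((('a \<Rightarrow> real) \<times> ('a \<Rightarrow> real) \<times> ('a \<Rightarrow> real)) \<times> nat) set"
    assume I: "finite I" "I \<subseteq> strategies \<times> UNIV"
    define n where "n = Max (insert 0 (snd ` I))"
    have n: "j \<le> n" if "(y, j) \<in> I" for y j
      unfolding n_def using I that by (intro Max_ge) (auto intro: rev_image_eqI)
    have "inf_J f < ereal (m + 1 / Suc n)"
      unfolding m by simp
    then obtain \<nu> where \<nu>: "\<nu> \<in> pos_measures_in (closure \<Omega>)" "total_J \<Omega> c f \<nu> < ereal (m + 1 / Suc n)"
      by (auto simp: INF_less_iff)
    then obtain M where M: "\<nu> = measure M" "carried M" using pos_measures_iff_carried by blast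
    have J: "total_J \<Omega> c f (measure M) \<le> ereal (m + 1 / Suc n)" using \<nu> M by simp
    also have "\<dots> \<le> ereal (m + 1)" by simp
    finally have "functional_of M \<in> ?P" using k M(2) by (intro functional_of_bounded) auto
    moreover have "functional_of M \<in> ?S i" if i: "i \<in> I" for i
    proof -
      obtain y j where yj: "i = (y, j)" by (cases i)
      hence y: "y \<in> strategies" and j: "j \<le> n" using i I n by auto
      have "1 / real (Suc n) \<le> 1 / real (Suc j)" using j by (simp add: field_simps)
      moreover have "- (m + 1 / real (Suc n)) \<le> payoff f (functional_of M) y"
        using J y total_J_le_iff[OF M(2)] by blast
      ultimately show ?thesis by (simp add: yj)
    qed
    ultimately show "?P \<inter> (\<Inter>i\<in>I. ?S i) \<noteq> {}" by blast
  qed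
  then obtain L where L: "L \<in> ?P" "\<And>y n. y \<in> strategies \<Longrightarrow> - (m + 1 / Suc n) \<le> payoff f L y" by auto
  obtain M where M: "carried M" "L = functional_of M" using bounded_functional_measure[OF L(1)] by blast
  have "- m \<le> payoff f (functional_of M) y" if y: "y \<in> strategies" for y
  proof -
    have "(\<lambda>n. - (m + 1 / real (Suc n))) \<longlonglongrightarrow> - (m + 0)"
      by (intro tendsto_minus tendsto_add tendsto_const LIMSEQ_Suc lim_1_over_n)
    from LIMSEQ_le_const2[OF this, of "payoff f L y"] show ?thesis using L(2)[OF y] M(2) by auto
  qed
  hence "total_J \<Omega> c f (measure M) \<le> ereal m" using total_J_le_iff[OF M(1)] by blast
  moreover have pos: "measure M \<in> pos_measures_in (closure \<Omega>)" using M(1) pos_measures_iff_carried by blast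
  moreover have "ereal m \<le> total_J \<Omega> c f (measure M)" unfolding m[symmetric] by (rule INF_lower[OF pos])
  ultimately have "measure M \<in> M_opt \<Omega> c f" by (simp add: M_opt_def m)
  thus ?thesis by blast
qed

text \<open>Testing with M shows that the right side is at least -m. If it exceeded some v > -m, the minimax
alternative would give either a measure with J \<le> -v < m, or a strategy whose payoff, and hence
energy minus cost, is at most v for all competitors.\<close>

lemma inf_sup_eq:
  assumes f: "distribution f" and m: "inf_J f = ereal m"
    and M: "carried M" and opt: "total_J \<Omega> c f (measure M) = ereal m" and k: "measure M (closure \<Omega>) \<le> real k"
  shows "(INF u\<in>test_functions \<Omega>. ereal (energy_F f (measure M) u) - cost_functional \<Omega> c (measure M)) = ereal (- m)"
    (is "?l = _")
    "(INF u\<in>test_functions \<Omega>. SUP \<mu>\<in>K_pos \<Omega> k. ereal (energy_F f \<mu> u) - cost_functional \<Omega> c \<mu>) = ereal (- m)"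
    (is "?R = _")
proof -
  let ?F = "\<lambda>u. ereal (energy_F f (measure M) u)" and ?C = "cost_functional \<Omega> c (measure M)"
  let ?E = "INF u\<in>test_functions \<Omega>. ?F u"
  have J: "- ?E + ?C = ereal m" using opt by (simp add: total_J_carried[OF M])
  obtain \<gamma> where \<gamma>: "?C = ereal \<gamma>" using J cost_functional_nonneg[of "measure M"] by (cases ?C) auto
  have E: "?E = ereal (\<gamma> - m)" using J unfolding \<gamma> by (cases ?E) auto
  have ge: "ereal (- m) \<le> ?F u - ?C" if u: "u \<in> test_functions \<Omega>" for u
  proof -
    have "ereal (\<gamma> - m) \<le> ?F u" unfolding E[symmetric] by (rule INF_lower[OF u])
    thus ?thesis by (simp add: \<gamma>)
  qed
  show "?l = ereal (- m)"
  proof (rule antisym)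
    show "ereal (- m) \<le> ?l" by (rule INF_greatest) (rule ge)
    show "?l \<le> ereal (- m)"
    proof (rule ccontr)
      assume "\<not> ?thesis"
      hence "ereal (- m) < ?l" by (rule not_le_imp_less)
      from ereal_dense2[OF this]
      obtain v where v: "- m < v" "ereal v < ?l" by auto
      have "ereal (v + \<gamma>) \<le> ?E"
      proof (rule INF_greatest)
        fix u assume "u \<in> test_functions \<Omega>"
        hence "ereal v \<le> ?F u - ?C" using v(2) by (meson INF_lower less_imp_le order_trans)
        thus "ereal (v + \<gamma>) \<le> ?F u" by (simp add: \<gamma>)
      qed
      thus False using v(1) by (simp add: E)
    qed
  qed
  show "?R = ereal (- m)"
  proof (rule antisym)
    have "measure M \<in> K_pos \<Omega> k" using M k pos_measures_iff_carried by (auto simp: K_pos_def)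
    thus "ereal (- m) \<le> ?R"
      by (intro INF_greatest) (rule SUP_upper2, assumption, rule ge)
    show "?R \<le> ereal (- m)"
    proof (rule ccontr)
      assume "\<not> ?thesis"
      hence "ereal (- m) < ?R" by (rule not_le_imp_less)
      from ereal_dense2[OF this] obtain v where v: "- m < v" "ereal v < ?R" by auto
      from strategies_minimax[OF f, of "real k" v] show False
      proof (elim disjE bexE)
        fix L assume L: "L \<in> functionals (real k)" "\<forall>y\<in>strategies. v \<le> payoff f L y"
        obtain M' where M': "carried M'" "L = functional_of M'" using bounded_functional_measure[OF L(1)] by blast
        have "total_J \<Omega> c f (measure M') \<le> ereal (- v)"
          using L(2) M' by (simp add: total_J_le_iff)
        moreover have "ereal m \<le> total_J \<Omega> c f (measure M')"
          unfolding m[symmetric] using M' pos_measures_iff_carried by (intro INF_lower) blast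
        ultimately have "ereal m \<le> ereal (- v)" by (rule order_trans[rotated])
        thus False using v(1) by simp
      next
        fix y assume y: "y \<in> strategies" "\<forall>L\<in>functionals (real k). payoff f L y \<le> v"
        obtain u \<phi> b where u\<phi>b: "y = (u, \<phi>, b)" "u \<in> test_functions \<Omega>" "(\<phi>, b) \<in> minorants"
          using y(1) by (auto simp: strategies_def)
        have "?R \<le> (SUP \<mu>\<in>K_pos \<Omega> k. ereal (energy_F f \<mu> u) - cost_functional \<Omega> c \<mu>)"
          by (rule INF_lower[OF u\<phi>b(2)])
        also have "\<dots> \<le> ereal v"
        proof (rule SUP_least)
          fix \<mu> assume "\<mu> \<in> K_pos \<Omega> k"
          then obtain M' where M': "\<mu> = measure M'" "carried M'" "measure M' (closure \<Omega>) \<le> real k"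
            by (auto simp: K_pos_def pos_measures_iff_carried)
          have "ereal (energy_F f \<mu> u) - cost_functional \<Omega> c \<mu> \<le> ereal (payoff f (functional_of M') y)"
            unfolding M'(1) u\<phi>b(1) by (rule energy_minus_cost_le_payoff[OF M'(2) u\<phi>b(2,3)])
          also have "\<dots> \<le> ereal v" using y(2) functional_of_bounded[OF M'(2,3)] by simp
          finally show "ereal (energy_F f \<mu> u) - cost_functional \<Omega> c \<mu> \<le> ereal v" .
        qed
        finally show False using v(2) by simp
      qed
    qed
  qed
qed

end

theorem theorem3p3:
  fixes \<Omega> :: "'a::euclidean_space set"
    and c :: "'a \<Rightarrow> real \<Rightarrow> ereal"
    and f :: "('a \<Rightarrow> real) \<Rightarrow> real"
  assumes "bounded_lipschitz_domain \<Omega>"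
    and "cost_function \<Omega> c"
    and "f \<in> Adm \<Omega> c"
  shows "M_opt \<Omega> c f \<noteq> {} \<and>
    (\<exists>k\<^sub>0::real. 0 < k\<^sub>0 \<and>
      (\<forall>\<mu>opt\<in>M_opt \<Omega> c f. \<forall>k::nat. k\<^sub>0 \<le> real k \<longrightarrow>
        (INF u\<in>test_functions \<Omega>.
           ereal (energy_F f \<mu>opt u) - cost_functional \<Omega> c \<mu>opt) =
        (INF u\<in>test_functions \<Omega>. SUP \<mu>\<in>K_pos \<Omega> k.
           ereal (energy_F f \<mu> u) - cost_functional \<Omega> c \<mu>)))"
proof -
  interpret cost_setting \<Omega> c using assms(1,2) by unfold_locales
  note d = Adm_infimum(1)[OF assms(3)]
  obtain m where m: "inf_J f = ereal m"
    using Adm_infimum(2)[OF assms(3)] by blast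
  obtain k where k: "\<And>M. carried M \<Longrightarrow> total_J \<Omega> c f (measure M) \<le> ereal m \<Longrightarrow> measure M (closure \<Omega>) \<le> k"
    using total_J_mass_bound[OF d] by blast
  have "(INF u\<in>test_functions \<Omega>. ereal (energy_F f \<mu>opt u) - cost_functional \<Omega> c \<mu>opt) =
      (INF u\<in>test_functions \<Omega>. SUP \<mu>\<in>K_pos \<Omega> n. ereal (energy_F f \<mu> u) - cost_functional \<Omega> c \<mu>)"
    if \<mu>: "\<mu>opt \<in> M_opt \<Omega> c f" and n: "max 1 k \<le> real n" for \<mu>opt n
  proof -
    obtain M where M: "\<mu>opt = measure M" "carried M"
      using \<mu> pos_measures_iff_carried by (auto simp: M_opt_def)
    have J: "total_J \<Omega> c f (measure M) = ereal m" using \<mu> by (simp add: M_opt_def m M(1))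
    hence "measure M (closure \<Omega>) \<le> real n" using k[OF M(2)] n by simp
    from inf_sup_eq[OF d m M(2) J this] show ?thesis by (simp add: M(1))
  qed
  moreover have "0 < max 1 k" by simp
  ultimately show ?thesis using optimal_measure_exists[OF assms(3)] by blast
qed

end
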